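(* Let $\delta>0$, $r\ge0$, and let $u_0$ be a nonnegative function in $W^{1,2}(-1,1)$. For $\varepsilon>0$ let $u_\varepsilon$ be the global nonnegative strong solution (in the sense given in the context, on $[0,\infty)$) of $$\partial_t u_\varepsilon=\delta\,\partial_{xx}^2u_\varepsilon-\partial_x(u_\varepsilon\,\varphi_\varepsilon)+r\,u_\varepsilon\,(1-u_\varepsilon),\qquad -\varepsilon\,\partial_{xx}^2\varphi_\varepsilon+\varphi_\varepsilon=-\partial_x u_\varepsilon,\qquad x\in(-1,1),\ t>0,$$ $$\partial_xu_\varepsilon(t,\pm1)=\varphi_\varepsilon(t,\pm1)=0,\ t>0,\qquad u_\varepsilon(0,x)=u_0(x),\ x\in(-1,1).$$ Then, for all $T>0$, $$\lim_{\varepsilon\to0}\int_0^T\|u_\varepsilon(t)-u(t)\|_2^2\,dt=0,$$ where $u$ is the unique (nonnegative) solution to $$\partial_tu=\partial_{xx}^2\left(\delta\,u+\tfrac12u^2\right)+r\,u\,(1-u),\quad x\in(-1,1),\ t>0,$$ $$u(0,x)=u_0(x),\ x\in(-1,1),\qquad \partial_xu(t,\pm1)=0,\ t>0.$$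
   Context: $\|\cdot\|_2$ is the norm of $L^2(-1,1)$. Strong solution on $[0,T)$, $T\in(0,\infty]$, of the $\varepsilon$-problem: a function $u_\varepsilon\in C([0,T),W^{1,2}(-1,1))\cap C((0,T),W^{2,2}(-1,1))$ such that the first equation holds a.e. in $[0,T)\times(-1,1)$, $u_\varepsilon(0,\cdot)=u_0$ a.e. in $(-1,1)$, $\partial_xu_\varepsilon(t,\pm1)=0$ for a.e. $t\in[0,T)$, where for each $t\in[0,T)$, $\varphi_\varepsilon(t)$ is the unique solution in $W^{2,2}(-1,1)$ of $-\varepsilon\,\partial_{xx}^2\varphi_\varepsilon(t)+\varphi_\varepsilon(t)=-\partial_xu_\varepsilon(t)$ a.e. in $(-1,1)$, $\varphi_\varepsilon(t,\pm1)=0$. For every $\varepsilon>0$ such a solution on $[0,\infty)$ exists, is unique and is nonnegative. Since $\delta+u>0$ for $u\ge0$, the limit problem is uniformly parabolic and has a unique nonnegative solution; solution is understood in the classical sense (continuous on $[0,\infty)\times[-1,1]$, $C^1$ in $t$ and $C^2$ in $x$ for $t>0$). *)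

theory Defs
  imports "HOL-Analysis.Analysis"
begin

section \<open>Test functions and weak derivatives\<close>

primrec C_k :: "nat \<Rightarrow> ('a::euclidean_space \<Rightarrow> real) \<Rightarrow> bool" where
  "C_k 0 f \<longleftrightarrow> continuous_on UNIV f"
| "C_k (Suc k) f \<longleftrightarrow>
     (\<forall>x. f differentiable at x) \<and>
     (\<forall>b\<in>Basis. C_k k (\<lambda>x. frechet_derivative f (at x) b))"

definition test_function :: "'a::euclidean_space set \<Rightarrow> ('a \<Rightarrow> real) \<Rightarrow> bool" where
  "test_function \<Omega> \<psi> \<longleftrightarrow>
     (\<forall>k. C_k k \<psi>) \<and> (\<exists>K. compact K \<and> K \<subseteq> \<Omega> \<and> (\<forall>x. x \<notin> K \<longrightarrow> \<psi> x = 0))"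

definition locally_integrable :: "'a::euclidean_space set \<Rightarrow> ('a \<Rightarrow> real) \<Rightarrow> bool" where
  "locally_integrable \<Omega> f \<longleftrightarrow>
     (\<forall>K. compact K \<and> K \<subseteq> \<Omega> \<longrightarrow> set_integrable lebesgue K f)"

text \<open>\<open>has_weak_deriv \<Omega> b f g\<close>: on the open set \<open>\<Omega>\<close>, the distributional derivative of \<open>f\<close> in
  the direction \<open>b\<close> is the function \<open>g\<close>. Such a \<open>g\<close> is unique only up to null sets.\<close>

definition has_weak_deriv ::
    "'a::euclidean_space set \<Rightarrow> 'a \<Rightarrow> ('a \<Rightarrow> real) \<Rightarrow> ('a \<Rightarrow> real) \<Rightarrow> bool" where
  "has_weak_deriv \<Omega> b f g \<longleftrightarrow>
     locally_integrable \<Omega> f \<and> locally_integrable \<Omega> g \<and>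
     (\<forall>\<psi>. test_function \<Omega> \<psi> \<longrightarrow>
        (LINT x:\<Omega>|lebesgue. f x * frechet_derivative \<psi> (at x) b)
          = - (LINT x:\<Omega>|lebesgue. g x * \<psi> x))"

section \<open>The spaces \<open>L\<^sup>2(-1,1)\<close> and \<open>W\<^sup>k\<^sup>,\<^sup>2(-1,1)\<close>\<close>

text \<open>Elements of these spaces are represented by functions, and only their values almost
  everywhere in \<open>(-1,1)\<close> matter.\<close>

abbreviation dom_I :: "real set" where
  "dom_I \<equiv> {-1<..<1}"

definition L2 :: "(real \<Rightarrow> real) \<Rightarrow> bool" where
  "L2 f \<longleftrightarrow> f \<in> borel_measurable (lebesgue_on dom_I) \<and>
            integrable (lebesgue_on dom_I) (\<lambda>x. (f x)\<^sup>2)"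

definition L2_norm :: "(real \<Rightarrow> real) \<Rightarrow> real" where
  "L2_norm f = sqrt (LINT x|lebesgue_on dom_I. (f x)\<^sup>2)"

primrec sobolev :: "nat \<Rightarrow> (real \<Rightarrow> real) \<Rightarrow> bool" where
  "sobolev 0 f \<longleftrightarrow> L2 f"
| "sobolev (Suc k) f \<longleftrightarrow> L2 f \<and> (\<exists>g. has_weak_deriv dom_I 1 f g \<and> sobolev k g)"

text \<open>The choice of the representative of the weak derivative does not affect the norms below.\<close>

definition weak_deriv :: "(real \<Rightarrow> real) \<Rightarrow> real \<Rightarrow> real" where
  "weak_deriv f = (SOME g. has_weak_deriv dom_I 1 f g)"

primrec sobolev_sqnorm :: "nat \<Rightarrow> (real \<Rightarrow> real) \<Rightarrow> real" where
  "sobolev_sqnorm 0 f = (L2_norm f)\<^sup>2"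
| "sobolev_sqnorm (Suc k) f = (L2_norm f)\<^sup>2 + sobolev_sqnorm k (weak_deriv f)"

definition sobolev_norm :: "nat \<Rightarrow> (real \<Rightarrow> real) \<Rightarrow> real" where
  "sobolev_norm k f = sqrt (sobolev_sqnorm k f)"

text \<open>\<open>u \<in> C(J, W\<^sup>k\<^sup>,\<^sup>2(-1,1))\<close>\<close>

definition continuous_sobolev :: "nat \<Rightarrow> real set \<Rightarrow> (real \<Rightarrow> real \<Rightarrow> real) \<Rightarrow> bool" where
  "continuous_sobolev k J u \<longleftrightarrow>
     (\<forall>t\<in>J. sobolev k (u t)) \<and>
     (\<forall>s\<in>J. ((\<lambda>t. sobolev_norm k (\<lambda>x. u t x - u s x)) \<longlongrightarrow> 0) (at s within J))"

text \<open>Boundary values: elements of \<open>W\<^sup>1\<^sup>,\<^sup>2(-1,1)\<close> are evaluated at \<open>\<plusminus>1\<close> through their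
  continuous representative on \<open>[-1,1]\<close>.\<close>

definition has_boundary_value :: "(real \<Rightarrow> real) \<Rightarrow> real \<Rightarrow> real \<Rightarrow> bool" where
  "has_boundary_value f a c \<longleftrightarrow>
     (\<exists>g. continuous_on {-1..1} g \<and> (AE x in lebesgue_on dom_I. f x = g x) \<and> g a = c)"

section \<open>The \<open>\<epsilon>\<close>-problem\<close>

text \<open>\<open>\<phi>\<close> is the solution in \<open>W\<^sup>2\<^sup>,\<^sup>2(-1,1)\<close> of \<open>-\<epsilon> \<phi>'' + \<phi> = f\<close>, \<open>\<phi>(\<plusminus>1) = 0\<close>
  (determined almost everywhere by \<open>f\<close>).\<close>

definition elliptic_solution :: "real \<Rightarrow> (real \<Rightarrow> real) \<Rightarrow> (real \<Rightarrow> real) \<Rightarrow> bool" where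
  "elliptic_solution \<epsilon> f \<phi> \<longleftrightarrow>
     sobolev 2 \<phi> \<and>
     (\<exists>\<phi>x \<phi>xx. has_weak_deriv dom_I 1 \<phi> \<phi>x \<and> has_weak_deriv dom_I 1 \<phi>x \<phi>xx \<and>
        (AE x in lebesgue_on dom_I. - \<epsilon> * \<phi>xx x + \<phi> x = f x)) \<and>
     has_boundary_value \<phi> (-1) 0 \<and> has_boundary_value \<phi> 1 0"

text \<open>Strong solutions on \<open>[0,T)\<close>, \<open>T \<in> (0,\<infinity>]\<close>. The time derivative \<open>ut\<close> is the
  distributional one on \<open>(0,T) \<times> (-1,1)\<close>; an almost everywhere pointwise derivative would
  admit spurious solutions that are singular in time. The space derivatives are the weak
  derivatives at fixed time, with representatives chosen jointly in \<open>(t,x)\<close>; \<open>Fx\<close> stands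
  for \<open>\<partial>\<^sub>x(u \<phi>)\<close>.\<close>

definition strong_solution ::
    "real \<Rightarrow> real \<Rightarrow> real \<Rightarrow> ereal \<Rightarrow> (real \<Rightarrow> real) \<Rightarrow> (real \<Rightarrow> real \<Rightarrow> real) \<Rightarrow> bool" where
  "strong_solution \<delta> r \<epsilon> T u0 u \<longleftrightarrow>
     (let J = {t. 0 \<le> t \<and> ereal t < T}; J' = {t. 0 < t \<and> ereal t < T} in
       continuous_sobolev 1 J u \<and>
       continuous_sobolev 2 J' u \<and>
       (AE x in lebesgue_on dom_I. u 0 x = u0 x) \<and>
       (\<exists>ut ux uxx \<phi> Fx.
          has_weak_deriv (J' \<times> dom_I) (1, 0) (\<lambda>(t, x). u t x) (\<lambda>(t, x). ut t x) \<and>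
          (\<forall>t\<in>J. has_weak_deriv dom_I 1 (u t) (ux t)) \<and>
          (\<forall>t\<in>J. elliptic_solution \<epsilon> (\<lambda>x. - ux t x) (\<phi> t)) \<and>
          (\<forall>t\<in>J'. has_weak_deriv dom_I 1 (ux t) (uxx t)) \<and>
          (\<forall>t\<in>J'. has_weak_deriv dom_I 1 (\<lambda>x. u t x * \<phi> t x) (Fx t)) \<and>
          (AE t in lebesgue_on J. has_boundary_value (ux t) (-1) 0 \<and>
                                  has_boundary_value (ux t) 1 0) \<and>
          (AE (t, x) in lebesgue_on (J \<times> dom_I).
             ut t x = \<delta> * uxx t x - Fx t x + r * u t x * (1 - u t x))))"

section \<open>The limit problem\<close>

text \<open>Classical solutions on \<open>[0,\<infinity>)\<close>: continuous on \<open>[0,\<infinity>) \<times> [-1,1]\<close>, with \<open>\<partial>\<^sub>tu\<close>, \<open>\<partial>\<^sub>xu\<close>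
  and \<open>\<partial>\<^sub>x\<^sub>xu\<close> existing and continuous on \<open>(0,\<infinity>) \<times> [-1,1]\<close> (one-sided in \<open>x\<close> at
  \<open>x = \<plusminus>1\<close>). The initial condition is imposed almost everywhere because \<open>u0\<close> need not be
  the continuous representative of its class.\<close>

definition limit_solution ::
    "real \<Rightarrow> real \<Rightarrow> (real \<Rightarrow> real) \<Rightarrow> (real \<Rightarrow> real \<Rightarrow> real) \<Rightarrow> bool" where
  "limit_solution \<delta> r u0 u \<longleftrightarrow>
     continuous_on ({0..} \<times> {-1..1}) (\<lambda>(t, x). u t x) \<and>
     (AE x in lebesgue_on dom_I. u 0 x = u0 x) \<and>
     (\<exists>ut ux uxx.
        continuous_on ({0<..} \<times> {-1..1}) (\<lambda>(t, x). ut t x) \<and>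
        continuous_on ({0<..} \<times> {-1..1}) (\<lambda>(t, x). ux t x) \<and>
        continuous_on ({0<..} \<times> {-1..1}) (\<lambda>(t, x). uxx t x) \<and>
        (\<forall>t>0. \<forall>x\<in>{-1..1}.
           ((\<lambda>s. u s x) has_real_derivative ut t x) (at t) \<and>
           ((\<lambda>y. u t y) has_real_derivative ux t x) (at x within {-1..1}) \<and>
           ((\<lambda>y. ux t y) has_real_derivative uxx t x) (at x within {-1..1})) \<and>
        (\<forall>t>0. \<forall>x\<in>dom_I.
           ut t x = deriv (deriv (\<lambda>y. \<delta> * u t y + (u t y)\<^sup>2 / 2)) x
                      + r * u t x * (1 - u t x)) \<and>
        (\<forall>t>0. ux t (-1) = 0 \<and> ux t 1 = 0))"

end

theory Submission
  imports Defs
begin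

text \<open>
  Fix \<open>\<epsilon> > 0\<close>, write \<open>v\<close> for the solution of the \<open>\<epsilon>\<close>-problem with potential \<open>\<phi>\<close>, and put
  \<open>w = v - \<epsilon> \<phi>\<^sub>x\<close>. The elliptic equation says \<open>w\<^sub>x = - \<phi>\<close>, hence \<open>- \<epsilon> w\<^sub>x\<^sub>x + w = v\<close> with
  \<open>w\<^sub>x = 0\<close> at \<open>\<plusminus>1\<close>, and \<open>w \<ge> 0\<close> by the maximum principle (\<open>neumann_resolvent_nonneg\<close>).
  In one space dimension the drift is then an exact derivative,
  \<open>v \<phi> = - ((w\<^sup>2 - \<epsilon> \<phi>\<^sup>2) / 2)\<^sub>x\<close>, so that \<open>v\<close> solves
  \<open>v\<^sub>t = (\<delta> v + (w\<^sup>2 - \<epsilon> \<phi>\<^sup>2) / 2)\<^sub>x\<^sub>x + r v (1 - v)\<close>, which has the shape of the limit equation.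

  The difference \<open>z = v - u\<close> is therefore measured in a norm dual to that of \<open>W\<^sup>1\<^sup>,\<^sup>2\<close>: with
  \<open>m = \<integral> z\<close> and \<open>Z(x) = \<integral>\<^bsub>-1\<^esub>\<^bsup>x\<^esup> z - (x + 1) m / 2\<close> take \<open>y = \<integral> Z\<^sup>2 + m\<^sup>2\<close>. Differentiation in
  time produces \<open>- \<delta> \<integral> z\<^sup>2 - \<integral> G z\<close> with \<open>G = (w\<^sup>2 - \<epsilon> \<phi>\<^sup>2 - u\<^sup>2) / 2\<close>. Inserting
  \<open>z = (w - u) + \<epsilon> \<phi>\<^sub>x\<close> and integrating by parts, every term without a sign is completed to a square,
  and \<open>- \<integral> G z \<le> (\<epsilon> / 2) \<integral> u u\<^sub>x\<^sup>2\<close> (\<open>flux_dissipation\<close>). What remains, namely the mean of \<open>G\<close>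
  and the reaction, is at most \<open>C y + C \<surd>y (\<integral> z\<^sup>2 + \<epsilon> \<integral> u\<^sub>x\<^sup>2)\<close> up to small multiples of
  \<open>\<integral> z\<^sup>2 + \<epsilon> \<integral> u\<^sub>x\<^sup>2\<close> (\<open>dissipation\<close>). As long as \<open>y\<close> is small this gives
  \<open>y' + \<delta> \<integral> z\<^sup>2 \<le> a \<epsilon> \<integral> u\<^sub>x\<^sup>2 + C y\<close>. Since \<open>y\<close> starts at \<open>0\<close> and \<open>\<integral>\<integral> u\<^sub>x\<^sup>2\<close> is finite by the energy
  identity for \<open>u\<close>, a continuity argument shows that for small \<open>\<epsilon>\<close> it stays small on all of
  \<open>[0,T]\<close> (\<open>gronwall_bootstrap\<close>), and then \<open>\<integral>\<^bsub>0\<^esub>\<^bsup>T\<^esup> \<parallel>v - u\<parallel>\<^sub>2\<^sup>2 \<le> C \<epsilon>\<close> (\<open>convergence_rate\<close>), with a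
  constant that depends on \<open>u\<close>, \<open>\<delta>\<close>, \<open>r\<close> and \<open>T\<close> alone.

  To differentiate \<open>y\<close>, the weak formulation has to be turned into a classical one. At each time
  \<open>t > 0\<close> the functions \<open>v\<close>, \<open>v\<^sub>x\<close> and \<open>\<phi>\<close> have continuous representatives, which by the Sobolev
  inequality and the maximum principle are jointly continuous in \<open>(t,x)\<close>. Testing the
  distributional equation with products of smoothed indicator functions of a time interval and of a
  space interval shows that \<open>\<integral>\<^bsub>-1\<^esub>\<^bsup>x\<^esup> v\<close> has the classical time derivative
  \<open>\<delta> v\<^sub>x - v \<phi> + \<integral>\<^bsub>-1\<^esub>\<^bsup>x\<^esup> r v (1 - v)\<close> (\<open>strong_solution_classical\<close>). This is all that the
  computation above asks of the evolution equation, because \<open>y\<close> depends on \<open>v\<close> through such primitives.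
\<close>

section \<open>Smooth cut-off functions on the line\<close>

lemma frechet_derivative_real:
  fixes f :: "real \<Rightarrow> real"
  assumes "(f has_real_derivative d) (at x)"
  shows "frechet_derivative f (at x) 1 = d"
proof -
  have "(*) d = frechet_derivative f (at x)"
    using assms by (intro frechet_derivative_at) (simp add: has_field_derivative_def)
  from fun_cong[OF this, of 1] show ?thesis by simp
qed

text \<open>
  On the line the Frechet derivative in the only basis direction is the ordinary derivative; in
  this form smoothness of one-variable functions can be proved by induction on the order.
\<close>

lemma C_k_Suc_real:
  fixes f :: "real \<Rightarrow> real"
  shows "C_k (Suc k) f \<longleftrightarrow> (\<exists>f'. (\<forall>x. (f has_real_derivative f' x) (at x)) \<and> C_k k f')"
proof
  assume *: "C_k (Suc k) f"
  then have "(f has_real_derivative frechet_derivative f (at x) 1) (at x)" for x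
    using frechet_derivative_real by (fastforce simp: real_differentiable_def)
  with * show "\<exists>f'. (\<forall>x. (f has_real_derivative f' x) (at x)) \<and> C_k k f'"
    by (intro exI[of _ "\<lambda>x. frechet_derivative f (at x) 1"]) auto
next
  assume "\<exists>f'. (\<forall>x. (f has_real_derivative f' x) (at x)) \<and> C_k k f'"
  then obtain f' where d: "\<And>x. (f has_real_derivative f' x) (at x)" and c: "C_k k f'" by auto
  have "frechet_derivative f (at x) 1 = f' x" for x
    by (rule frechet_derivative_real[OF d])
  then show "C_k (Suc k) f"
    using c d by (auto simp: real_differentiable_def)
qed

lemma C_k_mono:
  fixes f :: "real \<Rightarrow> real"
  shows "C_k (Suc k) f \<Longrightarrow> C_k k f"
proof (induction k arbitrary: f)
  case 0
  then show ?case unfolding C_k_Suc_real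
    by (auto intro!: continuous_at_imp_continuous_on intro: DERIV_isCont)
next
  case (Suc k)
  then show ?case by (metis C_k_Suc_real)
qed

lemma C_k_add:
  fixes f g :: "real \<Rightarrow> real"
  shows "C_k k f \<Longrightarrow> C_k k g \<Longrightarrow> C_k k (\<lambda>x. f x + g x)"
proof (induction k arbitrary: f g)
  case 0
  then show ?case by (auto intro: continuous_on_add)
next
  case (Suc k)
  then obtain f' g' where "\<And>x. (f has_real_derivative f' x) (at x)" "C_k k f'"
    "\<And>x. (g has_real_derivative g' x) (at x)" "C_k k g'"
    unfolding C_k_Suc_real by metis
  then show ?case unfolding C_k_Suc_real
    by (intro exI[of _ "\<lambda>x. f' x + g' x"] conjI Suc.IH) (auto intro: DERIV_add)
qed

lemma C_k_mult:
  fixes f g :: "real \<Rightarrow> real"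
  shows "C_k k f \<Longrightarrow> C_k k g \<Longrightarrow> C_k k (\<lambda>x. f x * g x)"
proof (induction k arbitrary: f g)
  case 0
  then show ?case by (auto intro: continuous_on_mult)
next
  case (Suc k)
  then obtain f' g' where *: "\<And>x. (f has_real_derivative f' x) (at x)" "C_k k f'"
    "\<And>x. (g has_real_derivative g' x) (at x)" "C_k k g'"
    unfolding C_k_Suc_real by metis
  have "C_k k f" "C_k k g" using Suc.prems by (auto intro: C_k_mono)
  with * show ?case unfolding C_k_Suc_real
    by (intro exI[of _ "\<lambda>x. f' x * g x + g' x * f x"] conjI Suc.IH C_k_add)
       (auto intro!: DERIV_mult)
qed

lemma C_k_const: "C_k k (\<lambda>x::real. c)"
proof (induction k arbitrary: c)
  case (Suc k)
  show ?case unfolding C_k_Suc_real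
    by (intro exI[of _ "\<lambda>x. 0"] conjI Suc.IH) auto
qed auto

lemma C_k_affine:
  fixes f :: "real \<Rightarrow> real"
  shows "C_k k f \<Longrightarrow> C_k k (\<lambda>x. f (n * x + d))"
proof (induction k arbitrary: f)
  case 0
  then show ?case by (auto intro!: continuous_intros intro: continuous_on_compose2)
next
  case (Suc k)
  then obtain f' where *: "\<And>x. (f has_real_derivative f' x) (at x)" "C_k k f'"
    unfolding C_k_Suc_real by metis
  have "((\<lambda>x. f (n * x + d)) has_real_derivative f' (n * x + d) * n) (at x)" for x
    by (rule DERIV_chain2[OF *(1)]) (auto intro!: derivative_eq_intros)
  moreover have "C_k k (\<lambda>x. f' (n * x + d) * n)"
    by (rule C_k_mult[OF Suc.IH[OF *(2)] C_k_const])
  ultimately show ?case unfolding C_k_Suc_real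
    by (intro exI[of _ "\<lambda>x. f' (n * x + d) * n"]) simp
qed

text \<open>
  Products \<open>a(t) b(x)\<close> are all the test functions of two variables that are used:
  their partial derivatives are again of this form.
\<close>

lemma C_k_tensor:
  fixes a b :: "real \<Rightarrow> real"
  shows "C_k k a \<Longrightarrow> C_k k b \<Longrightarrow> C_k k (\<lambda>(t, x). a t * b x)"
    and has_derivative_tensor:
      "(a has_real_derivative a') (at t) \<Longrightarrow> (b has_real_derivative b') (at x) \<Longrightarrow>
       ((\<lambda>(t, x). a t * b x) has_derivative (\<lambda>(s, y). a' * s * b x + a t * b' * y)) (at (t, x))"
proof -
  show D: "((\<lambda>(t, x). a t * b x) has_derivative (\<lambda>(s, y). a' * s * b x + a t * b' * y)) (at (t, x))"
    if "(a has_real_derivative a') (at t)" "(b has_real_derivative b') (at x)" for a b :: "real \<Rightarrow> real" and a' b' t x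
  proof -
    have 1: "((\<lambda>p. a (fst p)) has_derivative (\<lambda>p. a' * fst p)) (at (t, x))"
      using has_derivative_compose[OF has_derivative_fst[OF has_derivative_ident], of a "\<lambda>h. a' * h" "(t, x)" UNIV]
        that(1) by (simp add: has_field_derivative_def)
    have 2: "((\<lambda>p. b (snd p)) has_derivative (\<lambda>p. b' * snd p)) (at (t, x))"
      using has_derivative_compose[OF has_derivative_snd[OF has_derivative_ident], of b "\<lambda>h. b' * h" "(t, x)" UNIV]
        that(2) by (simp add: has_field_derivative_def)
    show ?thesis using has_derivative_mult[OF 1 2]
      by (simp add: case_prod_unfold algebra_simps)
  qed
  show "C_k k a \<Longrightarrow> C_k k b \<Longrightarrow> C_k k (\<lambda>(t, x). a t * b x)"
  proof (induction k arbitrary: a b)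
    case 0
    then show ?case
      by (auto simp: case_prod_unfold intro!: continuous_intros intro: continuous_on_compose2)
  next
    case (Suc k)
    then obtain a' b' where *: "\<And>x. (a has_real_derivative a' x) (at x)" "C_k k a'"
      "\<And>x. (b has_real_derivative b' x) (at x)" "C_k k b'"
      unfolding C_k_Suc_real by metis
    have ab: "C_k k a" "C_k k b" using Suc.prems by (auto intro: C_k_mono)
    note d = D[OF *(1) *(3)]
    have e: "frechet_derivative (\<lambda>(t, x). a t * b x) (at p) =
        (\<lambda>(s, y). a' (fst p) * s * b (snd p) + a (fst p) * b' (snd p) * y)" for p
      using frechet_derivative_at[OF d[of "fst p" "snd p"]] by (simp add: fun_eq_iff)
    have "(\<lambda>p. frechet_derivative (\<lambda>(t, x). a t * b x) (at p) (1, 0)) = (\<lambda>(t, x). a' t * b x)"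
      "(\<lambda>p. frechet_derivative (\<lambda>(t, x). a t * b x) (at p) (0, 1)) = (\<lambda>(t, x). a t * b' x)"
      unfolding e by auto
    moreover have "(\<lambda>(t, x). a t * b x) differentiable (at p)" for p
      using d[of "fst p" "snd p"] unfolding differentiable_def by auto
    ultimately show ?case using Suc.IH[OF *(2) ab(2)] Suc.IH[OF ab(1) *(4)]
      by (auto simp: Basis_prod_def)
  qed
qed

definition flat_exp :: "real poly \<Rightarrow> real \<Rightarrow> real" where
  "flat_exp p x = (if x > 0 then poly p (1 / x) * exp (- (1 / x)) else 0)"

lemma flat_exp_tendsto_0: "(flat_exp p \<longlongrightarrow> 0) (at 0)"
proof -
  have "((\<lambda>y. poly p y * exp (- y)) \<longlongrightarrow> (\<Sum>i\<le>degree p. coeff p i * 0)) at_top"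
  proof -
    have "((\<lambda>y. \<Sum>i\<le>degree p. coeff p i * (y ^ i / exp y)) \<longlongrightarrow> (\<Sum>i\<le>degree p. coeff p i * 0)) at_top"
      by (intro tendsto_intros tendsto_power_div_exp_0)
    then show ?thesis
      by (simp add: poly_altdef sum_distrib_right exp_minus divide_inverse mult.assoc)
  qed
  then have "((\<lambda>y. poly p y * exp (- y)) \<longlongrightarrow> 0) at_top" by simp
  then have "((\<lambda>x. poly p (inverse x) * exp (- inverse x)) \<longlongrightarrow> 0) (at_right 0)"
    using filterlim_inverse_at_top_right by (rule filterlim_compose)
  then have r: "(flat_exp p \<longlongrightarrow> 0) (at_right 0)"
    by (rule Lim_transform_eventually)
       (auto simp: flat_exp_def inverse_eq_divide eventually_at_filter)
  have "(flat_exp p \<longlongrightarrow> 0) (at_left 0)"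
    by (rule Lim_transform_eventually[OF tendsto_const])
       (auto simp: flat_exp_def eventually_at_filter)
  with r show ?thesis by (simp add: filterlim_at_split)
qed

text \<open>
  The functions \<open>p(1/x) exp(- 1/x)\<close>, extended by \<open>0\<close> to \<open>x \<le>
  0\<close>, are closed under differentiation, because the exponential beats every polynomial in
  \<open>1/x\<close> at \<open>0\<close>; hence all of them are smooth.
\<close>

lemma flat_exp_has_derivative:
  "(flat_exp p has_real_derivative flat_exp ([:0, 0, 1:] * (p - pderiv p)) x) (at x)"
proof (cases x "0 :: real" rule: linorder_cases)
  case greater
  have "((\<lambda>x. poly p (1 / x) * exp (- (1 / x))) has_real_derivative
       flat_exp ([:0, 0, 1:] * (p - pderiv p)) x) (at x)"
    by (rule derivative_eq_intros DERIV_chain2[OF poly_DERIV] refl | use greater in force)+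
       (use greater in \<open>simp add: flat_exp_def field_simps power2_eq_square\<close>)
  then show ?thesis
    by (rule has_field_derivative_transform_within_open[of _ _ _ "{0<..}"])
       (use greater in \<open>auto simp: flat_exp_def\<close>)
next
  case less
  have "((\<lambda>x. 0) has_real_derivative flat_exp ([:0, 0, 1:] * (p - pderiv p)) x) (at x)"
    using less by (auto simp: flat_exp_def)
  then show ?thesis
    by (rule has_field_derivative_transform_within_open[of _ _ _ "{..<0}"])
       (use less in \<open>auto simp: flat_exp_def\<close>)
next
  case equal
  have "((\<lambda>h. flat_exp p h / h) \<longlongrightarrow> 0) (at 0)"
    by (rule Lim_transform_eventually[OF flat_exp_tendsto_0[of "[:0,1:] * p"]])
       (auto simp: flat_exp_def eventually_at_filter)
  with equal show ?thesis
    by (simp add: has_field_derivative_def DERIV_def[unfolded has_field_derivative_def] flat_exp_def)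
qed

lemma C_k_flat_exp: "C_k k (flat_exp p)"
proof (induction k arbitrary: p)
  case 0
  show ?case
    by (auto intro!: continuous_at_imp_continuous_on intro: DERIV_isCont flat_exp_has_derivative)
next
  case (Suc k)
  then show ?case unfolding C_k_Suc_real using flat_exp_has_derivative by blast
qed

lemma antiderivative_vanishing_left:
  fixes f :: "real \<Rightarrow> real"
  assumes c: "continuous_on UNIV f" and 0: "\<And>x. x \<le> 0 \<Longrightarrow> f x = 0"
  shows "\<exists>F. (\<forall>x. (F has_real_derivative f x) (at x)) \<and> (\<forall>x\<le>0. F x = 0)"
proof -
  have "isCont f x" for x using c by (simp add: continuous_on_eq_continuous_at)
  then obtain F where F: "\<And>x. (F has_vector_derivative f x) (at x)"
    using einterval_antiderivative[of "-\<infinity>" "\<infinity>" f] by auto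
  then have F: "(F has_real_derivative f x) (at x)" for x
    by (simp add: has_real_derivative_iff_has_vector_derivative)
  have "F x = F 0" if "x \<le> 0" for x
  proof (cases "x = 0")
    case False
    with that have "x < 0" by simp
    then have "F 0 = F x"
    proof (rule DERIV_isconst_end)
      show "continuous_on {x..0} F" by (meson DERIV_isCont F continuous_at_imp_continuous_on)
      show "(F has_real_derivative 0) (at z)" if "x < z" "z < 0" for z
        using F[of z] 0[of z] that by simp
    qed
    then show ?thesis by simp
  qed simp
  then have "\<forall>x\<le>0. F x - F 0 = 0" unfolding right_minus_eq by blast
  \<comment> \<open>The primitive is normalised at \<open>0\<close>, so it vanishes wherever \<open>f\<close> vanishes to the left.\<close>
  moreover have "((\<lambda>x. F x - F 0) has_real_derivative f x) (at x)" for x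
    using DERIV_diff[OF F[of x] DERIV_const[of "F 0"]] by simp
  ultimately show ?thesis by (intro exI[of _ "\<lambda>x. F x - F 0"]) blast
qed

text \<open>
  The product of two flat exponentials is a bump on \<open>(0,1)\<close>; a smooth step is its
  normalised primitive.
\<close>

lemma smooth_step_exists:
  "\<exists>P :: real \<Rightarrow> real. (\<forall>k. C_k k P) \<and> mono P \<and> (\<forall>x\<le>0. P x = 0) \<and> (\<forall>x\<ge>1. P x = (1::real))"
proof -
  define b where "b x = flat_exp 1 x * flat_exp 1 (1 - x)" for x
  have bk: "C_k k b" for k
    using C_k_mult[OF C_k_flat_exp C_k_affine[OF C_k_flat_exp, of k 1 "-1" 1], of 1]
    by (simp add: b_def[abs_def] algebra_simps)
  have b0: "b x = 0" if "x \<le> 0 \<or> x \<ge> 1" for x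
    using that by (auto simp: b_def flat_exp_def)
  have bp: "b x \<ge> 0" for x by (simp add: b_def flat_exp_def)
  obtain F where F: "\<And>x. (F has_real_derivative b x) (at x)" and F0: "\<And>x. x \<le> 0 \<Longrightarrow> F x = 0"
    using antiderivative_vanishing_left[of b] bk[of 0] b0 unfolding C_k.simps(1) by blast
  have mono: "F x \<le> F y" if "x \<le> y" for x y
    using that by (rule DERIV_nonneg_imp_nondecreasing) (use F bp in blast)
  have F1: "F x = F 1" if "x \<ge> 1" for x
  proof (cases "x = 1")
    case False
    with that have "1 < x" by simp
    then show ?thesis
    proof (rule DERIV_isconst_end)
      show "continuous_on {1..x} F" by (meson DERIV_isCont F continuous_at_imp_continuous_on)
      show "(F has_real_derivative 0) (at z)" if "1 < z" "z < x" for z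
        using F[of z] b0[of z] that by simp
    qed
  qed simp
  have "F 1 > 0"
  proof -
    have "F 1 \<ge> 0" using mono[of 0 1] F0[of 0] by simp
    moreover have "F 1 \<noteq> 0"
    proof
      assume "F 1 = 0"
      then have "F x = 0" if "x \<in> {0<..<1}" for x
        using mono[of 0 x] mono[of x 1] that F0[of 0] by simp
      then have "(F has_real_derivative 0) (at (1/2))"
        by (intro has_field_derivative_transform_within_open[of "\<lambda>x. 0" 0 "1/2" "{0<..<1}" F]) auto
      with F[of "1/2"] have "b (1/2) = 0" by (rule DERIV_unique)
      then show False by (simp add: b_def flat_exp_def)
    qed
    ultimately show ?thesis by simp
  qed
  define P where "P x = F x / F 1" for x
  have "C_k k P" for k
  proof (rule C_k_mono)
    have "(P has_real_derivative b x * (1 / F 1)) (at x)" for x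
      using DERIV_cdivide[OF F[of x], of "F 1"] by (simp add: P_def[abs_def])
    then show "C_k (Suc k) P"
      unfolding C_k_Suc_real using C_k_mult[OF bk[of k] C_k_const[of k "1 / F 1"]]
      by (intro exI[of _ "\<lambda>x. b x * (1 / F 1)"]) simp
  qed
  moreover have "mono P" using mono \<open>F 1 > 0\<close> by (auto simp: P_def mono_def divide_right_mono)
  moreover have "P x = 0" if "x \<le> 0" for x using F0[OF that] by (simp add: P_def)
  moreover have "P x = 1" if "x \<ge> 1" for x using F1[OF that] \<open>F 1 > 0\<close> by (simp add: P_def)
  ultimately show ?thesis by (intro exI[of _ P]) blast
qed

definition smooth_step :: "real \<Rightarrow> real" where
  "smooth_step = (SOME P. (\<forall>k. C_k k P) \<and> mono P \<and> (\<forall>x\<le>0. P x = 0) \<and> (\<forall>x\<ge>1. P x = 1))"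

lemma
  shows C_k_smooth_step: "C_k k smooth_step"
    and mono_smooth_step: "mono smooth_step"
    and smooth_step_0: "x \<le> 0 \<Longrightarrow> smooth_step x = 0"
    and smooth_step_1: "x \<ge> 1 \<Longrightarrow> smooth_step x = 1"
proof -
  have P: "(\<forall>k. C_k k smooth_step) \<and> mono smooth_step
      \<and> (\<forall>x\<le>0. smooth_step x = 0) \<and> (\<forall>x\<ge>1. smooth_step x = 1)"
    unfolding smooth_step_def by (rule someI_ex[OF smooth_step_exists])
  from P show "C_k k smooth_step" by blast
  from P show "mono smooth_step" by blast
  from P show "x \<le> 0 \<Longrightarrow> smooth_step x = 0" by blast
  from P show "x \<ge> 1 \<Longrightarrow> smooth_step x = 1" by blast
qed

lemma smooth_step_bounds: "0 \<le> smooth_step x" "smooth_step x \<le> 1"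
proof -
  show "0 \<le> smooth_step x"
    using monoD[OF mono_smooth_step, of "min x 0" x] smooth_step_0[of "min x 0"] by simp
  show "smooth_step x \<le> 1"
    using monoD[OF mono_smooth_step, of x "max x 1"] smooth_step_1[of "max x 1"] by simp
qed

lemma smooth_step_has_derivative: "(smooth_step has_real_derivative deriv smooth_step x) (at x)"
proof -
  obtain f' where "\<And>x. (smooth_step has_real_derivative f' x) (at x)"
    using C_k_smooth_step[of "Suc 0"] unfolding C_k_Suc_real by blast
  from this[of x] show ?thesis by (simp add: DERIV_imp_deriv)
qed

lemma continuous_deriv_smooth_step: "continuous_on UNIV (deriv smooth_step)"
proof -
  obtain f' where f': "\<And>x. (smooth_step has_real_derivative f' x) (at x)" "continuous_on UNIV f'"
    using C_k_smooth_step[of "Suc 0"] unfolding C_k_Suc_real by auto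
  then have "deriv smooth_step = f'" by (auto simp: fun_eq_iff intro: DERIV_imp_deriv)
  with f' show ?thesis by simp
qed

lemma deriv_smooth_step_nonneg: "deriv smooth_step x \<ge> 0"
proof (rule ccontr)
  assume "\<not> ?thesis"
  then obtain d where "d > 0" "\<And>h. 0 < h \<Longrightarrow> h < d \<Longrightarrow> smooth_step x > smooth_step (x + h)"
    using DERIV_neg_dec_right[OF smooth_step_has_derivative, of x] by auto
  from this(2)[of "d/2"] this(1) monoD[OF mono_smooth_step, of x "x + d/2"] show False by simp
qed

lemma deriv_smooth_step_eq_0: "x < 0 \<or> x > 1 \<Longrightarrow> deriv smooth_step x = 0"
proof (elim disjE)
  assume "x < 0"
  then have "(smooth_step has_real_derivative 0) (at x)"
    by (intro has_field_derivative_transform_within_open[of "\<lambda>x. 0" 0 x "{..<0}" smooth_step]) (auto simp: smooth_step_0)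
  then show ?thesis by (rule DERIV_imp_deriv)
next
  assume "x > 1"
  then have "(smooth_step has_real_derivative 0) (at x)"
    by (intro has_field_derivative_transform_within_open[of "\<lambda>x. 1" 0 x "{1<..}" smooth_step]) (auto simp: smooth_step_1)
  then show ?thesis by (rule DERIV_imp_deriv)
qed

text \<open>
  A smooth version of the positive part \<open>max x 0\<close>.
\<close>

definition smooth_ramp :: "real \<Rightarrow> real" where
  "smooth_ramp = (SOME Q. (\<forall>x. (Q has_real_derivative smooth_step x) (at x)) \<and> (\<forall>x\<le>0. Q x = 0))"

lemma
  shows smooth_ramp_has_derivative: "(smooth_ramp has_real_derivative smooth_step x) (at x)"
    and smooth_ramp_0: "x \<le> 0 \<Longrightarrow> smooth_ramp x = 0"
proof -
  have "continuous_on UNIV smooth_step" using C_k_smooth_step[of 0] by simp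
  from someI_ex[OF antiderivative_vanishing_left[OF this smooth_step_0]]
  show "(smooth_ramp has_real_derivative smooth_step x) (at x)" "x \<le> 0 \<Longrightarrow> smooth_ramp x = 0"
    unfolding smooth_ramp_def by blast+
qed

lemma C_k_smooth_ramp: "C_k k smooth_ramp"
proof (rule C_k_mono)
  show "C_k (Suc k) smooth_ramp" unfolding C_k_Suc_real
    using smooth_ramp_has_derivative C_k_smooth_step by metis
qed

lemma smooth_ramp_lipschitz: "\<bar>smooth_ramp x - smooth_ramp y\<bar> \<le> \<bar>x - y\<bar>"
proof -
  have "smooth_ramp x \<le> smooth_ramp y \<and> smooth_ramp y - smooth_ramp x \<le> y - x" if "x \<le> y" for x y
  proof -
    have "smooth_ramp x \<le> smooth_ramp y"
      using that by (rule DERIV_nonneg_imp_nondecreasing)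
        (use smooth_ramp_has_derivative smooth_step_bounds in blast)
    moreover have "smooth_ramp y - y \<le> smooth_ramp x - x"
    proof (rule DERIV_nonpos_imp_nonincreasing[OF that])
      fix z show "\<exists>D. ((\<lambda>y. smooth_ramp y - y) has_real_derivative D) (at z) \<and> D \<le> 0"
        by (intro exI[of _ "smooth_step z - 1"] conjI derivative_intros smooth_ramp_has_derivative)
           (use smooth_step_bounds in auto)
    qed
    ultimately show ?thesis by simp
  qed
  from this[of x y] this[of y x] show ?thesis by (cases "x \<le> y") auto
qed

lemma smooth_ramp_shift: "x \<ge> 1 \<Longrightarrow> smooth_ramp x = smooth_ramp 1 + (x - 1)"
proof (cases "x = 1")
  case False
  assume "x \<ge> 1"
  with False have "1 < x" by simp
  then have "smooth_ramp x - x = smooth_ramp 1 - 1"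
  proof (rule DERIV_isconst_end)
    show "continuous_on {1..x} (\<lambda>x. smooth_ramp x - x)"
      by (intro continuous_intros continuous_at_imp_continuous_on ballI)
         (rule DERIV_isCont[OF smooth_ramp_has_derivative])
    fix z assume "1 < z" "z < x"
    then show "((\<lambda>x. smooth_ramp x - x) has_real_derivative 0) (at z)"
      by (auto intro!: derivative_eq_intros smooth_ramp_has_derivative simp: smooth_step_1)
  qed
  then show ?thesis by simp
qed simp

lemma smooth_ramp_approx: "\<bar>smooth_ramp x - max x 0\<bar> \<le> 1"
proof (cases "x \<ge> 1")
  case False
  have "smooth_ramp 0 \<le> smooth_ramp x" if "0 \<le> x"
    using that by (rule DERIV_nonneg_imp_nondecreasing)
      (use smooth_ramp_has_derivative smooth_step_bounds in blast)
  with False smooth_ramp_lipschitz[of x 0] smooth_ramp_0[of x] smooth_ramp_0[of 0] show ?thesis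
    by (cases "x \<le> 0") auto
next
  case True
  have "smooth_ramp 0 \<le> smooth_ramp 1"
    by (rule DERIV_nonneg_imp_nondecreasing)
      (use smooth_ramp_has_derivative smooth_step_bounds in auto)
  with True smooth_ramp_shift[of x] smooth_ramp_lipschitz[of 1 0] smooth_ramp_0[of 0]
  show ?thesis by auto
qed

section \<open>Weak derivatives on an interval\<close>

definition trapezoid :: "real \<Rightarrow> real \<Rightarrow> real \<Rightarrow> real \<Rightarrow> real" where
  "trapezoid n p q x = smooth_step (n * (x - p)) - smooth_step (n * (x - q))"

lemma C_k_trapezoid: "C_k k (trapezoid n p q)"
proof -
  have "C_k k (\<lambda>x. smooth_step (n * x + (- n * p)) + (-1) * smooth_step (n * x + (- n * q)))"
    by (intro C_k_add C_k_mult C_k_const C_k_affine C_k_smooth_step)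
  then show ?thesis by (simp add: trapezoid_def[abs_def] algebra_simps)
qed

lemma trapezoid_has_derivative:
  "(trapezoid n p q has_real_derivative
     n * deriv smooth_step (n * (x - p)) - n * deriv smooth_step (n * (x - q))) (at x)"
proof -
  have *: "((\<lambda>x. smooth_step (n * (x - p))) has_real_derivative deriv smooth_step (n * (x - p)) * n) (at x)" for p
    by (rule DERIV_chain2[OF smooth_step_has_derivative]) (auto intro!: derivative_eq_intros)
  show ?thesis unfolding trapezoid_def[abs_def]
    using DERIV_diff[OF *[of p] *[of q]] by (simp add: mult.commute)
qed

lemma trapezoid_bounds:
  assumes "n > 0" "p \<le> q"
  shows "0 \<le> trapezoid n p q x" "trapezoid n p q x \<le> 1"
proof -
  have "n * (x - q) \<le> n * (x - p)" using assms by simp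
  from monoD[OF mono_smooth_step this] show "0 \<le> trapezoid n p q x"
    by (simp add: trapezoid_def)
  show "trapezoid n p q x \<le> 1"
    using smooth_step_bounds[of "n * (x - p)"] smooth_step_bounds[of "n * (x - q)"]
    unfolding trapezoid_def by linarith
qed

lemma trapezoid_eq_0:
  assumes "n > 0" "p \<le> q" "x \<notin> {p..q + 1 / n}"
  shows "trapezoid n p q x = 0"
proof (cases "x < p")
  case True
  then have "n * (x - p) \<le> 0" "n * (x - q) \<le> 0" using assms by (auto simp: mult_le_0_iff)
  then show ?thesis by (simp add: trapezoid_def smooth_step_0)
next
  case False
  with assms have "x > q + 1 / n" by auto
  then have "x - q \<ge> 1 / n" "x - p \<ge> 1 / n" using assms by auto
  then have "n * (x - q) \<ge> 1" "n * (x - p) \<ge> 1" using assms by (auto simp: field_simps)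
  then show ?thesis by (simp add: trapezoid_def smooth_step_1)
qed

lemma continuous_on_trapezoid: "continuous_on A (trapezoid n p q)"
  using C_k_trapezoid[of 0 n p q] continuous_on_subset[of UNIV "trapezoid n p q" A] by simp

lemma test_function_trapezoid:
  assumes "n > 0" "p \<le> q" "{p..q + 1 / n} \<subseteq> \<Omega>"
  shows "test_function \<Omega> (trapezoid n p q)"
  unfolding test_function_def
  using C_k_trapezoid trapezoid_eq_0[OF assms(1,2)] assms(3)
  by (intro conjI allI exI[of _ "{p..q + 1 / n}"]) auto

lemma smooth_step_scale_tendsto:
  "(\<lambda>k. smooth_step (real (k + N) * x)) \<longlonglongrightarrow> indicator {0<..} x"
proof (cases "x > 0")
  case False
  then have "real (k + N) * x \<le> 0" for k by (simp add: mult_nonneg_nonpos)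
  with False show ?thesis by (simp add: smooth_step_0)
next
  case True
  have "eventually (\<lambda>k. real (k + N) * x \<ge> 1) sequentially"
  proof -
    obtain K where "real K * x > 1" using reals_Archimedean3[OF True] by blast
    then have "real (k + N) * x \<ge> 1" if "k \<ge> K" for k
      using mult_right_mono[of "real K" "real (k + N)" x] that True by linarith
    then show ?thesis unfolding eventually_sequentially by blast
  qed
  then have "eventually (\<lambda>k. smooth_step (real (k + N) * x) = 1) sequentially"
    by eventually_elim (simp add: smooth_step_1)
  with True show ?thesis by (simp add: tendsto_eventually)
qed

text \<open>
  The smoothed indicator functions increase from \<open>0\<close> to \<open>1\<close> to the
  right of \<open>p\<close> and decrease to the right of \<open>q\<close>, which fixes the
  half-open limit.
\<close>

lemma trapezoid_tendsto:
  assumes "p \<le> q"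
  shows "(\<lambda>k. trapezoid (real (k + N)) p q x) \<longlonglongrightarrow> indicator {p<..q} x"
proof -
  have "(\<lambda>k. trapezoid (real (k + N)) p q x) \<longlonglongrightarrow> indicator {0<..} (x - p) - indicator {0<..} (x - q)"
    unfolding trapezoid_def by (intro tendsto_diff smooth_step_scale_tendsto)
  moreover have "indicator {0<..} (x - p) - indicator {0<..} (x - q) = (indicator {p<..q} x :: real)"
    using assms by (auto simp: indicator_def)
  ultimately show ?thesis by simp
qed

lemma smooth_ramp_scale_tendsto:
  "(\<lambda>k. smooth_ramp (real (k + N) * x) / real (k + N)) \<longlonglongrightarrow> max x 0"
proof -
  have lim: "(\<lambda>k. 1 / real (k + N)) \<longlonglongrightarrow> 0"
    using LIMSEQ_ignore_initial_segment[OF lim_inverse_n, of N] by (simp add: inverse_eq_divide)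
  have ev: "eventually (\<lambda>k. norm (smooth_ramp (real (k + N) * x) / real (k + N) - max x 0) \<le> 1 / real (k + N)) sequentially"
    using eventually_gt_at_top[of "0::nat"]
  proof eventually_elim
    case (elim k)
    then have n: "real (k + N) > 0" by simp
    have "smooth_ramp (real (k + N) * x) / real (k + N) - max x 0
        = (smooth_ramp (real (k + N) * x) - max (real (k + N) * x) 0) / real (k + N)"
      using n by (auto simp: max_def diff_divide_distrib zero_le_mult_iff mult_le_0_iff)
    then show ?case
      using smooth_ramp_approx[of "real (k + N) * x"] n by (simp add: divide_right_mono)
  qed
  have "(\<lambda>k. smooth_ramp (real (k + N) * x) / real (k + N) - max x 0) \<longlonglongrightarrow> 0"
    by (rule Lim_null_comparison[OF ev lim])
  then show ?thesis by (rule LIM_zero_cancel)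
qed

lemma borel_measurable_lebesgueI:
  fixes f :: "'a::euclidean_space \<Rightarrow> real"
  assumes "f \<in> borel_measurable borel" shows "f \<in> borel_measurable lebesgue"
  using assms by (intro measurable_completion) simp

text \<open>
  Dominated convergence for test functions with a common compact support, against a function
  that is only locally integrable.
\<close>

lemma tendsto_integral_test:
  fixes h :: "real \<Rightarrow> real"
  assumes h: "locally_integrable \<Omega> h" and K: "compact K" "K \<subseteq> \<Omega>"
    and m: "\<And>n::nat. \<psi> n \<in> borel_measurable borel"
    and b: "\<And>n x. \<bar>\<psi> n x\<bar> \<le> C * indicator K x"
    and l: "\<And>x. (\<lambda>n. \<psi> n x) \<longlonglongrightarrow> \<psi>' x"
  shows "(\<lambda>n. LINT x:\<Omega>|lebesgue. h x * \<psi> n x) \<longlonglongrightarrow> (LINT x:\<Omega>|lebesgue. h x * \<psi>' x)"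
proof -
  have hK: "integrable lebesgue (\<lambda>x. indicator K x * h x)"
    using h K by (auto simp: locally_integrable_def set_integrable_def)
  have m': "\<psi>' \<in> borel_measurable borel"
    using m l by (rule borel_measurable_LIMSEQ_real[rotated])
  have b': "\<psi> n x = 0" if "x \<notin> K" for n x using b[of n x] that by simp
  have b'': "\<psi>' x = 0" if "x \<notin> K" for x
    using l[of x] b'[OF that] by (simp add: LIMSEQ_const_iff)
  have e: "(LINT x:\<Omega>|lebesgue. h x * f x) = (LINT x|lebesgue. (indicator K x * h x) * f x)"
    if "\<And>x. x \<notin> K \<Longrightarrow> f x = 0" for f :: "real \<Rightarrow> real"
    unfolding set_lebesgue_integral_def
    by (intro Bochner_Integration.integral_cong refl)
       (use that K(2) in \<open>force simp: indicator_def\<close>)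
  have e1: "(LINT x:\<Omega>|lebesgue. h x * \<psi> n x) = (LINT x|lebesgue. (indicator K x * h x) * \<psi> n x)" for n
    by (rule e) (rule b')
  have e2: "(LINT x:\<Omega>|lebesgue. h x * \<psi>' x) = (LINT x|lebesgue. (indicator K x * h x) * \<psi>' x)"
    by (rule e) (rule b'')
  show ?thesis
    unfolding e1 e2
  proof (rule integral_dominated_convergence[where w = "\<lambda>x. C * \<bar>indicator K x * h x\<bar>"])
    show "(\<lambda>x. indicator K x * h x * \<psi>' x) \<in> borel_measurable lebesgue"
      by (rule borel_measurable_times[OF borel_measurable_integrable[OF hK] borel_measurable_lebesgueI[OF m']])
    show "(\<lambda>x. indicator K x * h x * \<psi> n x) \<in> borel_measurable lebesgue" for n
      by (rule borel_measurable_times[OF borel_measurable_integrable[OF hK] borel_measurable_lebesgueI[OF m]])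
    show "integrable lebesgue (\<lambda>x. C * \<bar>indicator K x * h x\<bar>)"
      using hK by (intro integrable_mult_right integrable_abs)
    show "AE x in lebesgue. (\<lambda>n. indicator K x * h x * \<psi> n x) \<longlonglongrightarrow> indicator K x * h x * \<psi>' x"
      by (intro AE_I2 tendsto_mult_left l)
    show "AE x in lebesgue. norm (indicator K x * h x * \<psi> n x) \<le> C * \<bar>indicator K x * h x\<bar>" for n
    proof (intro AE_I2)
      fix x
      have "norm (indicator K x * h x * \<psi> n x) = \<bar>indicator K x * h x\<bar> * \<bar>\<psi> n x\<bar>"
        by (simp add: abs_mult)
      also have "\<dots> \<le> \<bar>indicator K x * h x\<bar> * (C * indicator K x)"
        by (intro mult_left_mono b) auto
      also have "\<dots> = C * \<bar>indicator K x * h x\<bar>" by (auto simp: indicator_def)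
      finally show "norm (indicator K x * h x * \<psi> n x) \<le> C * \<bar>indicator K x * h x\<bar>" .
    qed
  qed
qed

lemma locally_integrable_Icc:
  fixes h :: "real \<Rightarrow> real"
  assumes "locally_integrable \<Omega> h" "{p..q} \<subseteq> \<Omega>"
  shows "h absolutely_integrable_on {p..q}" "h integrable_on {p..q}"
  using assms by (auto simp: locally_integrable_def set_lebesgue_integral_eq_integral(1))

lemma integral_indicator_Ioc:
  fixes h :: "real \<Rightarrow> real"
  assumes "locally_integrable \<Omega> h" "{p..q} \<subseteq> \<Omega>"
  shows "(LINT x:\<Omega>|lebesgue. h x * indicator {p<..q} x) = integral {p..q} h"
proof -
  have "x \<in> \<Omega>" if "x \<in> {p<..q}" for x using assms(2) that by auto
  then have "(LINT x:\<Omega>|lebesgue. h x * indicator {p<..q} x) = (LINT x:{p<..q}|lebesgue. h x)"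
    unfolding set_lebesgue_integral_def
    by (intro Bochner_Integration.integral_cong refl) (auto simp: indicator_def)
  also have "\<dots> = integral {p<..q} h"
    by (intro set_lebesgue_integral_eq_integral(2)
          set_integrable_subset[OF locally_integrable_Icc(1)[OF assms]]) auto
  also have "\<dots> = integral {p..q} h"
    by (intro integral_spike_set) (auto intro!: negligible_subset[OF negligible_sing[of p]])
  finally show ?thesis .
qed

text \<open>
  Lebesgue differentiation applies to functions that are integrable on every box, so it is used
  for the cut-offs of \<open>h\<close> to an exhaustion of the interval by compact intervals.
\<close>

lemma AE_lebesgue_points:
  assumes h: "locally_integrable dom_I h"
  obtains N where "negligible N"
    "\<And>x. x \<in> dom_I \<Longrightarrow> x \<notin> N \<Longrightarrow>
       (\<lambda>m. integral {x..x + 1 / real (Suc m)} h * real (Suc m)) \<longlonglongrightarrow> h x"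
proof -
  define I where "I k = {- 1 + 1 / real (Suc k)..1 - 1 / real (Suc k)}" for k
  \<comment> \<open>Cut-offs that are integrable on the whole line.\<close>
  define H where "H k x = (if x \<in> I k then h x else 0)" for k x
  have I: "I k \<subseteq> dom_I" for k
  proof
    fix x assume "x \<in> I k"
    moreover have "1 / real (Suc k) > 0" by simp
    ultimately show "x \<in> dom_I"
      unfolding I_def atLeastAtMost_iff greaterThanLessThan_iff by linarith
  qed
  have "h integrable_on I k" for k
    using locally_integrable_Icc(2)[OF h] I[of k] unfolding I_def by blast
  then have "H k integrable_on cbox a b" for k a b
    unfolding H_def by (intro integrable_on_subcbox[of _ UNIV]) (auto simp: integrable_restrict_UNIV)
  then have "\<exists>N. negligible N \<and> (\<forall>x e. x \<notin> N \<longrightarrow> 0 < e \<longrightarrow>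
      (\<exists>d>0. \<forall>t. 0 < t \<and> t < d \<longrightarrow> norm (integral (cbox x (x + t *\<^sub>R One)) (H k) /\<^sub>R t ^ DIM(real) - H k x) < e))" for k
    by (rule integrable_ccontinuous_explicit[of "H k"]) blast
  then obtain N where N: "\<And>k. negligible (N k)" and
    L: "\<And>k x e. x \<notin> N k \<Longrightarrow> 0 < e \<Longrightarrow>
      (\<exists>d>0. \<forall>t. 0 < t \<and> t < d \<longrightarrow> norm (integral (cbox x (x + t *\<^sub>R One)) (H k) /\<^sub>R t ^ DIM(real) - H k x) < e)"
    by metis
  show thesis
  proof
    show "negligible (\<Union>(range N))"
      by (rule negligible_countable_Union) (use N in auto)
    fix x assume x: "x \<in> dom_I" "x \<notin> \<Union>(range N)"
    define \<eta> where "\<eta> = min (x + 1) (1 - x) / 2"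
    have "\<eta> > 0" using x(1) by (simp add: \<eta>_def)
    then obtain k where k: "1 / real (Suc k) < \<eta>" using nat_approx_posE by blast
    show "(\<lambda>m. integral {x..x + 1 / real (Suc m)} h * real (Suc m)) \<longlonglongrightarrow> h x"
    proof (rule LIMSEQ_I)
      fix e :: real assume "e > 0"
      with L[of x k e] x(2) obtain d where d: "d > 0"
        "\<And>t. 0 < t \<Longrightarrow> t < d \<Longrightarrow> norm (integral (cbox x (x + t *\<^sub>R One)) (H k) /\<^sub>R t ^ DIM(real) - H k x) < e"
        by blast
      obtain M where M: "1 / real (Suc M) < min d \<eta>"
        using nat_approx_posE[of "min d \<eta>"] d(1) \<open>\<eta> > 0\<close> by auto
      show "\<exists>M. \<forall>m\<ge>M. norm (integral {x..x + 1 / real (Suc m)} h * real (Suc m) - h x) < e"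
      proof (intro exI[of _ M] allI impI)
        fix m assume "m \<ge> M"
        then have "1 / real (Suc m) \<le> 1 / real (Suc M)" by (simp add: frac_le)
        define t where "t = 1 / real (Suc m)"
        have t: "0 < t" "t < d" "t < \<eta>" using M \<open>1 / real (Suc m) \<le> 1 / real (Suc M)\<close> by (auto simp: t_def)
        have sub: "{x..x + t} \<subseteq> I k"
          using t k unfolding I_def \<eta>_def by (auto simp del: of_nat_Suc simp: min_def split: if_splits)
        moreover have "x \<in> I k" using sub t(1) by auto
        ultimately have "integral {x..x + t} (H k) = integral {x..x + t} h" "H k x = h x"
          using t(1) by (auto simp: H_def intro!: Henstock_Kurzweil_Integration.integral_cong)
        with d(2)[OF t(1,2)] have "norm (integral {x..x + t} h * (1 / t) - h x) < e"
          by (simp add: divide_inverse mult.commute)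
        moreover have "1 / t = real (Suc m)" by (simp add: t_def)
        ultimately show "norm (integral {x..x + 1 / real (Suc m)} h * real (Suc m) - h x) < e"
          unfolding t_def by metis
      qed
    qed
  qed
qed

lemma trapezoid_scale_exists:
  assumes "q < (b::real)"
  obtains N where "N > 0" "\<And>k. q + 1 / real (k + N) \<le> b"
proof -
  obtain N where N: "1 / real (Suc N) < b - q" using nat_approx_posE[of "b - q"] assms by auto
  show thesis
  proof
    fix k
    have "1 / real (k + Suc N) \<le> 1 / real (Suc N)" by (intro divide_left_mono) auto
    with N show "q + 1 / real (k + Suc N) \<le> b" by linarith
  qed auto
qed

lemma trapezoid_test_tendsto:
  assumes h: "locally_integrable \<Omega> h" and pq: "p \<le> q" "q < b" "{p..b} \<subseteq> \<Omega>"
    and N: "N > 0" "\<And>k. q + 1 / real (k + N) \<le> b"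
  shows "(\<lambda>k. LINT x:\<Omega>|lebesgue. h x * trapezoid (real (k + N)) p q x) \<longlonglongrightarrow> integral {p..q} h"
proof -
  have "(\<lambda>k. LINT x:\<Omega>|lebesgue. h x * trapezoid (real (k + N)) p q x)
      \<longlonglongrightarrow> (LINT x:\<Omega>|lebesgue. h x * indicator {p<..q} x)"
  proof (rule tendsto_integral_test[OF h, of "{p..b}" _ 1])
    show "trapezoid (real (k + N)) p q \<in> borel_measurable borel" for k
      by (intro borel_measurable_continuous_onI continuous_on_trapezoid)
    show "\<bar>trapezoid (real (k + N)) p q x\<bar> \<le> 1 * indicator {p..b} x" for k x
    proof (cases "x \<in> {p..b}")
      case True
      then show ?thesis using trapezoid_bounds[of "real (k + N)" p q x] N(1) pq(1) by simp
    next
      case False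
      with N(2)[of k] have "x \<notin> {p..q + 1 / real (k + N)}" by auto
      then show ?thesis using N(1) pq(1) by (subst trapezoid_eq_0) auto
    qed
    show "(\<lambda>k. trapezoid (real (k + N)) p q x) \<longlonglongrightarrow> indicator {p<..q} x" for x
      by (rule trapezoid_tendsto[OF pq(1)])
  qed (use pq in auto)
  also have "(LINT x:\<Omega>|lebesgue. h x * indicator {p<..q} x) = integral {p..q} h"
    using pq by (intro integral_indicator_Ioc[OF h]) auto
  finally show ?thesis .
qed

lemma AE_lebesgue_on_dom_I_iff:
  "(AE x in lebesgue_on dom_I. P x) \<longleftrightarrow> (AE x in lebesgue. x \<in> dom_I \<longrightarrow> P x)"
  by (subst AE_restrict_space_iff) auto

lemma AE_dom_I_negligible:
  assumes "negligible N" "\<And>x. x \<in> dom_I \<Longrightarrow> x \<notin> N \<Longrightarrow> P x"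
  shows "AE x in lebesgue_on dom_I. P x"
proof -
  have "AE x in lebesgue. x \<notin> N"
    using assms(1) by (simp add: AE_not_in negligible_iff_null_sets)
  then show ?thesis unfolding AE_lebesgue_on_dom_I_iff
    by eventually_elim (use assms(2) in blast)
qed

text \<open>
  The fundamental lemma of the calculus of variations: smoothed indicators show that all
  integrals over intervals vanish, and the values at Lebesgue points are limits of such
  averages.
\<close>

lemma locally_integrable_AE_eq_0:
  assumes h: "locally_integrable dom_I h"
    and 0: "\<And>\<psi>. test_function dom_I \<psi> \<Longrightarrow> (LINT x:dom_I|lebesgue. h x * \<psi> x) = 0"
  shows "AE x in lebesgue_on dom_I. h x = 0"
proof -
  have int: "integral {p..q} h = 0" if pq: "-1 < p" "p \<le> q" "q < 1" for p q
  proof -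
    define b where "b = (q + 1) / 2"
    have b: "q < b" "b < 1" using pq by (auto simp: b_def)
    obtain N where N: "N > 0" "\<And>k. q + 1 / real (k + N) \<le> b"
      using trapezoid_scale_exists[OF b(1)] by blast
    have "(\<lambda>k. LINT x:dom_I|lebesgue. h x * trapezoid (real (k + N)) p q x) \<longlonglongrightarrow> integral {p..q} h"
      by (rule trapezoid_test_tendsto[OF h pq(2) b(1) _ N]) (use pq b in auto)
    moreover have "test_function dom_I (trapezoid (real (k + N)) p q)" for k
      using N(1) N(2)[of k] b pq by (intro test_function_trapezoid) auto
    ultimately show ?thesis using 0 by (simp add: LIMSEQ_const_iff)
  qed
  obtain N where N: "negligible N" "\<And>x. x \<in> dom_I \<Longrightarrow> x \<notin> N \<Longrightarrow>
       (\<lambda>m. integral {x..x + 1 / real (Suc m)} h * real (Suc m)) \<longlonglongrightarrow> h x"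
    using AE_lebesgue_points[OF h] by blast
  show ?thesis
  proof (rule AE_dom_I_negligible[OF N(1)])
    fix x assume x: "x \<in> dom_I" "x \<notin> N"
    obtain M where M: "1 / real (Suc M) < 1 - x" using nat_approx_posE[of "1 - x"] x by auto
    have "eventually (\<lambda>m. integral {x..x + 1 / real (Suc m)} h * real (Suc m) = 0) sequentially"
      unfolding eventually_sequentially
    proof (intro exI[of _ M] allI impI)
      fix m assume "m \<ge> M"
      then have "1 / real (Suc m) \<le> 1 / real (Suc M)" by (simp add: frac_le)
      then show "integral {x..x + 1 / real (Suc m)} h * real (Suc m) = 0"
        using M x by (subst int) auto
    qed
    then have "(\<lambda>m. integral {x..x + 1 / real (Suc m)} h * real (Suc m)) \<longlonglongrightarrow> 0"
      by (rule tendsto_eventually)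
    with N(2)[OF x] show "h x = 0" by (rule LIMSEQ_unique)
  qed
qed


text \<open>
  The primitive of a difference of two smoothed indicators of intervals of length
  \<open>d\<close>; it has compact support since the two intervals are equally long.
\<close>

definition smooth_hat :: "real \<Rightarrow> real \<Rightarrow> real \<Rightarrow> real \<Rightarrow> real \<Rightarrow> real" where
  "smooth_hat n d p q x =
     (smooth_ramp (n * (x - p)) - smooth_ramp (n * (x - p - d))
        - smooth_ramp (n * (x - q)) + smooth_ramp (n * (x - q - d))) / n"

text \<open>
  The limit of the smooth hats as the smoothing parameter tends to infinity.
\<close>

definition hat :: "real \<Rightarrow> real \<Rightarrow> real \<Rightarrow> real \<Rightarrow> real" where
  "hat d p q x = max (x - p) 0 - max (x - p - d) 0 - max (x - q) 0 + max (x - q - d) 0"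

lemma C_k_smooth_hat: "C_k k (smooth_hat n d p q)"
proof -
  have "C_k k (\<lambda>x. (1 / n) * ((smooth_ramp (n * x + (- n * p)) + (-1) * smooth_ramp (n * x + (- n * (p + d))))
      + ((-1) * smooth_ramp (n * x + (- n * q)) + smooth_ramp (n * x + (- n * (q + d))))))"
    by (intro C_k_add C_k_mult C_k_const C_k_affine C_k_smooth_ramp)
  then show ?thesis by (simp add: smooth_hat_def[abs_def] algebra_simps diff_divide_distrib add_divide_distrib)
qed

lemma smooth_hat_has_derivative:
  assumes "n > 0"
  shows "(smooth_hat n d p q has_real_derivative trapezoid n p (p + d) x - trapezoid n q (q + d) x) (at x)"
proof -
  have *: "((\<lambda>x. smooth_ramp (n * (x - p))) has_real_derivative smooth_step (n * (x - p)) * n) (at x)" for p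
    by (rule DERIV_chain2[OF smooth_ramp_has_derivative]) (auto intro!: derivative_eq_intros)
  have "((\<lambda>x. (smooth_ramp (n * (x - p)) - smooth_ramp (n * (x - (p + d)))
        - smooth_ramp (n * (x - q)) + smooth_ramp (n * (x - (q + d)))) / n) has_real_derivative
     (smooth_step (n * (x - p)) * n - smooth_step (n * (x - (p + d))) * n
      - smooth_step (n * (x - q)) * n + smooth_step (n * (x - (q + d))) * n) / n) (at x)"
    by (intro DERIV_cdivide DERIV_add DERIV_diff *)
  moreover have "(smooth_step (n * (x - p)) * n - smooth_step (n * (x - (p + d))) * n
      - smooth_step (n * (x - q)) * n + smooth_step (n * (x - (q + d))) * n) / n
      = trapezoid n p (p + d) x - trapezoid n q (q + d) x"
    using assms by (simp add: trapezoid_def field_simps)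
  ultimately show ?thesis
    unfolding smooth_hat_def[abs_def] diff_diff_eq by metis
qed

lemma smooth_hat_eq_0:
  assumes "n > 0" "p \<le> q" "d \<ge> 0" "x \<notin> {p..q + d + 1 / n}"
  shows "smooth_hat n d p q x = 0"
proof (cases "x < p")
  case True
  then have "n * (x - p) \<le> 0" "n * (x - q) \<le> 0" "n * (x - p - d) \<le> 0" "n * (x - q - d) \<le> 0"
    using assms by (auto simp: mult_le_0_iff)
  then show ?thesis by (simp add: smooth_hat_def smooth_ramp_0)
next
  case False
  with assms have "x > q + d + 1 / n" by auto
  then have "n * (x - s) \<ge> 1" if "s \<le> q + d" for s
    using that assms(1) by (smt (verit) divide_less_eq mult.commute)
  from this[of p] this[of "p + d"] this[of q] this[of "q + d"] assms(2,3)
  have "n * (x - p) \<ge> 1" "n * (x - p - d) \<ge> 1" "n * (x - q) \<ge> 1" "n * (x - q - d) \<ge> 1"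
    by (simp_all add: diff_diff_eq)
  then show ?thesis
    unfolding smooth_hat_def using smooth_ramp_shift[of "n * (x - p)"] smooth_ramp_shift[of "n * (x - p - d)"]
      smooth_ramp_shift[of "n * (x - q)"] smooth_ramp_shift[of "n * (x - q - d)"]
    by (simp add: algebra_simps)
qed

lemma smooth_hat_bound:
  assumes "n > 0" "d \<ge> 0"
  shows "\<bar>smooth_hat n d p q x\<bar> \<le> 2 * d"
proof -
  have *: "\<bar>smooth_ramp (n * (x - s)) - smooth_ramp (n * (x - s - d))\<bar> \<le> n * d" for s
    using smooth_ramp_lipschitz[of "n * (x - s)" "n * (x - s - d)"] assms by (simp add: algebra_simps)
  have "\<bar>smooth_ramp (n * (x - p)) - smooth_ramp (n * (x - p - d))
        - smooth_ramp (n * (x - q)) + smooth_ramp (n * (x - q - d))\<bar> \<le> n * (2 * d)"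
    using *[of p] *[of q] by linarith
  then show ?thesis using assms by (simp add: smooth_hat_def field_simps)
qed

lemma test_function_smooth_hat:
  assumes "n > 0" "p \<le> q" "d \<ge> 0" "{p..q + d + 1 / n} \<subseteq> \<Omega>"
  shows "test_function \<Omega> (smooth_hat n d p q)"
  unfolding test_function_def
  using C_k_smooth_hat smooth_hat_eq_0[OF assms(1-3)] assms(4)
  by (intro conjI allI exI[of _ "{p..q + d + 1 / n}"]) auto

lemma smooth_hat_tendsto:
  "(\<lambda>k. smooth_hat (real (k + N)) d p q x) \<longlonglongrightarrow> hat d p q x"
  unfolding smooth_hat_def hat_def diff_divide_distrib add_divide_distrib
  by (intro tendsto_intros smooth_ramp_scale_tendsto)

lemma hat_eq_0: "p \<le> q \<Longrightarrow> d \<ge> 0 \<Longrightarrow> x \<notin> {p..q + d} \<Longrightarrow> hat d p q x = 0"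
  by (auto simp: hat_def max_def)

lemma hat_bound: "d \<ge> 0 \<Longrightarrow> \<bar>hat d p q x\<bar> \<le> 2 * d"
  by (auto simp: hat_def max_def)

lemma hat_tendsto:
  assumes "p \<le> q"
  shows "(\<lambda>m. hat (1 / real (Suc (m + M))) p q x * real (Suc (m + M))) \<longlonglongrightarrow> indicator {p<..q} x"
proof -
  have *: "(\<lambda>m. (max y 0 - max (y - 1 / real (Suc (m + M))) 0) * real (Suc (m + M))) \<longlonglongrightarrow> indicator {0<..} y" for y :: real
  proof (cases "y > 0")
    case False
    then have "max y 0 = 0" "max (y - 1 / real (Suc (m + M))) 0 = 0" for m
      by (auto simp: max_def intro: order_trans[of y 0])
    with False show ?thesis by simp
  next
    case True
    then obtain K where K: "1 / real (Suc K) < y" using nat_approx_posE by blast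
    have "eventually (\<lambda>m. (max y 0 - max (y - 1 / real (Suc (m + M))) 0) * real (Suc (m + M)) = 1) sequentially"
      unfolding eventually_sequentially
    proof (intro exI[of _ K] allI impI)
      fix m assume "m \<ge> K"
      then have "1 / real (Suc (m + M)) \<le> 1 / real (Suc K)" by (simp add: frac_le)
      with K True have "max y 0 - max (y - 1 / real (Suc (m + M))) 0 = 1 / real (Suc (m + M))" by simp
      then show "(max y 0 - max (y - 1 / real (Suc (m + M))) 0) * real (Suc (m + M)) = 1" by simp
    qed
    with True show ?thesis by (simp add: tendsto_eventually)
  qed
  have "(\<lambda>m. hat (1 / real (Suc (m + M))) p q x * real (Suc (m + M)))
      \<longlonglongrightarrow> indicator {0<..} (x - p) - indicator {0<..} (x - q)"
    using tendsto_diff[OF *[of "x - p"] *[of "x - q"]]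
    by (simp add: hat_def algebra_simps)
  moreover have "indicator {0<..} (x - p) - indicator {0<..} (x - q) = (indicator {p<..q} x :: real)"
    using assms by (auto simp: indicator_def)
  ultimately show ?thesis by simp
qed

text \<open>
  The derivative of a hat function is the difference of the indicator functions of \<open>(p,
  p+d]\<close> and \<open>(q, q+d]\<close>; testing with smoothed hats therefore compares two
  averages of \<open>f\<close>.
\<close>

lemma weak_deriv_pairing_hat:
  assumes w: "has_weak_deriv dom_I 1 f g" and pq: "-1 < p" "p < q" "d > 0" "q + d < 1"
  shows "integral {p..p + d} f - integral {q..q + d} f = - (LINT x:dom_I|lebesgue. g x * hat d p q x)"
proof -
  have f: "locally_integrable dom_I f" and g: "locally_integrable dom_I g"
    and w: "\<And>\<psi>. test_function dom_I \<psi> \<Longrightarrow>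
        (LINT x:dom_I|lebesgue. f x * frechet_derivative \<psi> (at x) 1) = - (LINT x:dom_I|lebesgue. g x * \<psi> x)"
    using w by (auto simp: has_weak_deriv_def)
  define b where "b = (q + d + 1) / 2"
  have b: "q + d < b" "b < 1" using pq by (auto simp: b_def)
  obtain N where N: "N > 0" "\<And>k. q + d + 1 / real (k + N) \<le> b"
    using trapezoid_scale_exists[OF b(1)] by blast
  have N': "\<And>k. p + d + 1 / real (k + N) \<le> b"
    using N(2) pq by (meson add_right_mono less_imp_le order_trans)
  let ?n = "\<lambda>k. real (k + N)"
  have n0: "?n k > 0" for k using N(1) by simp
  have t: "test_function dom_I (smooth_hat (?n k) d p q)" for k
    using n0[of k] N(2)[of k] b pq by (intro test_function_smooth_hat) auto
  have fr: "frechet_derivative (smooth_hat (?n k) d p q) (at x) 1 =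
      trapezoid (?n k) p (p + d) x - trapezoid (?n k) q (q + d) x" for k x
    by (rule frechet_derivative_real[OF smooth_hat_has_derivative[OF n0]])
  have bi: "set_integrable lebesgue dom_I (\<lambda>x. f x * trapezoid (?n k) s (s + d) x)"
    if s: "s = p \<or> s = q" for s k
  proof -
    have K: "{s..b} \<subseteq> dom_I" "s + d + 1 / ?n k \<le> b" using s pq b N(2)[of k] N'[of k] by auto
    have "integrable lebesgue (\<lambda>x. indicator {s..b} x * f x)"
      using f K(1) by (auto simp: locally_integrable_def set_integrable_def)
    then have "integrable lebesgue (\<lambda>x. trapezoid (?n k) s (s + d) x * (indicator {s..b} x * f x))"
    proof (rule Bochner_Integration.integrable_bound)
      show "(\<lambda>x. trapezoid (?n k) s (s + d) x * (indicator {s..b} x * f x)) \<in> borel_measurable lebesgue"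
        by (rule borel_measurable_times[OF borel_measurable_lebesgueI[OF
              borel_measurable_continuous_onI[OF continuous_on_trapezoid]]
              borel_measurable_integrable[OF \<open>integrable lebesgue (\<lambda>x. indicator {s..b} x * f x)\<close>]])
      show "AE x in lebesgue. norm (trapezoid (?n k) s (s + d) x * (indicator {s..b} x * f x))
          \<le> norm (indicator {s..b} x * f x)"
        using trapezoid_bounds[OF n0[of k], of s "s + d"] pq
        by (intro AE_I2) (simp add: abs_mult mult_left_le_one_le)
    qed
    moreover have "trapezoid (?n k) s (s + d) x * (indicator {s..b} x * f x)
        = indicator dom_I x *\<^sub>R (f x * trapezoid (?n k) s (s + d) x)" for x
    proof (cases "x \<in> {s..b}")
      case True
      then have "x \<in> dom_I" using K(1) by blast
      with True show ?thesis by simp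
    next
      case False
      then have "x \<notin> {s..s + d + 1 / ?n k}" using K(2) by auto
      then have "trapezoid (?n k) s (s + d) x = 0"
        using n0[of k] pq by (intro trapezoid_eq_0) auto
      then show ?thesis by simp
    qed
    ultimately show ?thesis unfolding set_integrable_def by (simp only:)
  qed
  have "(\<lambda>k. (LINT x:dom_I|lebesgue. f x * trapezoid (?n k) p (p + d) x)
          - (LINT x:dom_I|lebesgue. f x * trapezoid (?n k) q (q + d) x))
      \<longlonglongrightarrow> integral {p..p + d} f - integral {q..q + d} f"
    by (intro tendsto_diff trapezoid_test_tendsto[OF f, where b = b] N N')
       (use pq b in auto)
  moreover have "(LINT x:dom_I|lebesgue. f x * trapezoid (?n k) p (p + d) x)
          - (LINT x:dom_I|lebesgue. f x * trapezoid (?n k) q (q + d) x)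
       = - (LINT x:dom_I|lebesgue. g x * smooth_hat (?n k) d p q x)" for k
    using w[OF t[of k], unfolded fr right_diff_distrib] set_integral_diff(2)[OF bi[of p k] bi[of q k]]
    by simp
  moreover have "(\<lambda>k. - (LINT x:dom_I|lebesgue. g x * smooth_hat (?n k) d p q x))
      \<longlonglongrightarrow> - (LINT x:dom_I|lebesgue. g x * hat d p q x)"
  proof (intro tendsto_minus tendsto_integral_test[OF g, of "{p..b}" _ "2 * d"])
    show "smooth_hat (?n k) d p q \<in> borel_measurable borel" for k
      using C_k_smooth_hat[of 0] by (intro borel_measurable_continuous_onI) simp
    show "\<bar>smooth_hat (?n k) d p q x\<bar> \<le> 2 * d * indicator {p..b} x" for k x
    proof (cases "x \<in> {p..b}")
      case True
      then show ?thesis using smooth_hat_bound[OF n0] pq by simp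
    next
      case False
      with N(2)[of k] have "x \<notin> {p..q + d + 1 / ?n k}" by auto
      then show ?thesis using n0[of k] pq by (subst smooth_hat_eq_0) auto
    qed
    show "(\<lambda>k. smooth_hat (?n k) d p q x) \<longlonglongrightarrow> hat d p q x" for x
      by (rule smooth_hat_tendsto)
  qed (use pq b in auto)
  ultimately show ?thesis using LIMSEQ_unique by (metis (no_types, lifting) ext)
qed

text \<open>
  Divide the comparison of averages by \<open>d\<close> and let \<open>d \<rightarrow> 0\<close>
  at Lebesgue points of \<open>f\<close>: the averages converge to values of \<open>f\<close>,
  and the rescaled hats to the indicator of \<open>(p,q]\<close>.
\<close>

lemma weak_deriv_increment:
  assumes w: "has_weak_deriv dom_I 1 f g"
  obtains N where "negligible N"
    "\<And>p q. p \<in> dom_I \<Longrightarrow> q \<in> dom_I \<Longrightarrow> p \<notin> N \<Longrightarrow> q \<notin> N \<Longrightarrow> p < q \<Longrightarrow> f q - f p = integral {p..q} g"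
proof -
  have f: "locally_integrable dom_I f" and g: "locally_integrable dom_I g"
    using w by (auto simp: has_weak_deriv_def)
  obtain N where N: "negligible N" "\<And>x. x \<in> dom_I \<Longrightarrow> x \<notin> N \<Longrightarrow>
       (\<lambda>m. integral {x..x + 1 / real (Suc m)} f * real (Suc m)) \<longlonglongrightarrow> f x"
    using AE_lebesgue_points[OF f] by blast
  show thesis
  proof (rule that[OF N(1)])
    fix p q assume pq: "p \<in> dom_I" "q \<in> dom_I" "p \<notin> N" "q \<notin> N" "p < q"
    define b where "b = (q + 1) / 2"
    have b: "q < b" "b < 1" using pq by (auto simp: b_def)
    obtain M where M: "1 / real (Suc M) < b - q" using nat_approx_posE[of "b - q"] b by auto
    define d where "d m = 1 / real (Suc (m + M))" for m
    have "d m \<le> 1 / real (Suc M)" for m unfolding d_def by (simp add: frac_le)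
    with M have d: "0 < d m" "q + d m < b" for m
      by (auto simp: d_def add.commute less_diff_eq intro: le_less_trans) (smt (verit))
    have L: "(\<lambda>m. integral {x..x + d m} f * real (Suc (m + M))) \<longlonglongrightarrow> f x" if "x \<in> dom_I" "x \<notin> N" for x
      unfolding d_def using LIMSEQ_ignore_initial_segment[OF N(2)[OF that], of M] by simp
    have "(\<lambda>m. integral {p..p + d m} f * real (Suc (m + M)) - integral {q..q + d m} f * real (Suc (m + M)))
        \<longlonglongrightarrow> f p - f q"
      by (intro tendsto_diff L pq)
    moreover have "integral {p..p + d m} f * real (Suc (m + M)) - integral {q..q + d m} f * real (Suc (m + M))
        = - (LINT x:dom_I|lebesgue. g x * (hat (d m) p q x * real (Suc (m + M))))" for m
    proof -
      have "integral {p..p + d m} f - integral {q..q + d m} f = - (LINT x:dom_I|lebesgue. g x * hat (d m) p q x)"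
        using pq d[of m] b by (intro weak_deriv_pairing_hat[OF w]) auto
      then have "(integral {p..p + d m} f - integral {q..q + d m} f) * real (Suc (m + M))
        = - ((LINT x:dom_I|lebesgue. g x * hat (d m) p q x) * real (Suc (m + M)))" by simp
      then show ?thesis by (simp add: left_diff_distrib mult.assoc[symmetric] del: of_nat_Suc)
    qed
    moreover have "(\<lambda>m. - (LINT x:dom_I|lebesgue. g x * (hat (d m) p q x * real (Suc (m + M)))))
        \<longlonglongrightarrow> - (LINT x:dom_I|lebesgue. g x * indicator {p<..q} x)"
    proof (intro tendsto_minus tendsto_integral_test[OF g, of "{p..b}" _ 2])
      show "(\<lambda>x. hat (d m) p q x * real (Suc (m + M))) \<in> borel_measurable borel" for m
        unfolding hat_def by measurable
      show "\<bar>hat (d m) p q x * real (Suc (m + M))\<bar> \<le> 2 * indicator {p..b} x" for m x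
      proof (cases "x \<in> {p..b}")
        case True
        have "\<bar>hat (d m) p q x\<bar> * real (Suc (m + M)) \<le> 2 * d m * real (Suc (m + M))"
          using hat_bound[of "d m" p q x] d(1)[of m] by (intro mult_right_mono) auto
        also have "\<dots> = 2" by (simp add: d_def del: of_nat_Suc)
        finally show ?thesis using True by (simp add: abs_mult)
      next
        case False
        with d[of m] have "x \<notin> {p..q + d m}" by auto
        then show ?thesis using d(1)[of m] pq by (subst hat_eq_0) auto
      qed
      show "(\<lambda>m. hat (d m) p q x * real (Suc (m + M))) \<longlonglongrightarrow> indicator {p<..q} x" for x
        unfolding d_def using hat_tendsto pq by simp
    qed (use pq b in auto)
    moreover have "(LINT x:dom_I|lebesgue. g x * indicator {p<..q} x) = integral {p..q} g"
      using pq by (intro integral_indicator_Ioc[OF g]) auto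
    ultimately have "f p - f q = - integral {p..q} g"
      using LIMSEQ_unique by (metis (no_types, lifting) ext)
    then show "f q - f p = integral {p..q} g" by simp
  qed
qed

section \<open>Square-integrable functions and Sobolev norms\<close>

lemma set_lebesgue_dom_I:
  fixes f :: "real \<Rightarrow> real"
  shows "(LINT x:dom_I|lebesgue. f x) = (LINT x|lebesgue_on dom_I. f x)"
    "set_integrable lebesgue dom_I f \<longleftrightarrow> integrable (lebesgue_on dom_I) f"
  by (auto simp: set_lebesgue_integral_def set_integrable_def integral_restrict_space integrable_restrict_space)

lemma finite_measure_dom_I: "finite_measure (lebesgue_on dom_I)" "measure (lebesgue_on dom_I) dom_I = 2"
  by (auto simp: emeasure_restrict_space measure_restrict_space intro!: finite_measureI)

lemma continuous_on_borel_measurable_dom_I: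
  fixes F :: "real \<Rightarrow> real"
  assumes "continuous_on {-1..1} F" shows "F \<in> borel_measurable (lebesgue_on dom_I)"
  by (rule continuous_imp_measurable_on_sets_lebesgue[OF continuous_on_subset[OF assms]]) auto

lemma continuous_integral_dom_I:
  fixes F :: "real \<Rightarrow> real"
  assumes "continuous_on {-1..1} F"
  shows "integrable (lebesgue_on dom_I) F" "(LINT x|lebesgue_on dom_I. F x) = integral {-1..1} F"
proof -
  have "set_integrable lebesgue dom_I F"
    by (rule set_integrable_subset[OF absolutely_integrable_continuous_real[OF assms]]) auto
  then show "integrable (lebesgue_on dom_I) F" "(LINT x|lebesgue_on dom_I. F x) = integral {-1..1} F"
    using set_lebesgue_integral_eq_integral(2)[of dom_I F] integral_open_interval_real[of "-1" 1 F]
    by (simp_all add: set_lebesgue_dom_I)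
qed

lemma L2_norm_continuous:
  assumes "continuous_on {-1..1} F" "AE x in lebesgue_on dom_I. f x = F x"
    "f \<in> borel_measurable (lebesgue_on dom_I)"
  shows "(L2_norm f)\<^sup>2 = integral {-1..1} (\<lambda>x. (F x)\<^sup>2)"
proof -
  have c: "continuous_on {-1..1} (\<lambda>x. (F x)\<^sup>2)" using assms by (intro continuous_intros)
  have "(LINT x|lebesgue_on dom_I. (f x)\<^sup>2) = (LINT x|lebesgue_on dom_I. (F x)\<^sup>2)"
  proof (rule integral_cong_AE)
    show "AE x in lebesgue_on dom_I. (f x)\<^sup>2 = (F x)\<^sup>2" using assms(2) by eventually_elim simp
    show "(\<lambda>x. (F x)\<^sup>2) \<in> borel_measurable (lebesgue_on dom_I)"
      by (rule continuous_on_borel_measurable_dom_I[OF c])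
    show "(\<lambda>x. (f x)\<^sup>2) \<in> borel_measurable (lebesgue_on dom_I)"
      using assms(3) by (rule borel_measurable_power)
  qed
  then show ?thesis
    using continuous_integral_dom_I[OF c] by (simp add: L2_norm_def Bochner_Integration.integral_nonneg integral_nonneg[OF integrable_continuous_interval[OF c]])
qed

lemma borel_measurable_dom_I_cong_AE:
  fixes f g :: "real \<Rightarrow> real"
  assumes "f \<in> borel_measurable (lebesgue_on dom_I)" "AE x in lebesgue_on dom_I. f x = g x"
  shows "g \<in> borel_measurable (lebesgue_on dom_I)"
proof -
  have "(\<lambda>x. if x \<in> dom_I then g x else 0) \<in> borel_measurable lebesgue"
  proof (rule borel_measurable_AE)
    show "(\<lambda>x. if x \<in> dom_I then f x else 0) \<in> borel_measurable lebesgue"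
      by (rule borel_measurable_if_I[OF assms(1)]) auto
    show "AE x in lebesgue. (if x \<in> dom_I then f x else 0) = (if x \<in> dom_I then g x else 0)"
      using assms(2) unfolding AE_lebesgue_on_dom_I_iff by eventually_elim simp
  qed
  then show ?thesis by (rule borel_measurable_if_D)
qed

lemma L2_cong_AE:
  assumes "L2 f" "AE x in lebesgue_on dom_I. f x = g x"
  shows "L2 g" "L2_norm g = L2_norm f"
proof -
  have f: "f \<in> borel_measurable (lebesgue_on dom_I)" "integrable (lebesgue_on dom_I) (\<lambda>x. (f x)\<^sup>2)"
    using assms by (auto simp: L2_def)
  have g: "g \<in> borel_measurable (lebesgue_on dom_I)"
    using borel_measurable_dom_I_cong_AE[OF f(1) assms(2)] .
  have ae: "AE x in lebesgue_on dom_I. (f x)\<^sup>2 = (g x)\<^sup>2" using assms(2) by eventually_elim simp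
  show "L2 g"
    using Bochner_Integration.integrable_cong_AE[THEN iffD1, OF _ _ ae f(2)] f g
    by (auto simp: L2_def intro: borel_measurable_power)
  show "L2_norm g = L2_norm f" unfolding L2_norm_def
    using integral_cong_AE[OF _ _ ae] f g by (simp add: borel_measurable_power)
qed

lemma L2_continuous:
  assumes "continuous_on {-1..1} F" shows "L2 F"
  unfolding L2_def using assms
  by (intro conjI continuous_on_borel_measurable_dom_I continuous_integral_dom_I(1) continuous_intros)

lemma L2_diff: "L2 f \<Longrightarrow> L2 g \<Longrightarrow> L2 (\<lambda>x. f x - g x)"
proof -
  assume fg: "L2 f" "L2 g"
  have "integrable (lebesgue_on dom_I) (\<lambda>x. (f x - g x)\<^sup>2)"
  proof (rule Bochner_Integration.integrable_bound)
    show "integrable (lebesgue_on dom_I) (\<lambda>x. 2 * (f x)\<^sup>2 + 2 * (g x)\<^sup>2)"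
      using fg by (auto simp: L2_def)
    show "(\<lambda>x. (f x - g x)\<^sup>2) \<in> borel_measurable (lebesgue_on dom_I)"
      using fg by (auto simp: L2_def intro!: borel_measurable_power borel_measurable_diff)
    have "(a - b)\<^sup>2 \<le> 2 * a\<^sup>2 + 2 * b\<^sup>2" for a b :: real
      using zero_le_power2[of "a + b"] by (simp add: power2_eq_square algebra_simps)
    then show "AE x in lebesgue_on dom_I. norm ((f x - g x)\<^sup>2) \<le> norm (2 * (f x)\<^sup>2 + 2 * (g x)\<^sup>2)"
      by (intro AE_I2) auto
  qed
  with fg show ?thesis by (auto simp: L2_def)
qed

lemma L2_norm_nonneg [simp]: "L2_norm f \<ge> 0"
  by (simp add: L2_norm_def Bochner_Integration.integral_nonneg)

text \<open>
  The Cauchy-Schwarz inequality against the constant \<open>1\<close>, obtained by expanding the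
  square of \<open>\<bar>f\<bar>\<close> minus its mean value.
\<close>

lemma L2_integrable:
  assumes "L2 f" shows "integrable (lebesgue_on dom_I) f"
    and "(LINT x|lebesgue_on dom_I. \<bar>f x\<bar>) \<le> 2 * L2_norm f"
proof -
  interpret finite_measure "lebesgue_on dom_I" by (rule finite_measure_dom_I)
  have m: "f \<in> borel_measurable (lebesgue_on dom_I)" and i: "integrable (lebesgue_on dom_I) (\<lambda>x. (f x)\<^sup>2)"
    using assms by (auto simp: L2_def)
  show I: "integrable (lebesgue_on dom_I) f"
  proof (rule Bochner_Integration.integrable_bound[OF _ m])
    show "integrable (lebesgue_on dom_I) (\<lambda>x. 1 + (f x)\<^sup>2)"
      using i by (intro Bochner_Integration.integrable_add) auto
    have "\<bar>a\<bar> \<le> \<bar>1 + a\<^sup>2\<bar>" for a :: real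
      using zero_le_power2[of "\<bar>a\<bar> - 1/2"] by (simp add: power2_eq_square algebra_simps)
    then show "AE x in lebesgue_on dom_I. norm (f x) \<le> norm (1 + (f x)\<^sup>2)"
      by (intro AE_I2) auto
  qed
  define a where "a = (LINT x|lebesgue_on dom_I. \<bar>f x\<bar>)"
  have a: "a \<ge> 0" by (simp add: a_def)
  have s: "(L2_norm f)\<^sup>2 = (LINT x|lebesgue_on dom_I. (f x)\<^sup>2)"
    by (simp add: L2_norm_def Bochner_Integration.integral_nonneg)
  have "0 \<le> (LINT x|lebesgue_on dom_I. (\<bar>f x\<bar> - a / 2)\<^sup>2)"
    by (rule Bochner_Integration.integral_nonneg) simp
  also have "\<dots> = (LINT x|lebesgue_on dom_I. (f x)\<^sup>2 - a * \<bar>f x\<bar> + a\<^sup>2 / 4)"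
    by (rule Bochner_Integration.integral_cong) (auto simp: power2_eq_square algebra_simps)
  also have "\<dots> = (L2_norm f)\<^sup>2 - a * a + a\<^sup>2 / 4 * 2"
    using i I finite_measure_dom_I(2) by (simp add: s a_def)
  finally have "a\<^sup>2 \<le> 2 * (L2_norm f)\<^sup>2" by (simp add: power2_eq_square)
  also have "\<dots> \<le> (2 * L2_norm f)\<^sup>2" by (simp add: power_mult_distrib)
  finally show "(LINT x|lebesgue_on dom_I. \<bar>f x\<bar>) \<le> 2 * L2_norm f"
    unfolding a_def[symmetric] by (rule power2_le_imp_le) simp
qed

lemma L2_integrable_Icc:
  assumes "L2 f" "-1 \<le> p" "q \<le> 1"
  shows "f absolutely_integrable_on {p..q}" "\<bar>integral {p..q} f\<bar> \<le> 2 * L2_norm f"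
proof -
  have "f absolutely_integrable_on dom_I"
    using L2_integrable(1)[OF assms(1)] by (simp add: set_lebesgue_dom_I)
  then have "f absolutely_integrable_on {-1..1}"
    using absolutely_integrable_spike_set_eq[of dom_I "{-1..1}" f] by (simp add: negligible_subset[of "{-1, 1}"] subset_iff)
  then show ai: "f absolutely_integrable_on {p..q}"
    by (rule set_integrable_subset) (use assms in auto)
  have "\<bar>integral {p..q} f\<bar> = \<bar>integral {p<..<q} f\<bar>" by (simp add: integral_open_interval_real)
  also have "\<dots> \<le> integral {p<..<q} (\<lambda>x. \<bar>f x\<bar>)"
  proof -
    have "f absolutely_integrable_on {p<..<q}" using ai by (rule set_integrable_subset) auto
    then show ?thesis
      using integral_norm_bound_integral[of f "{p<..<q}" "\<lambda>x. \<bar>f x\<bar>"]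
      by (auto simp: absolutely_integrable_on_def)
  qed
  also have "\<dots> \<le> integral dom_I (\<lambda>x. \<bar>f x\<bar>)"
  proof (rule integral_subset_le)
    have "(\<lambda>x. \<bar>f x\<bar>) absolutely_integrable_on dom_I"
      using \<open>f absolutely_integrable_on dom_I\<close> set_integrable_abs by blast
    then show "(\<lambda>x. \<bar>f x\<bar>) integrable_on dom_I" by (rule set_lebesgue_integral_eq_integral(1))
    have "(\<lambda>x. \<bar>f x\<bar>) absolutely_integrable_on {p<..<q}"
      by (rule set_integrable_subset[OF \<open>(\<lambda>x. \<bar>f x\<bar>) absolutely_integrable_on dom_I\<close>]) (use assms in auto)
    then show "(\<lambda>x. \<bar>f x\<bar>) integrable_on {p<..<q}" by (rule set_lebesgue_integral_eq_integral(1))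
  qed (use assms in auto)
  also have "\<dots> = (LINT x|lebesgue_on dom_I. \<bar>f x\<bar>)"
    using set_lebesgue_integral_eq_integral(2)[OF set_integrable_abs[OF \<open>f absolutely_integrable_on dom_I\<close>]]
    by (simp add: set_lebesgue_dom_I)
  also have "\<dots> \<le> 2 * L2_norm f" by (rule L2_integrable(2)[OF assms(1)])
  finally show "\<bar>integral {p..q} f\<bar> \<le> 2 * L2_norm f" .
qed

lemma continuous_AE_eq:
  fixes F G :: "real \<Rightarrow> real"
  assumes F: "continuous_on {-1..1} F" and G: "continuous_on {-1..1} G"
    and ae: "AE x in lebesgue_on dom_I. F x = G x" and x: "x \<in> {-1..1}"
  shows "F x = G x"
proof -
  define C where "C = {x \<in> {-1..1}. F x - G x = 0}"
  have "closed C" unfolding C_def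
    by (intro continuous_closed_preimage_constant continuous_intros F G)
  have "AE x \<in> dom_I in lebesgue. x \<in> C"
    using ae unfolding AE_lebesgue_on_dom_I_iff by eventually_elim (auto simp: C_def)
  from mem_closed_if_AE_lebesgue_open[OF open_greaterThanLessThan \<open>closed C\<close> this]
  have "dom_I \<subseteq> C" by (rule subsetI)
  then have "closure dom_I \<subseteq> C" using \<open>closed C\<close> by (rule closure_minimal)
  with x show ?thesis by (auto simp: C_def)
qed

lemma negligible_dom_I_point:
  assumes "negligible N" obtains p where "p \<in> dom_I" "p \<notin> N"
proof -
  have "\<not> negligible dom_I"
    using open_not_negligible[of dom_I] by auto
  then have "\<not> dom_I \<subseteq> N" using assms negligible_subset by blast
  then show thesis using that by blast
qed

text \<open>
  Functions with an integrable weak derivative are primitives of it; the base point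
  \<open>p\<close> is any Lebesgue point.
\<close>

lemma weak_deriv_representative:
  assumes w: "has_weak_deriv dom_I 1 f g" and g: "g absolutely_integrable_on {-1..1}"
  obtains F where "continuous_on {-1..1} F" "AE x in lebesgue_on dom_I. f x = F x"
    "\<And>x y. -1 \<le> x \<Longrightarrow> x \<le> y \<Longrightarrow> y \<le> 1 \<Longrightarrow> F y - F x = integral {x..y} g"
proof -
  obtain N where N: "negligible N"
    "\<And>p q. p \<in> dom_I \<Longrightarrow> q \<in> dom_I \<Longrightarrow> p \<notin> N \<Longrightarrow> q \<notin> N \<Longrightarrow> p < q \<Longrightarrow> f q - f p = integral {p..q} g"
    using weak_deriv_increment[OF w] by blast
  obtain p where p: "p \<in> dom_I" "p \<notin> N" using negligible_dom_I_point[OF N(1)] by blast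
  have gi: "g integrable_on {-1..1}" using g by (simp add: absolutely_integrable_on_def)
  have comb: "integral {-1..x} g + integral {x..y} g = integral {-1..y} g" if "-1 \<le> x" "x \<le> y" "y \<le> 1" for x y
    using that integrable_subinterval_real[OF gi, of "-1" y]
    by (intro Henstock_Kurzweil_Integration.integral_combine) auto
  define F where "F x = f p + (integral {-1..x} g - integral {-1..p} g)" for x
  show thesis
  proof
    show "continuous_on {-1..1} F"
      unfolding F_def by (intro continuous_intros indefinite_integral_continuous_1 gi)
    show "F y - F x = integral {x..y} g" if "-1 \<le> x" "x \<le> y" "y \<le> 1" for x y
      using comb[OF that] by (simp add: F_def)
    show "AE x in lebesgue_on dom_I. f x = F x"
    proof (rule AE_dom_I_negligible[OF N(1)])
      fix x assume x: "x \<in> dom_I" "x \<notin> N"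
      consider "x < p" | "x = p" | "x > p" by linarith
      then show "f x = F x"
      proof cases
        case 1
        then show ?thesis using N(2)[of x p] comb[of x p] x p by (simp add: F_def)
      next
        case 3
        then show ?thesis using N(2)[of p x] comb[of p x] x p by (simp add: F_def)
      qed (simp add: F_def)
    qed
  qed
qed

lemma integral_AE_eq_continuous:
  fixes G :: "real \<Rightarrow> real"
  assumes ae: "AE x in lebesgue_on dom_I. g x = G x" and "-1 \<le> x" "y \<le> 1"
  shows "integral {x..y} g = integral {x..y} G"
proof -
  have "negligible {z \<in> dom_I. g z \<noteq> G z}"
    using ae unfolding AE_lebesgue_on_dom_I_iff completion.AE_iff_null_sets
    by (auto simp: negligible_iff_null_sets Collect_conj_eq)
  then have "negligible (insert (-1) (insert 1 {z \<in> dom_I. g z \<noteq> G z}))" by simp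
  then show ?thesis
    by (rule integral_spike) (use assms in force)
qed

lemma weak_deriv_continuous_representative:
  assumes w: "has_weak_deriv dom_I 1 f g" and G: "continuous_on {-1..1} G"
    and ae: "AE x in lebesgue_on dom_I. g x = G x"
  obtains F where "continuous_on {-1..1} F" "AE x in lebesgue_on dom_I. f x = F x"
    "\<And>x. x \<in> {-1..1} \<Longrightarrow> (F has_real_derivative G x) (at x within {-1..1})"
proof -
  have "L2 g" using L2_cong_AE(1)[OF L2_continuous[OF G], of g] ae by (simp add: eq_commute)
  then obtain F where F: "continuous_on {-1..1} F" "AE x in lebesgue_on dom_I. f x = F x"
    "\<And>x y. -1 \<le> x \<Longrightarrow> x \<le> y \<Longrightarrow> y \<le> 1 \<Longrightarrow> F y - F x = integral {x..y} g"
    using weak_deriv_representative[OF w L2_integrable_Icc(1)[of g "-1" 1]] by auto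
  show thesis
  proof (rule that[OF F(1,2)])
    fix x :: real assume x: "x \<in> {-1..1}"
    have "((\<lambda>y. F (-1) + integral {-1..y} G) has_real_derivative 0 + G x) (at x within {-1..1})"
      by (intro DERIV_add DERIV_const integral_has_real_derivative[OF G x])
    then have *: "((\<lambda>y. F (-1) + integral {-1..y} G) has_real_derivative G x) (at x within {-1..1})" by simp
    show "(F has_real_derivative G x) (at x within {-1..1})"
    proof (rule has_field_derivative_transform_within[OF * zero_less_one x])
      fix y :: real assume "y \<in> {-1..1}"
      then show "F (-1) + integral {-1..y} G = F y"
        using F(3)[of "-1" y] integral_AE_eq_continuous[OF ae, of "-1" y] by simp
    qed
  qed
qed

text \<open>
  The oscillation is at most the \<open>L\<^sup>1\<close> norm of the derivative, and some value
  is at most the \<open>L\<^sup>2\<close> norm in modulus, since the interval has length greater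
  than \<open>1\<close>.
\<close>

lemma sobolev_sup_bound:
  assumes w: "has_weak_deriv dom_I 1 f g" and L: "L2 f" "L2 g"
    and F: "continuous_on {-1..1} F" "AE x in lebesgue_on dom_I. f x = F x" and x: "x \<in> {-1..1}"
  shows "\<bar>F x\<bar> \<le> L2_norm f + 2 * L2_norm g"
proof -
  obtain F' where F': "continuous_on {-1..1} F'" "AE x in lebesgue_on dom_I. f x = F' x"
    "\<And>x y. -1 \<le> x \<Longrightarrow> x \<le> y \<Longrightarrow> y \<le> 1 \<Longrightarrow> F' y - F' x = integral {x..y} g"
    using weak_deriv_representative[OF w L2_integrable_Icc(1)[OF L(2), of "-1" 1]] by auto
  have "AE x in lebesgue_on dom_I. F' x = F x" using F(2) F'(2) by eventually_elim simp
  then have eq: "F' x = F x" if "x \<in> {-1..1}" for x using continuous_AE_eq[OF F'(1) F(1)] that by blast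
  have osc: "\<bar>F y - F x\<bar> \<le> 2 * L2_norm g" if "x \<in> {-1..1}" "y \<in> {-1..1}" for x y
  proof (cases "x \<le> y")
    case True
    then show ?thesis using F'(3)[of x y] eq that L2_integrable_Icc(2)[OF L(2), of x y] by auto
  next
    case False
    then show ?thesis using F'(3)[of y x] eq that L2_integrable_Icc(2)[OF L(2), of y x] by auto
  qed
  \<comment> \<open>By the oscillation bound \<open>c\<close> is a lower bound of \<open>\<bar>F\<bar>\<close> on the whole interval.\<close>
  define c where "c = \<bar>F x\<bar> - 2 * L2_norm g"
  have "c \<le> L2_norm f"
  proof (cases "c \<le> 0")
    case False
    have "c \<le> \<bar>F y\<bar>" if "y \<in> {-1..1}" for y using osc[OF x that] unfolding c_def by linarith
    then have *: "c\<^sup>2 \<le> (F y)\<^sup>2" if "y \<in> {-1..1}" for y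
      using False that by (metis abs_le_square_iff abs_of_pos linorder_not_le power2_abs)
    have "integral {-1..1} (\<lambda>y::real. c\<^sup>2) \<le> integral {-1..1} (\<lambda>y. (F y)\<^sup>2)"
      by (intro Henstock_Kurzweil_Integration.integral_le integrable_continuous_interval continuous_intros F *)
    also have "\<dots> = (L2_norm f)\<^sup>2"
      using L2_norm_continuous[OF F] L(1) by (simp add: L2_def)
    finally have "2 * c\<^sup>2 \<le> (L2_norm f)\<^sup>2" by simp
    then have "c\<^sup>2 \<le> (L2_norm f)\<^sup>2" using zero_le_power2[of c] by linarith
    then show ?thesis by (rule power2_le_imp_le) simp
  qed (use L2_norm_nonneg[of f] in linarith)
  then show ?thesis by (simp add: c_def)
qed


lemma locally_integrable_test:
  fixes h :: "'a::euclidean_space \<Rightarrow> real"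
  assumes h: "locally_integrable \<Omega> h" and K: "compact K" "K \<subseteq> \<Omega>"
    and c: "continuous_on UNIV \<psi>" and 0: "\<And>x. x \<notin> K \<Longrightarrow> \<psi> x = 0"
  shows "set_integrable lebesgue \<Omega> (\<lambda>x. h x * \<psi> x)"
proof -
  have "compact (\<psi> ` K)" by (intro compact_continuous_image continuous_on_subset[OF c] K) auto
  then have "bounded (\<psi> ` K)" by (rule compact_imp_bounded)
  then obtain C where "\<And>x. x \<in> K \<Longrightarrow> \<bar>\<psi> x\<bar> \<le> C"
    unfolding bounded_iff by auto
  then have C: "\<bar>\<psi> x\<bar> * \<bar>indicator K x * h x\<bar> \<le> C * \<bar>indicator K x * h x\<bar>" for x
    by (cases "x \<in> K") (auto intro: mult_right_mono)
  have i: "integrable lebesgue (\<lambda>x. indicator K x * h x)"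
    using h K by (auto simp: locally_integrable_def set_integrable_def)
  have "integrable lebesgue (\<lambda>x. \<psi> x * (indicator K x * h x))"
  proof (rule Bochner_Integration.integrable_bound)
    show "integrable lebesgue (\<lambda>x. C * \<bar>indicator K x * h x\<bar>)"
      using i by (intro integrable_mult_right integrable_abs)
    show "(\<lambda>x. \<psi> x * (indicator K x * h x)) \<in> borel_measurable lebesgue"
      by (rule borel_measurable_times[OF borel_measurable_lebesgueI[OF borel_measurable_continuous_onI[OF c]]
            borel_measurable_integrable[OF i]])
    show "AE x in lebesgue. norm (\<psi> x * (indicator K x * h x)) \<le> norm (C * \<bar>indicator K x * h x\<bar>)"
    proof (rule AE_I2)
      fix x
      have "norm (\<psi> x * (indicator K x * h x)) \<le> C * \<bar>indicator K x * h x\<bar>"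
        using C[of x] by (simp add: abs_mult)
      also have "\<dots> \<le> norm (C * \<bar>indicator K x * h x\<bar>)" by simp
      finally show "norm (\<psi> x * (indicator K x * h x)) \<le> norm (C * \<bar>indicator K x * h x\<bar>)" .
    qed
  qed
  moreover have "\<psi> x * (indicator K x * h x) = indicator \<Omega> x *\<^sub>R (h x * \<psi> x)" for x
    using 0[of x] K(2) by (cases "x \<in> K") auto
  ultimately show ?thesis unfolding set_integrable_def by (simp only:)
qed

lemma test_function_real:
  fixes \<psi> :: "real \<Rightarrow> real"
  assumes "test_function \<Omega> \<psi>"
  obtains K where "compact K" "K \<subseteq> \<Omega>" "continuous_on UNIV \<psi>" "\<And>x. x \<notin> K \<Longrightarrow> \<psi> x = 0"
    "continuous_on UNIV (\<lambda>x. frechet_derivative \<psi> (at x) 1)"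
    "\<And>x. x \<notin> K \<Longrightarrow> frechet_derivative \<psi> (at x) 1 = 0"
    "\<And>x. (\<psi> has_real_derivative frechet_derivative \<psi> (at x) 1) (at x)"
proof -
  obtain K where K: "compact K" "K \<subseteq> \<Omega>" "\<And>x. x \<notin> K \<Longrightarrow> \<psi> x = 0" and C: "\<And>k. C_k k \<psi>"
    using assms by (auto simp: test_function_def)
  have d: "frechet_derivative \<psi> (at x) 1 = 0" if "x \<notin> K" for x
  proof (rule frechet_derivative_real)
    show "(\<psi> has_real_derivative 0) (at x)"
      by (rule has_field_derivative_transform_within_open[of "\<lambda>x. 0" _ _ "- K"])
         (use K that compact_imp_closed[OF K(1)] in auto)
  qed
  obtain f' where f': "\<And>x. (\<psi> has_real_derivative f' x) (at x)"
    using C[of "Suc 0"] unfolding C_k_Suc_real by auto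
  have "(\<psi> has_real_derivative frechet_derivative \<psi> (at x) 1) (at x)" for x
    using f'[of x] frechet_derivative_real[OF f'[of x]] by simp
  with K C[of 0] C[of "Suc 0"] d show thesis by (intro that[of K]) auto
qed

lemma locally_integrable_diff:
  "locally_integrable \<Omega> f \<Longrightarrow> locally_integrable \<Omega> g \<Longrightarrow> locally_integrable \<Omega> (\<lambda>x. f x - g x)"
  unfolding locally_integrable_def by (auto intro: set_integral_diff)

lemma has_weak_deriv_diff:
  fixes f g :: "real \<Rightarrow> real"
  assumes "has_weak_deriv \<Omega> 1 f f'" "has_weak_deriv \<Omega> 1 g g'"
  shows "has_weak_deriv \<Omega> 1 (\<lambda>x. f x - g x) (\<lambda>x. f' x - g' x)"
  unfolding has_weak_deriv_def
proof (intro conjI allI impI)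
  note li = assms[unfolded has_weak_deriv_def]
  show "locally_integrable \<Omega> (\<lambda>x. f x - g x)" "locally_integrable \<Omega> (\<lambda>x. f' x - g' x)"
    using li by (auto intro: locally_integrable_diff)
  fix \<psi> :: "real \<Rightarrow> real" assume t: "test_function \<Omega> \<psi>"
  then obtain K where K: "compact K" "K \<subseteq> \<Omega>" "continuous_on UNIV \<psi>" "\<And>x. x \<notin> K \<Longrightarrow> \<psi> x = 0"
    "continuous_on UNIV (\<lambda>x. frechet_derivative \<psi> (at x) 1)"
    "\<And>x. x \<notin> K \<Longrightarrow> frechet_derivative \<psi> (at x) 1 = 0"
    by (rule test_function_real) blast
  have i: "set_integrable lebesgue \<Omega> (\<lambda>x. h x * \<psi> x)"
    "set_integrable lebesgue \<Omega> (\<lambda>x. h x * frechet_derivative \<psi> (at x) 1)"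
    if "locally_integrable \<Omega> h" for h
    using locally_integrable_test[OF that K(1,2)] K by auto
  show "(LINT x:\<Omega>|lebesgue. (f x - g x) * frechet_derivative \<psi> (at x) 1)
      = - (LINT x:\<Omega>|lebesgue. (f' x - g' x) * \<psi> x)"
    unfolding left_diff_distrib using li t i by (simp add: set_integral_diff(2))
qed

lemma has_weak_deriv_unique:
  assumes "has_weak_deriv dom_I 1 f g" "has_weak_deriv dom_I 1 f g'"
  shows "AE x in lebesgue_on dom_I. g x = g' x"
proof -
  have "AE x in lebesgue_on dom_I. g x - g' x = 0"
  proof (rule locally_integrable_AE_eq_0)
    note * = has_weak_deriv_diff[OF assms, unfolded has_weak_deriv_def]
    show "locally_integrable dom_I (\<lambda>x. g x - g' x)" using * by simp
    show "(LINT x:dom_I|lebesgue. (g x - g' x) * \<psi> x) = 0" if "test_function dom_I \<psi>" for \<psi>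
      using * that by simp
  qed
  then show ?thesis by eventually_elim simp
qed

lemma locally_integrable_cong_AE:
  assumes "locally_integrable dom_I f" "AE x in lebesgue_on dom_I. f x = g x"
  shows "locally_integrable dom_I g"
  unfolding locally_integrable_def
proof (intro allI impI)
  fix K :: "real set" assume K: "compact K \<and> K \<subseteq> dom_I"
  have f: "integrable lebesgue (\<lambda>x. indicator K x *\<^sub>R f x)"
    using assms(1) K by (auto simp: locally_integrable_def set_integrable_def)
  have ae: "AE x in lebesgue. indicator K x *\<^sub>R f x = indicator K x *\<^sub>R g x"
    using assms(2) unfolding AE_lebesgue_on_dom_I_iff
    by eventually_elim (use K in \<open>auto simp: indicator_def\<close>)
  have "(\<lambda>x. indicator K x *\<^sub>R g x) \<in> borel_measurable lebesgue"
    by (rule borel_measurable_AE[OF borel_measurable_integrable[OF f] ae])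
  then show "set_integrable lebesgue K g"
    unfolding set_integrable_def
    using integrable_cong_AE[THEN iffD1, OF borel_measurable_integrable[OF f] _ ae f] by blast
qed

lemma set_integral_cong_dom_I:
  fixes f g :: "real \<Rightarrow> real"
  assumes "AE x in lebesgue_on dom_I. f x = g x"
  shows "(LINT x:dom_I|lebesgue. f x) = (LINT x:dom_I|lebesgue. g x)"
proof (cases "f \<in> borel_measurable (lebesgue_on dom_I)")
  case True
  then show ?thesis unfolding set_lebesgue_dom_I
    using assms borel_measurable_dom_I_cong_AE by (intro integral_cong_AE) blast+
next
  case False
  then have "g \<notin> borel_measurable (lebesgue_on dom_I)"
    using borel_measurable_dom_I_cong_AE[of g f] assms by (auto simp: eq_commute)
  with False have "\<not> integrable (lebesgue_on dom_I) f" "\<not> integrable (lebesgue_on dom_I) g"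
    by auto
  then show ?thesis unfolding set_lebesgue_dom_I by (simp add: not_integrable_integral_eq)
qed

lemma has_weak_deriv_cong_AE:
  assumes w: "has_weak_deriv dom_I 1 f g" and ae: "AE x in lebesgue_on dom_I. f x = f' x"
  shows "has_weak_deriv dom_I 1 f' g"
  unfolding has_weak_deriv_def
proof (intro conjI allI impI)
  note w' = w[unfolded has_weak_deriv_def]
  show "locally_integrable dom_I f'" "locally_integrable dom_I g"
    using w' locally_integrable_cong_AE[OF _ ae] by auto
  fix \<psi> assume t: "test_function dom_I \<psi>"
  have "(LINT x:dom_I|lebesgue. f' x * frechet_derivative \<psi> (at x) 1)
      = (LINT x:dom_I|lebesgue. f x * frechet_derivative \<psi> (at x) 1)"
    by (rule set_integral_cong_dom_I) (use ae in \<open>eventually_elim, simp\<close>)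
  then show "(LINT x:dom_I|lebesgue. f' x * frechet_derivative \<psi> (at x) 1) = - (LINT x:dom_I|lebesgue. g x * \<psi> x)"
    using w' t by simp
qed

lemma has_weak_deriv_weak_deriv: "has_weak_deriv dom_I 1 f g \<Longrightarrow> has_weak_deriv dom_I 1 f (weak_deriv f)"
  unfolding weak_deriv_def by (erule someI[of "has_weak_deriv dom_I 1 f" g])

lemma sobolev_1_deriv:
  assumes s: "sobolev 1 f" and w: "has_weak_deriv dom_I 1 f g"
  shows "L2 f" "L2 g" "L2_norm f \<le> sobolev_norm 1 f" "L2_norm g \<le> sobolev_norm 1 f"
proof -
  obtain g' where g': "has_weak_deriv dom_I 1 f g'" "L2 g'" and f: "L2 f"
    using s by (auto simp: One_nat_def)
  show "L2 f" by fact
  show g: "L2 g" by (rule L2_cong_AE(1)[OF g'(2) has_weak_deriv_unique[OF g'(1) w]])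
  have "has_weak_deriv dom_I 1 f (weak_deriv f)"
    by (rule has_weak_deriv_weak_deriv[OF w])
  then have "L2_norm (weak_deriv f) = L2_norm g"
    using L2_cong_AE(2)[OF g has_weak_deriv_unique[OF w]] by simp
  then have *: "sobolev_norm 1 f = sqrt ((L2_norm f)\<^sup>2 + (L2_norm g)\<^sup>2)"
    by (simp add: sobolev_norm_def One_nat_def)
  show "L2_norm f \<le> sobolev_norm 1 f" "L2_norm g \<le> sobolev_norm 1 f"
    unfolding * by (auto intro!: real_le_rsqrt)
qed

text \<open>
  The norms in the definition of \<open>W\<^sup>k\<^sup>,\<^sup>2\<close> are computed with
  chosen weak derivatives; by uniqueness any other weak derivatives have the same norms.
\<close>

lemma sobolev_2_deriv:
  assumes s: "sobolev 2 f" and w: "has_weak_deriv dom_I 1 f g" "has_weak_deriv dom_I 1 g h"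
  shows "L2 f" "L2 g" "L2 h"
    "L2_norm f \<le> sobolev_norm 2 f" "L2_norm g \<le> sobolev_norm 2 f" "L2_norm h \<le> sobolev_norm 2 f"
proof -
  obtain g' h' where g': "has_weak_deriv dom_I 1 f g'" "L2 g'" "has_weak_deriv dom_I 1 g' h'" "L2 h'"
    and f: "L2 f"
    using s by (auto simp: numeral_2_eq_2)
  show "L2 f" by fact
  have gg: "AE x in lebesgue_on dom_I. g' x = g x" by (rule has_weak_deriv_unique[OF g'(1) w(1)])
  show g: "L2 g" by (rule L2_cong_AE(1)[OF g'(2) gg])
  show h: "L2 h"
    by (rule L2_cong_AE(1)[OF g'(4) has_weak_deriv_unique[OF has_weak_deriv_cong_AE[OF g'(3) gg] w(2)]])
  have d1: "has_weak_deriv dom_I 1 f (weak_deriv f)"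
    by (rule has_weak_deriv_weak_deriv[OF w(1)])
  have ae: "AE x in lebesgue_on dom_I. g x = weak_deriv f x" by (rule has_weak_deriv_unique[OF w(1) d1])
  have d2: "has_weak_deriv dom_I 1 (weak_deriv f) h" by (rule has_weak_deriv_cong_AE[OF w(2) ae])
  then have d3: "has_weak_deriv dom_I 1 (weak_deriv f) (weak_deriv (weak_deriv f))"
    by (rule has_weak_deriv_weak_deriv)
  have "L2_norm (weak_deriv f) = L2_norm g" "L2_norm (weak_deriv (weak_deriv f)) = L2_norm h"
    using L2_cong_AE(2)[OF g ae] L2_cong_AE(2)[OF h has_weak_deriv_unique[OF d2 d3]] by auto
  then have *: "sobolev_norm 2 f = sqrt ((L2_norm f)\<^sup>2 + ((L2_norm g)\<^sup>2 + (L2_norm h)\<^sup>2))"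
    by (simp add: sobolev_norm_def numeral_2_eq_2)
  show "L2_norm f \<le> sobolev_norm 2 f" "L2_norm g \<le> sobolev_norm 2 f" "L2_norm h \<le> sobolev_norm 2 f"
    unfolding * by (auto intro!: real_le_rsqrt)
qed

lemma sobolev_diff:
  "sobolev k f \<Longrightarrow> sobolev k g \<Longrightarrow> sobolev k (\<lambda>x. f x - g x)"
proof (induction k arbitrary: f g)
  case 0
  then show ?case by (simp add: L2_diff)
next
  case (Suc k)
  then show ?case by (auto intro: L2_diff has_weak_deriv_diff)
qed

section \<open>Regular representatives at a fixed time\<close>

text \<open>
  The second-derivative test in a form that covers the end points of the interval: a minimum at
  which \<open>f\<close> has vanishing first derivative cannot have a negative second
  derivative.
\<close>

lemma critical_minimum_not_concave:
  fixes f f' f'' :: "real \<Rightarrow> real"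
  assumes f: "\<And>x. x \<in> {-1..1} \<Longrightarrow> (f has_real_derivative f' x) (at x within {-1..1})"
    and f': "(f' has_real_derivative c) (at a within {-1..1})"
    and a: "a \<in> {-1..1}" and min: "\<And>x. x \<in> {-1..1} \<Longrightarrow> f a \<le> f x"
    and crit: "f' a = 0" and c: "c < 0"
  shows False
proof -
  have mvt: "\<exists>z\<in>{x<..<y}. f y - f x = f' z * (y - x)" if "x < y" "x \<in> {-1..1}" "y \<in> {-1..1}" for x y
  proof (rule mvt_simple[OF that(1), of f "\<lambda>z. (*) (f' z)"])
    fix z assume "x \<le> z" "z \<le> y"
    then have "(f has_real_derivative f' z) (at z within {x..y})"
      using that by (intro DERIV_subset[OF f]) auto
    then show "(f has_derivative (*) (f' z)) (at z within {x..y})"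
      by (simp add: has_field_derivative_def)
  qed
  show False
  proof (cases "a < 1")
    case True
    obtain d where d: "d > 0" "\<And>h. 0 < h \<Longrightarrow> a + h \<in> {-1..1} \<Longrightarrow> h < d \<Longrightarrow> f' (a + h) < f' a"
      using has_real_derivative_neg_dec_right[OF f' c] by auto
    define h where "h = min (d / 2) (1 - a)"
    have h: "0 < h" "h < d" "a + h \<in> {-1..1}" using True d(1) a by (auto simp: h_def min_def)
    then obtain z where z: "z \<in> {a<..<a + h}" "f (a + h) - f a = f' z * h"
      using mvt[of a "a + h"] a by auto
    have "f' z < 0" using d(2)[of "z - a"] z(1) h a crit by auto
    then have "f' z * h < 0" using h(1) by (rule mult_neg_pos)
    with z(2) min[OF h(3)] show False by linarith
  next
    case False
    with a have a1: "a = 1" by auto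
    obtain d where d: "d > 0" "\<And>h. 0 < h \<Longrightarrow> a - h \<in> {-1..1} \<Longrightarrow> h < d \<Longrightarrow> f' a < f' (a - h)"
      using has_real_derivative_neg_dec_left[OF f' c] by auto
    define h where "h = min (d / 2) 1"
    have h: "0 < h" "h < d" "a - h \<in> {-1..1}" using d(1) a1 by (auto simp: h_def min_def)
    then obtain z where z: "z \<in> {a - h<..<a}" "f a - f (a - h) = f' z * h"
      using mvt[of "a - h" a] a by auto
    have "0 < f' z" using d(2)[of "a - z"] z(1) h a crit by auto
    then have "0 < f' z * h" using h(1) by simp
    with z(2) min[OF h(3)] show False by linarith
  qed
qed

lemma minimum_critical_in_interior:
  fixes f :: "real \<Rightarrow> real"
  assumes "\<And>x. x \<in> {-1..1} \<Longrightarrow> (f has_real_derivative f' x) (at x within {-1..1})"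
  obtains a where "a \<in> {-1..1}" "\<And>x. x \<in> {-1..1} \<Longrightarrow> f a \<le> f x" "a \<in> {-1<..<1} \<Longrightarrow> f' a = 0"
proof -
  have "continuous_on {-1..1} f"
    using assms by (meson DERIV_continuous continuous_on_eq_continuous_within)
  then obtain a where a: "a \<in> {-1..1}" "\<And>x. x \<in> {-1..1} \<Longrightarrow> f a \<le> f x"
    using continuous_attains_inf[of "{-1..1}" f] by auto
  show thesis
  proof (rule that[OF a])
    assume a': "a \<in> {-1<..<1}"
    then have "(f has_real_derivative f' a) (at a)"
      using assms[OF a(1)] by (simp add: at_within_Icc_at)
    then show "f' a = 0"
      by (rule DERIV_local_min[of f "f' a" a "min (a + 1) (1 - a)"]) (use a a' in \<open>auto simp: abs_real_def split: if_splits\<close>)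
  qed
qed

text \<open>
  The maximum principle for \<open>- \<epsilon> W'' + W = V\<close> with Neumann conditions: at
  a negative minimum \<open>\<epsilon> W'' = W - V\<close> would be negative.
\<close>

lemma neumann_resolvent_nonneg:
  fixes V W P :: "real \<Rightarrow> real"
  assumes eps: "\<epsilon> > 0"
    and W: "\<And>x. x \<in> {-1..1} \<Longrightarrow> (W has_real_derivative - P x) (at x within {-1..1})"
    and P: "\<And>x. x \<in> {-1..1} \<Longrightarrow> (P has_real_derivative (V x - W x) / \<epsilon>) (at x within {-1..1})"
    and bd: "P (-1) = 0" "P 1 = 0" and V: "\<And>x. x \<in> {-1..1} \<Longrightarrow> V x \<ge> 0" and x: "x \<in> {-1..1}"
  shows "W x \<ge> 0"
proof (rule ccontr)
  assume "\<not> W x \<ge> 0"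
  obtain a where a: "a \<in> {-1..1}" "\<And>x. x \<in> {-1..1} \<Longrightarrow> W a \<le> W x" "a \<in> {-1<..<1} \<Longrightarrow> - P a = 0"
    using minimum_critical_in_interior[OF W] by blast
  have "W a < 0" using a(2)[OF x] \<open>\<not> W x \<ge> 0\<close> by simp
  show False
  proof (rule critical_minimum_not_concave[OF W _ a(1,2)])
    show "((\<lambda>x. - P x) has_real_derivative - ((V a - W a) / \<epsilon>)) (at a within {-1..1})"
      by (intro DERIV_minus P a)
    show "- P a = 0" using a(1,3) bd by (cases "a = -1 \<or> a = 1") auto
    show "- ((V a - W a) / \<epsilon>) < 0" using \<open>W a < 0\<close> V[OF a(1)] eps by simp
  qed
qed

text \<open>
  The maximum principle for \<open>- \<epsilon> P'' + P = - g\<close> with Dirichlet conditions: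
  a minimum below \<open>- c \<le> 0\<close> is attained in the interior, and there
  \<open>\<epsilon> P'' = P + g\<close> would be negative.
\<close>

lemma dirichlet_resolvent_lower:
  fixes P Q g :: "real \<Rightarrow> real"
  assumes eps: "\<epsilon> > 0"
    and P: "\<And>x. x \<in> {-1..1} \<Longrightarrow> (P has_real_derivative Q x) (at x within {-1..1})"
    and Q: "\<And>x. x \<in> {-1..1} \<Longrightarrow> (Q has_real_derivative (P x + g x) / \<epsilon>) (at x within {-1..1})"
    and bd: "P (-1) = 0" "P 1 = 0" and g: "\<And>x. x \<in> {-1..1} \<Longrightarrow> g x \<le> c" and c: "c \<ge> 0" and x: "x \<in> {-1..1}"
  shows "P x \<ge> - c"
proof (rule ccontr)
  assume "\<not> P x \<ge> - c"
  obtain a where a: "a \<in> {-1..1}" "\<And>x. x \<in> {-1..1} \<Longrightarrow> P a \<le> P x" "a \<in> {-1<..<1} \<Longrightarrow> Q a = 0"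
    using minimum_critical_in_interior[OF P] by blast
  have lt: "P a < - c" using a(2)[OF x] \<open>\<not> P x \<ge> - c\<close> by simp
  show False
  proof (rule critical_minimum_not_concave[OF P Q[OF a(1)] a(1,2)])
    show "Q a = 0" using a(1,3) bd lt c by (cases "a = -1 \<or> a = 1") auto
    show "(P a + g a) / \<epsilon> < 0" using lt g[OF a(1)] eps by (simp add: divide_neg_pos)
  qed
qed

lemma dirichlet_resolvent_bound:
  fixes P Q g :: "real \<Rightarrow> real"
  assumes eps: "\<epsilon> > 0"
    and P: "\<And>x. x \<in> {-1..1} \<Longrightarrow> (P has_real_derivative Q x) (at x within {-1..1})"
    and Q: "\<And>x. x \<in> {-1..1} \<Longrightarrow> (Q has_real_derivative (P x + g x) / \<epsilon>) (at x within {-1..1})"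
    and bd: "P (-1) = 0" "P 1 = 0" and g: "\<And>x. x \<in> {-1..1} \<Longrightarrow> \<bar>g x\<bar> \<le> c" and x: "x \<in> {-1..1}"
  shows "\<bar>P x\<bar> \<le> c"
proof -
  have c: "c \<ge> 0" using g[OF x] by simp
  have 1: "g y \<le> c" "- g y \<le> c" if "y \<in> {-1..1}" for y using g[OF that] by auto
  have "P x \<ge> - c" by (rule dirichlet_resolvent_lower[OF eps P Q bd 1(1) c x])
  moreover have "- P x \<ge> - c"
  proof (rule dirichlet_resolvent_lower[OF eps, of "\<lambda>x. - P x" "\<lambda>x. - Q x" "\<lambda>x. - g x"])
    show "((\<lambda>x. - Q x) has_real_derivative (- P y + - g y) / \<epsilon>) (at y within {-1..1})" if "y \<in> {-1..1}" for y
      using DERIV_minus[OF Q[OF that]] by (simp add: minus_divide_left)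
  qed (use P bd 1 c x in \<open>auto intro: DERIV_minus\<close>)
  ultimately show ?thesis by simp
qed

text \<open>
  The differential equations for \<open>\<phi>\<close> and for the resolvent are stored as a
  first-order system for \<open>(P, W)\<close>.
\<close>

definition regular_slice ::
    "real \<Rightarrow> (real \<Rightarrow> real) \<Rightarrow> (real \<Rightarrow> real) \<Rightarrow> (real \<Rightarrow> real) \<Rightarrow>
     (real \<Rightarrow> real) \<Rightarrow> (real \<Rightarrow> real) \<Rightarrow> (real \<Rightarrow> real) \<Rightarrow> (real \<Rightarrow> real) \<Rightarrow> bool" where
  "regular_slice \<epsilon> f fx \<phi> F FX P W \<longleftrightarrow>
     continuous_on {-1..1} FX \<and>
     (AE x in lebesgue_on dom_I. f x = F x) \<and> (AE x in lebesgue_on dom_I. fx x = FX x) \<and>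
     (AE x in lebesgue_on dom_I. \<phi> x = P x) \<and>
     (\<forall>x\<in>{-1..1}. (F has_real_derivative FX x) (at x within {-1..1})) \<and>
     (\<forall>x\<in>{-1..1}. (P has_real_derivative (F x - W x) / \<epsilon>) (at x within {-1..1})) \<and>
     (\<forall>x\<in>{-1..1}. (W has_real_derivative - P x) (at x within {-1..1})) \<and>
     P (-1) = 0 \<and> P 1 = 0"

lemma boundary_value_unique:
  assumes "has_boundary_value f a c" "continuous_on {-1..1} F" "AE x in lebesgue_on dom_I. f x = F x" "a \<in> {-1..1}"
  shows "F a = c"
proof -
  obtain g where g: "continuous_on {-1..1} g" "AE x in lebesgue_on dom_I. f x = g x" "g a = c"
    using assms(1) by (auto simp: has_boundary_value_def)
  have "AE x in lebesgue_on dom_I. F x = g x" using assms(3) g(2) by eventually_elim simp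
  from continuous_AE_eq[OF assms(2) g(1) this assms(4)] g(3) show ?thesis by simp
qed

text \<open>
  The elliptic equation is read as a formula for \<open>\<phi>\<^sub>x\<^sub>x\<close>, whose
  right-hand side has a continuous representative; so \<open>\<phi>\<close> is twice
  continuously differentiable. Differentiating \<open>W = F - \<epsilon> \<phi>\<^sub>x\<close>
  and inserting this formula leaves \<open>- \<phi>\<close>.
\<close>

lemma regular_slice_exists:
  assumes eps: "\<epsilon> > 0" and s: "sobolev 2 f"
    and w: "has_weak_deriv dom_I 1 f fx" "has_weak_deriv dom_I 1 fx fxx"
    and e: "elliptic_solution \<epsilon> (\<lambda>x. - fx x) \<phi>"
  shows "\<exists>F FX P W. regular_slice \<epsilon> f fx \<phi> F FX P W"
proof -
  obtain FX where FX: "continuous_on {-1..1} FX" "AE x in lebesgue_on dom_I. fx x = FX x"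
    using L2_integrable_Icc(1)[OF sobolev_2_deriv(3)[OF s w], of "-1" 1]
    by (auto intro: weak_deriv_representative[OF w(2)])
  obtain F where F: "continuous_on {-1..1} F" "AE x in lebesgue_on dom_I. f x = F x"
    "\<And>x. x \<in> {-1..1} \<Longrightarrow> (F has_real_derivative FX x) (at x within {-1..1})"
    using weak_deriv_continuous_representative[OF w(1) FX] by blast
  obtain \<phi>x \<phi>xx where p: "sobolev 2 \<phi>" "has_weak_deriv dom_I 1 \<phi> \<phi>x" "has_weak_deriv dom_I 1 \<phi>x \<phi>xx"
    "AE x in lebesgue_on dom_I. - \<epsilon> * \<phi>xx x + \<phi> x = - fx x"
    and bd: "has_boundary_value \<phi> (-1) 0" "has_boundary_value \<phi> 1 0"
    using e unfolding elliptic_solution_def by blast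
  obtain P0 where P0: "continuous_on {-1..1} P0" "AE x in lebesgue_on dom_I. \<phi> x = P0 x"
    using L2_integrable_Icc(1)[OF sobolev_2_deriv(2)[OF p(1-3)], of "-1" 1]
    by (auto intro: weak_deriv_representative[OF p(2)])
  have c: "continuous_on {-1..1} (\<lambda>x. (P0 x + FX x) / \<epsilon>)"
    using eps by (intro continuous_intros P0 FX) auto
  have "AE x in lebesgue_on dom_I. \<phi>xx x = (P0 x + FX x) / \<epsilon>"
    using p(4) P0(2) FX(2) by eventually_elim (use eps in \<open>simp add: field_simps\<close>)
  then obtain PX where PX: "continuous_on {-1..1} PX" "AE x in lebesgue_on dom_I. \<phi>x x = PX x"
    "\<And>x. x \<in> {-1..1} \<Longrightarrow> (PX has_real_derivative (P0 x + FX x) / \<epsilon>) (at x within {-1..1})"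
    using weak_deriv_continuous_representative[OF p(3) c] by blast
  obtain P where P: "continuous_on {-1..1} P" "AE x in lebesgue_on dom_I. \<phi> x = P x"
    "\<And>x. x \<in> {-1..1} \<Longrightarrow> (P has_real_derivative PX x) (at x within {-1..1})"
    using weak_deriv_continuous_representative[OF p(2) PX(1,2)] by blast
  have "AE x in lebesgue_on dom_I. P x = P0 x" using P(2) P0(2) by eventually_elim simp
  then have PP: "P x = P0 x" if "x \<in> {-1..1}" for x using continuous_AE_eq[OF P(1) P0(1) _ that] by blast
  define W where "W x = F x - \<epsilon> * PX x" for x
  have "(W has_real_derivative - P x) (at x within {-1..1})" if "x \<in> {-1..1}" for x
  proof -
    have "(W has_real_derivative FX x - \<epsilon> * ((P0 x + FX x) / \<epsilon>)) (at x within {-1..1})"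
      unfolding W_def by (intro DERIV_diff F(3) that DERIV_cmult PX(3))
    then show ?thesis using eps PP[OF that] by simp
  qed
  moreover have "(F x - W x) / \<epsilon> = PX x" for x using eps by (simp add: W_def)
  moreover have "P (-1) = 0" "P 1 = 0"
    using boundary_value_unique[OF bd(1) P(1,2)] boundary_value_unique[OF bd(2) P(1,2)] by auto
  ultimately have "regular_slice \<epsilon> f fx \<phi> F FX P W"
    unfolding regular_slice_def using FX F P by auto
  then show ?thesis by blast
qed

text \<open>
  Uniform continuity in time of the slices \<open>F s\<close>, quantified by
  \<open>\<omega>\<close>, is the form in which the Sobolev bounds below deliver continuity.
\<close>

lemma jointly_continuous:
  fixes F :: "real \<Rightarrow> real \<Rightarrow> real"
  assumes c: "\<And>s. s > 0 \<Longrightarrow> continuous_on {-1..1} (F s)"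
    and \<omega>: "\<And>s. s > 0 \<Longrightarrow> ((\<omega> s) \<longlongrightarrow> 0) (at s within {0<..})"
    and b: "\<And>s t x. s > 0 \<Longrightarrow> t > 0 \<Longrightarrow> x \<in> {-1..1} \<Longrightarrow> \<bar>F t x - F s x\<bar> \<le> \<omega> s t"
  shows "continuous_on ({0<..} \<times> {-1..1}) (\<lambda>(t, x). F t x)"
  unfolding continuous_on_iff
proof (intro ballI allI impI)
  fix p :: "real \<times> real" and e :: real assume p: "p \<in> {0<..} \<times> {-1..1}" and e: "e > 0"
  obtain s x where sx: "p = (s, x)" "s > 0" "x \<in> {-1..1}" using p by auto
  obtain d1 where d1: "d1 > 0" "\<And>t. t > 0 \<Longrightarrow> t \<noteq> s \<Longrightarrow> dist t s < d1 \<Longrightarrow> \<bar>\<omega> s t\<bar> < e / 2"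
    using tendstoD[OF \<omega>[OF sx(2)], of "e / 2"] e unfolding eventually_at by auto
  obtain d2 where d2: "d2 > 0" "\<And>y. y \<in> {-1..1} \<Longrightarrow> dist y x < d2 \<Longrightarrow> \<bar>F s y - F s x\<bar> < e / 2"
    using c[OF sx(2), unfolded continuous_on_iff, rule_format, OF sx(3), of "e / 2"] e
    by (auto simp: dist_real_def)
  show "\<exists>d>0. \<forall>q\<in>{0<..} \<times> {-1..1}. dist q p < d \<longrightarrow>
      dist (case q of (t, x) \<Rightarrow> F t x) (case p of (t, x) \<Rightarrow> F t x) < e"
  proof (intro exI[of _ "min d1 d2"] conjI ballI impI)
    fix q :: "real \<times> real" assume q: "q \<in> {0<..} \<times> {-1..1}" "dist q p < min d1 d2"
    obtain t y where ty: "q = (t, y)" "t > 0" "y \<in> {-1..1}" using q by auto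
    have dd: "dist t s < d1" "dist y x < d2"
      using q(2) dist_fst_le[of q p] dist_snd_le[of q p] by (auto simp: ty sx)
    have "\<bar>F t y - F s y\<bar> < e / 2"
    proof (cases "t = s")
      case False
      have "\<bar>F t y - F s y\<bar> \<le> \<omega> s t" by (rule b[OF sx(2) ty(2,3)])
      with d1(2)[OF ty(2) False dd(1)] show ?thesis by simp
    qed (use e in simp)
    with d2(2)[OF ty(3) dd(2)] have "\<bar>F t y - F s x\<bar> < e" by linarith
    then show "dist (case q of (t, x) \<Rightarrow> F t x) (case p of (t, x) \<Rightarrow> F t x) < e"
      by (simp add: ty sx dist_real_def)
  qed (use d1 d2 in auto)
qed

text \<open>
  The Sobolev inequality controls the function and its first derivative, and the maximum
  principle transfers the bound to the potential, because the elliptic problem is linear.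
\<close>

lemma regular_slice_diff_bounds:
  assumes eps: "\<epsilon> > 0"
    and 1: "sobolev 2 f1" "has_weak_deriv dom_I 1 f1 fx1" "has_weak_deriv dom_I 1 fx1 fxx1"
      "regular_slice \<epsilon> f1 fx1 \<phi>1 F1 FX1 P1 W1"
    and 2: "sobolev 2 f2" "has_weak_deriv dom_I 1 f2 fx2" "has_weak_deriv dom_I 1 fx2 fxx2"
      "regular_slice \<epsilon> f2 fx2 \<phi>2 F2 FX2 P2 W2"
    and x: "x \<in> {-1..1}"
  defines "\<omega> \<equiv> 3 * sobolev_norm 2 (\<lambda>x. f1 x - f2 x)"
  shows "\<bar>F1 x - F2 x\<bar> \<le> \<omega>" "\<bar>FX1 x - FX2 x\<bar> \<le> \<omega>" "\<bar>P1 x - P2 x\<bar> \<le> \<omega>"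
proof -
  note r = 1(4)[unfolded regular_slice_def] 2(4)[unfolded regular_slice_def]
  have s: "sobolev 2 (\<lambda>x. f1 x - f2 x)" by (rule sobolev_diff[OF 1(1) 2(1)])
  have w1: "has_weak_deriv dom_I 1 (\<lambda>x. f1 x - f2 x) (\<lambda>x. fx1 x - fx2 x)"
    by (rule has_weak_deriv_diff[OF 1(2) 2(2)])
  have w2: "has_weak_deriv dom_I 1 (\<lambda>x. fx1 x - fx2 x) (\<lambda>x. fxx1 x - fxx2 x)"
    by (rule has_weak_deriv_diff[OF 1(3) 2(3)])
  note S = sobolev_2_deriv[OF s w1 w2]
  have cont: "continuous_on {-1..1} F1" "continuous_on {-1..1} F2"
    using r by (meson DERIV_continuous continuous_on_eq_continuous_within)+
  have "\<bar>F1 x - F2 x\<bar> \<le> L2_norm (\<lambda>x. f1 x - f2 x) + 2 * L2_norm (\<lambda>x. fx1 x - fx2 x)"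
  proof (rule sobolev_sup_bound[OF w1 S(1,2) _ _ x])
    show "continuous_on {-1..1} (\<lambda>x. F1 x - F2 x)" by (intro continuous_intros cont)
    have "AE x in lebesgue_on dom_I. f1 x = F1 x" "AE x in lebesgue_on dom_I. f2 x = F2 x"
      using r by auto
    then show "AE x in lebesgue_on dom_I. f1 x - f2 x = F1 x - F2 x" by eventually_elim simp
  qed
  with S(4,5) show "\<bar>F1 x - F2 x\<bar> \<le> \<omega>" unfolding \<omega>_def by linarith
  have FX: "\<bar>FX1 x - FX2 x\<bar> \<le> \<omega>" if x: "x \<in> {-1..1}" for x
  proof -
    have "\<bar>FX1 x - FX2 x\<bar> \<le> L2_norm (\<lambda>x. fx1 x - fx2 x) + 2 * L2_norm (\<lambda>x. fxx1 x - fxx2 x)"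
    proof (rule sobolev_sup_bound[OF w2 S(2,3) _ _ x])
      show "continuous_on {-1..1} (\<lambda>x. FX1 x - FX2 x)" using r by (intro continuous_intros) auto
      have "AE x in lebesgue_on dom_I. fx1 x = FX1 x" "AE x in lebesgue_on dom_I. fx2 x = FX2 x"
        using r by auto
      then show "AE x in lebesgue_on dom_I. fx1 x - fx2 x = FX1 x - FX2 x" by eventually_elim simp
    qed
    with S(5,6) show ?thesis unfolding \<omega>_def by linarith
  qed
  from FX[OF x] show "\<bar>FX1 x - FX2 x\<bar> \<le> \<omega>" .
  show "\<bar>P1 x - P2 x\<bar> \<le> \<omega>"
  proof (rule dirichlet_resolvent_bound[OF eps _ _ _ _ FX x])
    show "((\<lambda>x. P1 x - P2 x) has_real_derivative (F1 y - W1 y) / \<epsilon> - (F2 y - W2 y) / \<epsilon>) (at y within {-1..1})"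
      if "y \<in> {-1..1}" for y
      using r that by (intro DERIV_diff) auto
    show "((\<lambda>y. (F1 y - W1 y) / \<epsilon> - (F2 y - W2 y) / \<epsilon>) has_real_derivative
        ((P1 y - P2 y) + (FX1 y - FX2 y)) / \<epsilon>) (at y within {-1..1})"
      if "y \<in> {-1..1}" for y
    proof -
      have "((\<lambda>y. (F1 y - W1 y) / \<epsilon> - (F2 y - W2 y) / \<epsilon>) has_real_derivative
        ((FX1 y - - P1 y) / \<epsilon> - (FX2 y - - P2 y) / \<epsilon>)) (at y within {-1..1})"
        using r that by (intro DERIV_diff DERIV_cdivide) auto
      then show ?thesis by (simp add: diff_divide_distrib add_divide_distrib algebra_simps)
    qed
  qed (use r in auto)
qed

section \<open>The distributional time derivative\<close>

text \<open>
  Lebesgue measure on the plane is the completion of a product measure but not itself one, so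
  the iterated integral is computed for a Borel representative.
\<close>

lemma lebesgue_Fubini:
  fixes f :: "real \<times> real \<Rightarrow> real"
  assumes f: "integrable lebesgue f"
  shows "integral\<^sup>L lebesgue f = (LINT t|lebesgue. LINT x|lebesgue. f (t, x))"
proof -
  obtain g where g: "g \<in> borel_measurable lborel" and fg: "AE p in lborel. f p = g p"
    using completion_ex_borel_measurable_real[OF borel_measurable_integrable[OF f]] by blast
  have fg': "AE p in lebesgue. f p = g p" using fg by (rule AE_completion)
  have gl: "g \<in> borel_measurable lebesgue" by (rule measurable_completion[OF g])
  have "integrable lebesgue g"
    using integrable_cong_AE[OF borel_measurable_integrable[OF f] gl fg'] f by blast
  then have gi: "integrable lborel g" using integrable_completion[OF g] by blast
  have gi': "integrable (lborel \<Otimes>\<^sub>M lborel) g" using gi by (simp add: lborel_prod)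
  have "integral\<^sup>L lebesgue f = integral\<^sup>L lborel g"
    using integral_cong_AE[OF borel_measurable_integrable[OF f] gl fg'] integral_completion[OF g] by simp
  also have "\<dots> = (LINT t|lborel. LINT x|lborel. g (t, x))"
    using lborel_pair.integral_fst'[OF gi'] by (simp add: lborel_prod)
  also have "\<dots> = (LINT t|lebesgue. LINT x|lborel. g (t, x))"
    using lborel_pair.integrable_fst'[OF gi'] by (intro integral_completion[symmetric]) auto
  also have "\<dots> = (LINT t|lebesgue. LINT x|lebesgue. f (t, x))"
  proof -
    have "AE p in lborel \<Otimes>\<^sub>M lborel. f p = g p"
      by (subst lborel_prod) (rule fg)
    then have "AE t in lborel. AE x in lborel. f (t, x) = g (t, x)"
      by (rule lborel_pair.AE_pair)
    then have "AE t in lebesgue. AE x in lborel. f (t, x) = g (t, x)" by (rule AE_completion)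
    then have ae: "AE t in lebesgue. (LINT x|lborel. g (t, x)) = (LINT x|lebesgue. f (t, x))"
    proof eventually_elim
      case (elim t)
      then have e: "AE x in lebesgue. g (t, x) = f (t, x)"
        by (intro AE_completion) (simp add: eq_commute)
      have m: "(\<lambda>x. g (t, x)) \<in> borel_measurable lborel"
        using g by (simp add: lborel_prod[symmetric] measurable_compose[OF measurable_Pair1'])
      have m': "(\<lambda>x. g (t, x)) \<in> borel_measurable lebesgue" by (rule measurable_completion[OF m])
      have "(LINT x|lebesgue. g (t, x)) = (LINT x|lebesgue. f (t, x))"
        by (rule integral_cong_AE[OF m' borel_measurable_AE[OF m' e] e])
      then show ?case using integral_completion[OF m] by simp
    qed
    have m: "(\<lambda>t. LINT x|lborel. g (t, x)) \<in> borel_measurable lebesgue"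
      using borel_measurable_integrable[OF lborel_pair.integrable_fst'[OF gi']] by (rule measurable_completion)
    show ?thesis
      by (rule integral_cong_AE[OF m borel_measurable_AE[OF m ae] ae])
  qed
  finally show ?thesis .
qed

text \<open>
  With a product test function \<open>a(t) b(x)\<close> the distributional equation becomes a
  weak equation in time for the moment \<open>t \<mapsto> \<integral> u b\<close>.
\<close>

lemma time_weak_identity:
  fixes u ut :: "real \<Rightarrow> real \<Rightarrow> real"
  assumes w: "has_weak_deriv ({0<..} \<times> dom_I) (1, 0) (\<lambda>(t, x). u t x) (\<lambda>(t, x). ut t x)"
    and g: "\<And>t. t > 0 \<Longrightarrow> (LINT x:dom_I|lebesgue. u t x * b x) = g t"
    and A: "AE t in lebesgue. t > 0 \<longrightarrow> (LINT x:dom_I|lebesgue. ut t x * b x) = A t"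
    and A_meas: "(\<lambda>t. indicator {0<..} t * A t) \<in> borel_measurable lebesgue"
    and b: "test_function dom_I b" and a: "test_function {0<..} a"
  shows "(LINT t:{0<..}|lebesgue. g t * frechet_derivative a (at t) 1) = - (LINT t:{0<..}|lebesgue. A t * a t)"
proof -
  let ?\<Omega> = "{0<..} \<times> dom_I :: (real \<times> real) set"
  let ?a' = "\<lambda>t. frechet_derivative a (at t) 1"
  obtain K where K: "compact K" "K \<subseteq> {0<..}" "continuous_on UNIV a" "\<And>t. t \<notin> K \<Longrightarrow> a t = 0"
    "continuous_on UNIV ?a'" "\<And>t. t \<notin> K \<Longrightarrow> ?a' t = 0" "\<And>t. (a has_real_derivative ?a' t) (at t)"
    by (rule test_function_real[OF a]) blast
  obtain L where L: "compact L" "L \<subseteq> dom_I" "continuous_on UNIV b" "\<And>t. t \<notin> L \<Longrightarrow> b t = 0"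
    "\<And>t. (b has_real_derivative frechet_derivative b (at t) 1) (at t)"
    by (rule test_function_real[OF b]) blast
  let ?\<psi> = "\<lambda>(t, x). a t * b x"
  have KL: "compact (K \<times> L)" "K \<times> L \<subseteq> ?\<Omega>" using K L by (auto intro: compact_Times)
  have t: "test_function ?\<Omega> ?\<psi>"
    unfolding test_function_def
  proof (intro conjI allI exI[of _ "K \<times> L"] impI)
    show "C_k k ?\<psi>" for k
      using a b by (intro C_k_tensor) (auto simp: test_function_def)
    show "?\<psi> p = 0" if "p \<notin> K \<times> L" for p
      using that K(4)[of "fst p"] L(4)[of "snd p"] by (cases p) auto
  qed (use KL in auto)
  have d: "frechet_derivative ?\<psi> (at (t, x)) (1, 0) = ?a' t * b x" for t x
    using frechet_derivative_at[OF has_derivative_tensor[OF K(7)[of t] L(5)[of x]]]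
    by (metis (mono_tags, lifting) case_prod_conv mult.right_neutral mult_zero_right add.right_neutral)
  have li: "locally_integrable ?\<Omega> (\<lambda>(t, x). u t x)" "locally_integrable ?\<Omega> (\<lambda>(t, x). ut t x)"
    and id: "(LINT p:?\<Omega>|lebesgue. (case p of (t, x) \<Rightarrow> u t x) * frechet_derivative ?\<psi> (at p) (1, 0))
        = - (LINT p:?\<Omega>|lebesgue. (case p of (t, x) \<Rightarrow> ut t x) * ?\<psi> p)"
    using w t unfolding has_weak_deriv_def by blast+
  have F: "(LINT p:?\<Omega>|lebesgue. (case p of (t, x) \<Rightarrow> h t x) * (case p of (t, x) \<Rightarrow> \<alpha> t * b x))
      = (LINT t|lebesgue. indicator {0<..} t * \<alpha> t * (LINT x:dom_I|lebesgue. h t x * b x))"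
    if "locally_integrable ?\<Omega> (\<lambda>(t, x). h t x)" "continuous_on UNIV \<alpha>" "\<And>t. t \<notin> K \<Longrightarrow> \<alpha> t = 0"
    for h :: "real \<Rightarrow> real \<Rightarrow> real" and \<alpha> :: "real \<Rightarrow> real"
  proof -
    have "set_integrable lebesgue ?\<Omega> (\<lambda>p. (case p of (t, x) \<Rightarrow> h t x) * (case p of (t, x) \<Rightarrow> \<alpha> t * b x))"
    proof (rule locally_integrable_test[OF that(1) KL])
      show "continuous_on UNIV (\<lambda>(t, x). \<alpha> t * b x)"
        unfolding case_prod_unfold
        by (intro continuous_intros continuous_on_compose2[OF that(2)] continuous_on_compose2[OF L(3)]) auto
      show "(case p of (t, x) \<Rightarrow> \<alpha> t * b x) = 0" if "p \<notin> K \<times> L" for p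
        using that \<open>\<And>t. t \<notin> K \<Longrightarrow> \<alpha> t = 0\<close>[of "fst p"] L(4)[of "snd p"] by (cases p) auto
    qed
    from lebesgue_Fubini[OF this[unfolded set_integrable_def]]
    have "(LINT p:?\<Omega>|lebesgue. (case p of (t, x) \<Rightarrow> h t x) * (case p of (t, x) \<Rightarrow> \<alpha> t * b x))
      = (LINT t|lebesgue. LINT x|lebesgue. indicator ?\<Omega> (t, x) *\<^sub>R (h t x * (\<alpha> t * b x)))"
      by (simp add: set_lebesgue_integral_def)
    also have "(\<lambda>t. LINT x|lebesgue. indicator ?\<Omega> (t, x) *\<^sub>R (h t x * (\<alpha> t * b x)))
        = (\<lambda>t. indicator {0<..} t * \<alpha> t * (LINT x:dom_I|lebesgue. h t x * b x))"
    proof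
      fix t
      have "(LINT x|lebesgue. indicator ?\<Omega> (t, x) *\<^sub>R (h t x * (\<alpha> t * b x)))
        = (LINT x|lebesgue. (indicator {0<..} t * \<alpha> t) * (indicator dom_I x *\<^sub>R (h t x * b x)))"
        by (intro Bochner_Integration.integral_cong refl) (simp add: indicator_times)
      then show "(LINT x|lebesgue. indicator ?\<Omega> (t, x) *\<^sub>R (h t x * (\<alpha> t * b x)))
        = indicator {0<..} t * \<alpha> t * (LINT x:dom_I|lebesgue. h t x * b x)"
        by (simp add: set_lebesgue_integral_def)
    qed
    finally show ?thesis .
  qed
  have d': "frechet_derivative ?\<psi> (at p) (1, 0) = (case p of (t, x) \<Rightarrow> ?a' t * b x)" for p
    using d by (cases p) simp
  have "(LINT p:?\<Omega>|lebesgue. (case p of (t, x) \<Rightarrow> u t x) * frechet_derivative ?\<psi> (at p) (1, 0))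
      = (LINT p:?\<Omega>|lebesgue. (case p of (t, x) \<Rightarrow> u t x) * (case p of (t, x) \<Rightarrow> ?a' t * b x))"
    unfolding d' ..
  also have "\<dots> = (LINT t|lebesgue. indicator {0<..} t * ?a' t * (LINT x:dom_I|lebesgue. u t x * b x))"
    by (rule F[OF li(1) K(5,6)])
  also have "\<dots> = (LINT t:{0<..}|lebesgue. g t * ?a' t)"
    unfolding set_lebesgue_integral_def[of lebesgue "{0<..}"]
  proof (intro Bochner_Integration.integral_cong refl)
    fix t :: real
    show "indicator {0<..} t * ?a' t * (LINT x:dom_I|lebesgue. u t x * b x)
        = indicator {0<..} t *\<^sub>R (g t * ?a' t)"
      using g[of t] by (cases "t > 0") auto
  qed
  finally have 1: "(LINT p:?\<Omega>|lebesgue. (case p of (t, x) \<Rightarrow> u t x) * frechet_derivative ?\<psi> (at p) (1, 0))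
      = (LINT t:{0<..}|lebesgue. g t * ?a' t)" .
  have "(LINT p:?\<Omega>|lebesgue. (case p of (t, x) \<Rightarrow> ut t x) * ?\<psi> p)
      = (LINT t|lebesgue. indicator {0<..} t * a t * (LINT x:dom_I|lebesgue. ut t x * b x))"
    by (rule F[OF li(2) K(3,4)])
  also have "\<dots> = (LINT t:{0<..}|lebesgue. A t * a t)"
  proof -
    have ae: "AE t in lebesgue. (indicator {0<..} t * A t) * a t
        = indicator {0<..} t * a t * (LINT x:dom_I|lebesgue. ut t x * b x)"
      using A by eventually_elim (auto simp: indicator_def)
    have m: "(\<lambda>t. (indicator {0<..} t * A t) * a t) \<in> borel_measurable lebesgue"
      by (rule borel_measurable_times[OF A_meas borel_measurable_lebesgueI[OF borel_measurable_continuous_onI[OF K(3)]]])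
    from integral_cong_AE[OF m borel_measurable_AE[OF m ae] ae] show ?thesis
      by (simp add: set_lebesgue_integral_def mult.assoc)
  qed
  finally show ?thesis using id 1 by simp
qed

lemma step_kernel_has_integral:
  assumes "c \<le> d"
  shows "((\<lambda>x. n * deriv smooth_step (n * (x - p))) has_integral
     (smooth_step (n * (d - p)) - smooth_step (n * (c - p)))) {c..d}"
proof (rule fundamental_theorem_of_calculus[OF assms])
  fix x
  have "((\<lambda>x. smooth_step (n * (x - p))) has_real_derivative deriv smooth_step (n * (x - p)) * n) (at x)"
    by (rule DERIV_chain2[OF smooth_step_has_derivative]) (auto intro!: derivative_eq_intros)
  then show "((\<lambda>x. smooth_step (n * (x - p))) has_vector_derivative n * deriv smooth_step (n * (x - p))) (at x within {c..d})"
    by (simp add: has_real_derivative_iff_has_vector_derivative mult.commute has_vector_derivative_at_within)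
qed

lemma continuous_on_step_kernel: "continuous_on A (\<lambda>x. n * deriv smooth_step (n * (x - p)))"
  by (intro continuous_intros continuous_on_compose2[OF continuous_deriv_smooth_step]) auto

lemma step_kernel_bound:
  assumes h: "continuous_on {c..d} h" and "c \<le> d" "n > 0"
    and M: "\<And>x. x \<in> {c..d} \<Longrightarrow> n * (x - p) \<in> {0..1} \<Longrightarrow> \<bar>h x\<bar> \<le> M" "M \<ge> 0"
  shows "\<bar>integral {c..d} (\<lambda>x. h x * (n * deriv smooth_step (n * (x - p))))\<bar> \<le> M"
proof -
  let ?k = "\<lambda>x. n * deriv smooth_step (n * (x - p))"
  have "norm (integral {c..d} (\<lambda>x. h x * ?k x)) \<le> integral {c..d} (\<lambda>x. M * ?k x)"
  proof (rule integral_norm_bound_integral)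
    show "(\<lambda>x. h x * ?k x) integrable_on {c..d}"
      by (intro integrable_continuous_interval continuous_on_mult h continuous_on_step_kernel)
    show "(\<lambda>x. M * ?k x) integrable_on {c..d}"
      by (intro integrable_continuous_interval continuous_on_mult continuous_on_const continuous_on_step_kernel)
    show "norm (h x * ?k x) \<le> M * ?k x" if "x \<in> {c..d}" for x
    proof (cases "n * (x - p) \<in> {0..1}")
      case True
      then show ?thesis using M(1)[of x] that \<open>n > 0\<close> deriv_smooth_step_nonneg[of "n * (x - p)"]
        by (simp add: abs_mult mult_right_mono)
    next
      case False
      then have "deriv smooth_step (n * (x - p)) = 0" by (intro deriv_smooth_step_eq_0) auto
      then show ?thesis by simp
    qed
  qed
  also have "\<dots> = M * (smooth_step (n * (d - p)) - smooth_step (n * (c - p)))"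
    by (rule integral_unique[OF has_integral_mult_right[OF step_kernel_has_integral[OF \<open>c \<le> d\<close>]]])
  also have "\<dots> \<le> M * 1"
    using smooth_step_bounds[of "n * (d - p)"] smooth_step_bounds[of "n * (c - p)"] M(2)
    by (intro mult_left_mono) auto
  finally show ?thesis by simp
qed

text \<open>
  The derivatives of the rescaled steps form an approximate identity concentrated to the right
  of \<open>p\<close>.
\<close>

lemma step_kernel_tendsto:
  assumes h: "continuous_on {c..d} h" and p: "c \<le> p" "p < d" and N: "N > 0"
  shows "(\<lambda>k. integral {c..d} (\<lambda>x. h x * (real (k + N) * deriv smooth_step (real (k + N) * (x - p))))) \<longlonglongrightarrow> h p"
proof (rule LIMSEQ_I)
  fix e :: real assume e: "e > 0"
  obtain \<eta> where \<eta>: "\<eta> > 0" "\<And>x. x \<in> {c..d} \<Longrightarrow> dist x p < \<eta> \<Longrightarrow> \<bar>h x - h p\<bar> < e / 2"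
    using h[unfolded continuous_on_iff, rule_format, of p "e / 2"] p e by (auto simp: dist_real_def)
  obtain K where K: "1 / real (Suc K) < min \<eta> (d - p)" using nat_approx_posE[of "min \<eta> (d - p)"] \<eta> p by auto
  show "\<exists>K. \<forall>k\<ge>K. norm (integral {c..d} (\<lambda>x. h x * (real (k + N) * deriv smooth_step (real (k + N) * (x - p)))) - h p) < e"
  proof (intro exI[of _ "Suc K"] allI impI)
    fix k assume "k \<ge> Suc K"
    define n where "n = real (k + N)"
    have n: "n > 0" "n \<ge> real (Suc K)" using N \<open>k \<ge> Suc K\<close> by (auto simp: n_def)
    then have "1 / n \<le> 1 / real (Suc K)" by (intro divide_left_mono) auto
    with K have n1: "1 / n < \<eta>" "1 / n < d - p" by auto
    let ?k = "\<lambda>x. n * deriv smooth_step (n * (x - p))"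
    have "smooth_step (n * (d - p)) = 1" using n1(2) n(1) by (intro smooth_step_1) (simp add: field_simps)
    moreover have "smooth_step (n * (c - p)) = 0" using p n(1) by (intro smooth_step_0) (simp add: mult_nonneg_nonpos)
    ultimately have I: "(?k has_integral 1) {c..d}" using step_kernel_has_integral[of c d n p] p by simp
    have "integral {c..d} (\<lambda>x. h p * ?k x) = h p * 1"
      by (rule integral_unique[OF has_integral_mult_right[OF I]])
    then have "integral {c..d} (\<lambda>x. h x * ?k x) - h p = integral {c..d} (\<lambda>x. h x * ?k x) - integral {c..d} (\<lambda>x. h p * ?k x)"
      by simp
    also have "\<dots> = integral {c..d} (\<lambda>x. h x * ?k x - h p * ?k x)"
      by (intro Henstock_Kurzweil_Integration.integral_diff[symmetric] integrable_continuous_interval continuous_on_mult h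
            continuous_on_step_kernel continuous_on_const)
    also have "\<dots> = integral {c..d} (\<lambda>x. (h x - h p) * ?k x)" by (simp add: left_diff_distrib)
    finally have "\<bar>integral {c..d} (\<lambda>x. h x * ?k x) - h p\<bar> = \<bar>integral {c..d} (\<lambda>x. (h x - h p) * ?k x)\<bar>" by simp
    also have "\<dots> \<le> e / 2"
    proof (rule step_kernel_bound)
      show "continuous_on {c..d} (\<lambda>x. h x - h p)" by (intro continuous_intros h)
      show "\<bar>h x - h p\<bar> \<le> e / 2" if "x \<in> {c..d}" "n * (x - p) \<in> {0..1}" for x
      proof -
        have "0 \<le> x - p" "x - p \<le> 1 / n" using that(2) n(1) by (auto simp: field_simps zero_le_mult_iff)
        then have "dist x p < \<eta>" using n1(1) by (simp add: dist_real_def)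
        from \<eta>(2)[OF that(1) this] show ?thesis by simp
      qed
    qed (use p n e in auto)
    finally show "norm (integral {c..d} (\<lambda>x. h x * (real (k + N) * deriv smooth_step (real (k + N) * (x - p)))) - h p) < e"
      using e unfolding n_def by simp
  qed
qed

lemma set_integral_test_eq_integral:
  fixes h \<psi> :: "real \<Rightarrow> real"
  assumes "\<And>x. x \<notin> {p..q} \<Longrightarrow> \<psi> x = 0" "{p..q} \<subseteq> \<Omega>" "continuous_on {p..q} (\<lambda>x. h x * \<psi> x)"
  shows "(LINT x:\<Omega>|lebesgue. h x * \<psi> x) = integral {p..q} (\<lambda>x. h x * \<psi> x)"
proof -
  have "(LINT x:\<Omega>|lebesgue. h x * \<psi> x) = (LINT x:{p..q}|lebesgue. h x * \<psi> x)"
    unfolding set_lebesgue_integral_def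
  proof (intro Bochner_Integration.integral_cong refl)
    fix x show "indicator \<Omega> x *\<^sub>R (h x * \<psi> x) = indicator {p..q} x *\<^sub>R (h x * \<psi> x)"
      using assms(1)[of x] assms(2) by (cases "x \<in> {p..q}") (auto simp: indicator_def)
  qed
  also have "\<dots> = integral {p..q} (\<lambda>x. h x * \<psi> x)"
    by (rule set_lebesgue_integral_eq_integral(2)[OF absolutely_integrable_continuous_real[OF assms(3)]])
  finally show ?thesis .
qed

lemma locally_integrable_continuous:
  fixes h :: "real \<Rightarrow> real"
  assumes "continuous_on \<Omega> h" shows "locally_integrable \<Omega> h"
  unfolding locally_integrable_def
proof (intro allI impI)
  fix K assume K: "compact K \<and> K \<subseteq> \<Omega>"
  then have "continuous_on K h" using assms continuous_on_subset by blast
  with K show "set_integrable lebesgue K h"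
    using borel_integrable_compact[of K h]
      by (auto simp: set_integrable_def integrable_completion borel_measurable_integrable indicator_scaleR_eq_if)
qed

text \<open>
  Test functions approximating the indicator of \<open>(t1,t2]\<close> have derivatives
  approximating the difference of the point masses at \<open>t1\<close> and \<open>t2\<close>.
\<close>

lemma weak_time_increment:
  fixes g A :: "real \<Rightarrow> real" and t1 t2 :: real
  assumes g: "continuous_on {0<..} g" and A: "continuous_on {0<..} A"
    and id: "\<And>a. test_function {0<..} a \<Longrightarrow>
      (LINT t:{0<..}|lebesgue. g t * frechet_derivative a (at t) 1) = - (LINT t:{0<..}|lebesgue. A t * a t)"
    and t: "0 < t1" "t1 < t2"
  shows "g t2 - g t1 = integral {t1..t2} A"
proof -
  obtain N where N: "N > 0" "\<And>k. t2 + 1 / real (k + N) \<le> t2 + 1"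
    using trapezoid_scale_exists[of t2 "t2 + 1"] by auto
  have n0: "real (k + N) > 0" for k using N(1) by simp
  let ?a = "\<lambda>k. trapezoid (real (k + N)) t1 t2"
  let ?k = "\<lambda>k p t. real (k + N) * deriv smooth_step (real (k + N) * (t - p))"
  have "(\<lambda>k. LINT t:{0<..}|lebesgue. A t * ?a k t) \<longlonglongrightarrow> integral {t1..t2} A"
    by (rule trapezoid_test_tendsto[OF locally_integrable_continuous[OF A] _ _ _ N]) (use t in auto)
  then have "(\<lambda>k. - (LINT t:{0<..}|lebesgue. A t * ?a k t)) \<longlonglongrightarrow> - integral {t1..t2} A"
    by (rule tendsto_minus)
  moreover have "- (LINT t:{0<..}|lebesgue. A t * ?a k t)
      = integral {t1..t2 + 1} (\<lambda>t. g t * ?k k t1 t) - integral {t1..t2 + 1} (\<lambda>t. g t * ?k k t2 t)" for k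
  proof -
    have cg: "continuous_on {t1..t2 + 1} g" by (rule continuous_on_subset[OF g]) (use t in auto)
    have "test_function {0<..} (?a k)"
      using t N(2)[of k] n0[of k] by (intro test_function_trapezoid) auto
    from id[OF this] have "- (LINT t:{0<..}|lebesgue. A t * ?a k t) =
        (LINT t:{0<..}|lebesgue. g t * (?k k t1 t - ?k k t2 t))"
      unfolding frechet_derivative_real[OF trapezoid_has_derivative] by simp
    also have "\<dots> = integral {t1..t2 + 1} (\<lambda>t. g t * (?k k t1 t - ?k k t2 t))"
    proof (rule set_integral_test_eq_integral)
      show "?k k t1 t - ?k k t2 t = 0" if "t \<notin> {t1..t2 + 1}" for t
      proof (cases "t < t1")
        case True
        then show ?thesis using t n0[of k]
          by (simp add: deriv_smooth_step_eq_0 mult_pos_neg del: of_nat_add)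
      next
        case False
        with that have "t > t2 + 1 / real (k + N)" using N(2)[of k] by auto
        then have "real (k + N) * (t - t2) > 1" "real (k + N) * (t - t1) > real (k + N) * (t - t2)"
          using n0[of k] t by (auto simp: field_simps simp del: of_nat_add)
        then show ?thesis by (simp add: deriv_smooth_step_eq_0 del: of_nat_add)
      qed
      show "continuous_on {t1..t2 + 1} (\<lambda>t. g t * (?k k t1 t - ?k k t2 t))"
        by (intro continuous_on_mult continuous_on_diff cg continuous_on_step_kernel)
    qed (use t in auto)
    also have e: "(\<lambda>t. g t * (?k k t1 t - ?k k t2 t)) = (\<lambda>t. g t * ?k k t1 t - g t * ?k k t2 t)"
      by (rule ext) (rule right_diff_distrib)
    also have "integral {t1..t2 + 1} (\<lambda>t. g t * ?k k t1 t - g t * ?k k t2 t)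
        = integral {t1..t2 + 1} (\<lambda>t. g t * ?k k t1 t) - integral {t1..t2 + 1} (\<lambda>t. g t * ?k k t2 t)"
      by (intro Henstock_Kurzweil_Integration.integral_diff integrable_continuous_interval continuous_on_mult cg continuous_on_step_kernel)
    finally show ?thesis .
  qed
  moreover have "(\<lambda>k. integral {t1..t2 + 1} (\<lambda>t. g t * ?k k t1 t) - integral {t1..t2 + 1} (\<lambda>t. g t * ?k k t2 t))
      \<longlonglongrightarrow> g t1 - g t2"
    by (intro tendsto_diff step_kernel_tendsto continuous_on_subset[OF g] N) (use t in auto)
  ultimately have "- integral {t1..t2} A = g t1 - g t2"
    using LIMSEQ_unique by (metis (no_types, lifting) ext)
  then show ?thesis by simp
qed

section \<open>The equation integrated in space\<close>

text \<open>
  At a fixed time all spatial derivatives are moved onto the test function by the definition of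
  weak derivatives, which leaves continuous functions only.
\<close>

lemma slice_weak_form:
  assumes r: "regular_slice \<epsilon> f fx \<phi> F FX P W" and w2: "has_weak_deriv dom_I 1 fx fxx"
    and wF: "has_weak_deriv dom_I 1 (\<lambda>x. f x * \<phi> x) Fx"
    and eq: "AE x in lebesgue_on dom_I. ft x = \<delta> * fxx x - Fx x + \<rho> * f x * (1 - f x)"
    and b: "test_function dom_I b"
  shows "(LINT x:dom_I|lebesgue. ft x * b x) = integral {-1..1} (\<lambda>x.
      - (\<delta> * FX x - F x * P x) * frechet_derivative b (at x) 1 + \<rho> * F x * (1 - F x) * b x)"
proof -
  let ?b' = "\<lambda>x. frechet_derivative b (at x) 1"
  note r = r[unfolded regular_slice_def]
  have ae: "AE x in lebesgue_on dom_I. f x = F x" "AE x in lebesgue_on dom_I. fx x = FX x"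
    "AE x in lebesgue_on dom_I. \<phi> x = P x" using r by auto
  have cF: "continuous_on {-1..1} F" "continuous_on {-1..1} P" "continuous_on {-1..1} FX"
    using r by (auto intro!: DERIV_continuous simp: continuous_on_eq_continuous_within)
  obtain L where L: "compact L" "L \<subseteq> dom_I" "continuous_on UNIV b" "\<And>t. t \<notin> L \<Longrightarrow> b t = 0"
    "continuous_on UNIV ?b'" "\<And>t. t \<notin> L \<Longrightarrow> ?b' t = 0"
    by (rule test_function_real[OF b]) blast
  have cb: "continuous_on {-1..1} b" "continuous_on {-1..1} ?b'"
    using L continuous_on_subset by blast+
  have int: "(LINT x:dom_I|lebesgue. h x) = integral {-1..1} h" if "continuous_on {-1..1} h" for h :: "real \<Rightarrow> real"
    using continuous_integral_dom_I(2)[OF that] by (simp add: set_lebesgue_dom_I)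
  let ?R = "\<lambda>x. \<rho> * F x * (1 - F x)"
  have cR: "continuous_on {-1..1} ?R" by (intro continuous_intros cF)
  have li: "locally_integrable dom_I fxx" "locally_integrable dom_I Fx" "locally_integrable dom_I ?R"
    using w2 wF locally_integrable_continuous[OF continuous_on_subset[OF cR greaterThanLessThan_subseteq_atLeastAtMost_iff[THEN iffD2]]]
    by (auto simp: has_weak_deriv_def)
  have si: "set_integrable lebesgue dom_I (\<lambda>x. h x * b x)" if "locally_integrable dom_I h" for h
    by (rule locally_integrable_test[OF that L(1-4)])
  have s1: "set_integrable lebesgue dom_I (\<lambda>x. \<delta> * (fxx x * b x))"
    using si[OF li(1)] by simp
  have "(LINT x:dom_I|lebesgue. ft x * b x)
      = (LINT x:dom_I|lebesgue. \<delta> * (fxx x * b x) - Fx x * b x + ?R x * b x)"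
  proof (rule set_integral_cong_dom_I)
    show "AE x in lebesgue_on dom_I. ft x * b x = \<delta> * (fxx x * b x) - Fx x * b x + ?R x * b x"
      using eq ae(1)
    proof eventually_elim
      case (elim x)
      show ?case unfolding elim by (simp only: algebra_simps)
    qed
  qed
  also have "\<dots> = \<delta> * (LINT x:dom_I|lebesgue. fxx x * b x) - (LINT x:dom_I|lebesgue. Fx x * b x)
      + (LINT x:dom_I|lebesgue. ?R x * b x)"
    using set_integral_add(2)[OF set_integral_diff(1)[OF s1 si[OF li(2)]] si[OF li(3)]]
      set_integral_diff(2)[OF s1 si[OF li(2)]] by simp
  also have "(LINT x:dom_I|lebesgue. fxx x * b x) = - (LINT x:dom_I|lebesgue. fx x * ?b' x)"
    using w2 b by (simp add: has_weak_deriv_def)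
  also have "(LINT x:dom_I|lebesgue. fx x * ?b' x) = (LINT x:dom_I|lebesgue. FX x * ?b' x)"
    by (rule set_integral_cong_dom_I) (use ae(2) in \<open>eventually_elim, simp\<close>)
  also have "\<dots> = integral {-1..1} (\<lambda>x. FX x * ?b' x)"
    by (rule int) (intro continuous_intros cF cb)
  also have "(LINT x:dom_I|lebesgue. Fx x * b x) = - (LINT x:dom_I|lebesgue. (f x * \<phi> x) * ?b' x)"
    using wF b by (simp add: has_weak_deriv_def)
  also have "(LINT x:dom_I|lebesgue. (f x * \<phi> x) * ?b' x) = (LINT x:dom_I|lebesgue. (F x * P x) * ?b' x)"
    by (rule set_integral_cong_dom_I) (use ae(1,3) in \<open>eventually_elim, simp\<close>)
  also have "\<dots> = integral {-1..1} (\<lambda>x. (F x * P x) * ?b' x)"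
    by (rule int) (intro continuous_intros cF cb)
  also have "(LINT x:dom_I|lebesgue. ?R x * b x) = integral {-1..1} (\<lambda>x. ?R x * b x)"
    by (rule int) (intro continuous_intros cF cb)
  also have "\<delta> * - integral {-1..1} (\<lambda>x. FX x * ?b' x) - - integral {-1..1} (\<lambda>x. (F x * P x) * ?b' x)
       + integral {-1..1} (\<lambda>x. ?R x * b x)
      = integral {-1..1} (\<lambda>x. - (\<delta> * FX x - F x * P x) * ?b' x + ?R x * b x)"
  proof -
    have i: "(\<lambda>x. FX x * ?b' x) integrable_on {-1..1}" "(\<lambda>x. (F x * P x) * ?b' x) integrable_on {-1..1}"
      "(\<lambda>x. ?R x * b x) integrable_on {-1..1}"
      by (intro integrable_continuous_interval continuous_intros cF cb)+
    have "((\<lambda>x. (- \<delta>) * (FX x * ?b' x) + (F x * P x) * ?b' x + ?R x * b x) has_integral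
       (- \<delta>) * integral {-1..1} (\<lambda>x. FX x * ?b' x) + integral {-1..1} (\<lambda>x. (F x * P x) * ?b' x)
         + integral {-1..1} (\<lambda>x. ?R x * b x)) {-1..1}"
      by (intro has_integral_add has_integral_mult_right integrable_integral i)
    then have "integral {-1..1} (\<lambda>x. (- \<delta>) * (FX x * ?b' x) + (F x * P x) * ?b' x + ?R x * b x) =
       (- \<delta>) * integral {-1..1} (\<lambda>x. FX x * ?b' x) + integral {-1..1} (\<lambda>x. (F x * P x) * ?b' x)
         + integral {-1..1} (\<lambda>x. ?R x * b x)" by (rule integral_unique)
    moreover have "(\<lambda>x. - (\<delta> * FX x - F x * P x) * ?b' x + ?R x * b x)
      = (\<lambda>x. (- \<delta>) * (FX x * ?b' x) + (F x * P x) * ?b' x + ?R x * b x)"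
      by (auto simp: algebra_simps)
    ultimately show ?thesis by simp
  qed
  finally show ?thesis .
qed

text \<open>
  As the test function approaches the indicator of \<open>(p,q]\<close>, only the fluxes through
  the two end points remain of the divergence term. The uniform bound serves as a majorant for
  the integration in time.
\<close>

lemma trapezoid_flux:
  assumes H: "continuous_on {-1..1} H" and R: "continuous_on {-1..1} R"
    and pq: "-1 < p" "p < q" "q < 1" and N: "N > 0" "\<And>k. q + 1 / real (k + N) \<le> (q + 1) / 2"
  defines "T \<equiv> \<lambda>k. trapezoid (real (k + N)) p q"
  shows "(\<lambda>k. integral {-1..1} (\<lambda>x. - H x * frechet_derivative (T k) (at x) 1 + R x * T k x))
      \<longlonglongrightarrow> H q - H p + integral {p..q} R"
    and "(\<And>x. x \<in> {-1..1} \<Longrightarrow> \<bar>H x\<bar> \<le> M) \<Longrightarrow> (\<And>x. x \<in> {-1..1} \<Longrightarrow> \<bar>R x\<bar> \<le> M) \<Longrightarrow>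
      \<bar>integral {-1..1} (\<lambda>x. - H x * frechet_derivative (T k) (at x) 1 + R x * T k x)\<bar> \<le> 4 * M"
proof -
  let ?k = "\<lambda>k p t. real (k + N) * deriv smooth_step (real (k + N) * (t - p))"
  have n0: "real (k + N) > 0" for k using N(1) by simp
  have split: "integral {-1..1} (\<lambda>x. - H x * frechet_derivative (T k) (at x) 1 + R x * T k x)
      = integral {-1..1} (\<lambda>x. H x * ?k k q x) - integral {-1..1} (\<lambda>x. H x * ?k k p x)
        + integral {-1..1} (\<lambda>x. R x * T k x)" for k
  proof -
    have i: "(\<lambda>x. H x * ?k k s x) integrable_on {-1..1}" "(\<lambda>x. R x * T k x) integrable_on {-1..1}" for s
      unfolding T_def
      by (intro integrable_continuous_interval continuous_on_mult H R continuous_on_step_kernel continuous_on_trapezoid)+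
    have "((\<lambda>x. H x * ?k k q x - H x * ?k k p x + R x * T k x) has_integral
        integral {-1..1} (\<lambda>x. H x * ?k k q x) - integral {-1..1} (\<lambda>x. H x * ?k k p x)
        + integral {-1..1} (\<lambda>x. R x * T k x)) {-1..1}"
      by (intro has_integral_add has_integral_diff integrable_integral i)
    moreover have "(\<lambda>x. H x * ?k k q x - H x * ?k k p x + R x * T k x)
        = (\<lambda>x. - H x * frechet_derivative (T k) (at x) 1 + R x * T k x)"
      unfolding T_def frechet_derivative_real[OF trapezoid_has_derivative]
      by (intro ext) (simp only: minus_mult_left[symmetric] right_diff_distrib minus_diff_eq)
    ultimately have "((\<lambda>x. - H x * frechet_derivative (T k) (at x) 1 + R x * T k x) has_integral
        integral {-1..1} (\<lambda>x. H x * ?k k q x) - integral {-1..1} (\<lambda>x. H x * ?k k p x)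
        + integral {-1..1} (\<lambda>x. R x * T k x)) {-1..1}" by (simp only:)
    then show ?thesis by (rule integral_unique)
  qed
  have RT: "(LINT x:{-1..1}|lebesgue. R x * T k x) = integral {-1..1} (\<lambda>x. R x * T k x)" for k
    by (rule set_lebesgue_integral_eq_integral(2)[OF absolutely_integrable_continuous_real])
       (auto simp: T_def intro!: continuous_on_mult R continuous_on_trapezoid)
  show "(\<lambda>k. integral {-1..1} (\<lambda>x. - H x * frechet_derivative (T k) (at x) 1 + R x * T k x))
      \<longlonglongrightarrow> H q - H p + integral {p..q} R"
    unfolding split
  proof (intro tendsto_add tendsto_diff step_kernel_tendsto[OF H _ _ N(1)])
    have "(\<lambda>k. LINT x:{-1..1}|lebesgue. R x * T k x) \<longlonglongrightarrow> integral {p..q} R"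
      unfolding T_def
      by (rule trapezoid_test_tendsto[OF locally_integrable_continuous[OF R] _ _ _ N]) (use pq in auto)
    then show "(\<lambda>k. integral {-1..1} (\<lambda>x. R x * T k x)) \<longlonglongrightarrow> integral {p..q} R" by (simp add: RT)
  qed (use pq in auto)
  assume M: "\<And>x. x \<in> {-1..1} \<Longrightarrow> \<bar>H x\<bar> \<le> M" "\<And>x. x \<in> {-1..1} \<Longrightarrow> \<bar>R x\<bar> \<le> M"
  have M0: "M \<ge> 0" using M(1)[of 0] by simp
  have "\<bar>integral {-1..1} (\<lambda>x. H x * ?k k s x)\<bar> \<le> M" for s
    by (rule step_kernel_bound[OF H _ n0 _ M0]) (use M in auto)
  moreover have "\<bar>integral {-1..1} (\<lambda>x. R x * T k x)\<bar> \<le> 2 * M"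
  proof -
    have "norm (integral {-1..1} (\<lambda>x. R x * T k x)) \<le> integral {-1..1::real} (\<lambda>x. M)"
    proof (rule integral_norm_bound_integral)
      show "(\<lambda>x. R x * T k x) integrable_on {-1..1}"
        unfolding T_def by (intro integrable_continuous_interval continuous_on_mult R continuous_on_trapezoid)
      show "norm (R x * T k x) \<le> M" if "x \<in> {-1..1}" for x
      proof -
        have "\<bar>R x\<bar> * \<bar>T k x\<bar> \<le> M * 1"
          using M(2)[OF that] trapezoid_bounds[OF n0, of p q k x] pq M0 unfolding T_def
          by (intro mult_mono) auto
        then show ?thesis by (simp add: abs_mult)
      qed
    qed auto
    then show ?thesis by simp
  qed
  moreover have "\<bar>a - b + c\<bar> \<le> 4 * M" if "\<bar>a\<bar> \<le> M" "\<bar>b\<bar> \<le> M" "\<bar>c\<bar> \<le> 2 * M" for a b c :: real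
    using that by linarith
  ultimately show "\<bar>integral {-1..1} (\<lambda>x. - H x * frechet_derivative (T k) (at x) 1 + R x * T k x)\<bar> \<le> 4 * M"
    unfolding split by blast
qed

lemma continuous_on_time_slice:
  fixes G :: "real \<Rightarrow> real \<Rightarrow> real"
  assumes "continuous_on (T \<times> X) (\<lambda>(t, x). G t x)" "t \<in> T"
  shows "continuous_on X (G t)"
proof -
  have c: "continuous_on X (\<lambda>x. (t, x))" by (intro continuous_intros)
  have s: "(\<lambda>x. (t, x)) ` X \<subseteq> T \<times> X" using assms(2) by auto
  show ?thesis using continuous_on_compose2[OF assms(1) c s] by simp
qed

lemma continuous_on_section:
  fixes G :: "real \<Rightarrow> real \<Rightarrow> real"
  assumes "continuous_on (T \<times> X) (\<lambda>(t, x). G t x)" "x \<in> X"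
  shows "continuous_on T (\<lambda>t. G t x)"
proof -
  have c: "continuous_on T (\<lambda>t. (t, x))" by (intro continuous_intros)
  have s: "(\<lambda>t. (t, x)) ` T \<subseteq> T \<times> X" using assms(2) by auto
  show ?thesis using continuous_on_compose2[OF assms(1) c s] by simp
qed

lemma continuous_on_param_integral:
  fixes G :: "real \<Rightarrow> real \<Rightarrow> real"
  assumes "continuous_on (T \<times> {a..b}) (\<lambda>(t, x). G t x)"
  shows "continuous_on T (\<lambda>t. integral {a..b} (G t))"
  using integral_continuous_on_param[of T a b G] assms by simp

text \<open>
  Rescaling \<open>[-1,x]\<close> to the unit interval moves the dependence on \<open>x\<close>
  from the domain of integration into the integrand.
\<close>

lemma continuous_on_primitive:
  fixes R :: "real \<Rightarrow> real \<Rightarrow> real"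
  assumes R: "continuous_on (T \<times> {-1..1}) (\<lambda>(t, x). R t x)"
  shows "continuous_on (T \<times> {-1..1}) (\<lambda>(t, x). integral {-1..x} (R t))"
proof -
  have eq: "integral {-1..x} (R t) = (x + 1) * integral {0..1} (\<lambda>z. R t ((x + 1) * z + (-1)))"
    if "t \<in> T" "x \<in> {-1..1}" for t x
  proof (cases "x = -1")
    case False
    then have x: "x + 1 > 0" using that by auto
    have "continuous_on {-1..x} (R t)"
      using continuous_on_time_slice[OF R that(1)] by (rule continuous_on_subset) (use that in auto)
    then have "(R t has_integral integral {-1..x} (R t)) (cbox (-1) x)"
      using integrable_integral[OF integrable_continuous_interval] by simp
    from has_integral_affinity[OF this, of "x + 1" "-1"] x
    have "((\<lambda>z. R t ((x + 1) * z + (-1))) has_integral (1 / (x + 1)) * integral {-1..x} (R t))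
       ((\<lambda>z. (1 / (x + 1)) * z + - ((1 / (x + 1)) * (-1))) ` {-1..x})"
      by simp
    moreover have "(\<lambda>z. (1 / (x + 1)) * z + - ((1 / (x + 1)) * (-1))) ` {-1..x} = {0..1}"
      using x by (subst image_affinity_atLeastAtMost) (auto simp: field_simps)
    ultimately have "integral {0..1} (\<lambda>z. R t ((x + 1) * z + (-1))) = (1 / (x + 1)) * integral {-1..x} (R t)"
      by (simp add: integral_unique)
    with x show ?thesis by simp
  qed simp
  have "continuous_on (T \<times> {-1..1}) (\<lambda>p. (snd p + 1) * integral (cbox 0 1) (\<lambda>z. R (fst p) ((snd p + 1) * z + (-1))))"
  proof (intro continuous_intros integral_continuous_on_param)
    show "continuous_on ((T \<times> {-1..1}) \<times> cbox 0 1) (\<lambda>(p, z). R (fst p) ((snd p + 1) * z + (-1)))"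
    proof -
      have "continuous_on ((T \<times> {-1..1}) \<times> cbox 0 1)
         (\<lambda>q. (\<lambda>(t, x). R t x) (fst (fst q), (snd (fst q) + 1) * snd q + (-1)))"
      proof (rule continuous_on_compose2[OF R])
        show "continuous_on ((T \<times> {-1..1}) \<times> cbox 0 1)
            (\<lambda>q :: (real \<times> real) \<times> real. (fst (fst q), (snd (fst q) + 1) * snd q + (-1)))"
          by (intro continuous_intros)
        have "0 \<le> (x + 1) * z \<and> (x + 1) * z \<le> 2" if "-1 \<le> x" "x \<le> 1" "0 \<le> z" "z \<le> 1" for x z :: real
          using that mult_mono[of "x + 1" 2 z 1] by auto
        then show "(\<lambda>q :: (real \<times> real) \<times> real. (fst (fst q), (snd (fst q) + 1) * snd q + (-1))) ` ((T \<times> {-1..1}) \<times> cbox 0 1) \<subseteq> T \<times> {-1..1}"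
          by force
      qed
      then show ?thesis by (simp add: case_prod_unfold)
    qed
  qed
  then show ?thesis
    by (rule continuous_on_eq) (auto simp: eq)
qed


lemma bounded_on_slab:
  fixes G :: "real \<Rightarrow> real \<Rightarrow> real"
  assumes "continuous_on ({t1..t2} \<times> {-1..1}) (\<lambda>(t, x). G t x)"
  shows "\<exists>M. \<forall>s\<in>{t1..t2}. \<forall>x\<in>{-1..1}. \<bar>G s x\<bar> \<le> M"
proof -
  have "compact ({t1..t2} \<times> {-1..1::real})" by (intro compact_Times compact_Icc)
  then have "bounded ((\<lambda>(t, x). G t x) ` ({t1..t2} \<times> {-1..1}))"
    by (intro compact_imp_bounded compact_continuous_image assms)
  then show ?thesis unfolding bounded_iff by fastforce
qed

text \<open>
  The weak formulation with smoothed indicators gives the balance of mass on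
  \<open>[p,q]\<close> inside the interval; both sides are continuous up to the end points, and
  the flux \<open>H\<close> vanishes at \<open>-1\<close>. Since the integrand in time is
  continuous, the balance can be differentiated.
\<close>

lemma integrated_equation:
  fixes V H R :: "real \<Rightarrow> real \<Rightarrow> real"
  assumes V: "continuous_on ({0<..} \<times> {-1..1}) (\<lambda>(t, x). V t x)"
    and H: "continuous_on ({0<..} \<times> {-1..1}) (\<lambda>(t, x). H t x)"
    and R: "continuous_on ({0<..} \<times> {-1..1}) (\<lambda>(t, x). R t x)"
    and H0: "\<And>t. t > 0 \<Longrightarrow> H t (-1) = 0"
    and weak: "\<And>b t1 t2. test_function dom_I b \<Longrightarrow> 0 < t1 \<Longrightarrow> t1 < t2 \<Longrightarrow>
      integral {-1..1} (\<lambda>x. V t2 x * b x) - integral {-1..1} (\<lambda>x. V t1 x * b x) =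
      integral {t1..t2} (\<lambda>s. integral {-1..1} (\<lambda>x. - H s x * frechet_derivative b (at x) 1 + R s x * b x))"
    and t: "t > 0" and x: "x \<in> {-1..1}"
  shows "((\<lambda>t. integral {-1..x} (V t)) has_real_derivative H t x + integral {-1..x} (R t)) (at t)"
proof -
  define K where "K t x = integral {-1..x} (V t)" for t x
  define L where "L t x = H t x + integral {-1..x} (R t)" for t x
  have cK: "continuous_on ({0<..} \<times> {-1..1}) (\<lambda>(t, x). K t x)"
    unfolding K_def by (rule continuous_on_primitive[OF V])
  have cL: "continuous_on ({0<..} \<times> {-1..1}) (\<lambda>(t, x). L t x)"
    using continuous_on_add[OF H continuous_on_primitive[OF R]] by (simp add: L_def case_prod_unfold)
  have sl: "continuous_on {-1..1} (V t)" "continuous_on {-1..1} (H t)" "continuous_on {-1..1} (R t)" if "t > 0" for t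
    using continuous_on_time_slice[OF V] continuous_on_time_slice[OF H] continuous_on_time_slice[OF R] that by auto
  have inc: "K t2 q - K t2 p - (K t1 q - K t1 p) = integral {t1..t2} (\<lambda>s. L s q - L s p)"
    if pq: "-1 < p" "p < q" "q < 1" and t: "0 < t1" "t1 < t2" for p q t1 t2
  proof -
    obtain N where N: "N > 0" "\<And>k. q + 1 / real (k + N) \<le> (q + 1) / 2"
      using trapezoid_scale_exists[of q "(q + 1) / 2"] pq by auto
    define T where "T k = trapezoid (real (k + N)) p q" for k
    have test: "test_function dom_I (T k)" for k
      unfolding T_def using N(1) N(2)[of k] pq by (intro test_function_trapezoid) auto
    define A where "A k s = integral {-1..1} (\<lambda>x. - H s x * frechet_derivative (T k) (at x) 1 + R s x * T k x)" for k s
    have comb: "integral {-1..q} f - integral {-1..p} f = integral {p..q} f" if "continuous_on {-1..1} f" for f :: "real \<Rightarrow> real"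
      using Henstock_Kurzweil_Integration.integral_combine[of "-1" p q f] pq
        integrable_continuous_interval[OF continuous_on_subset[OF that, of "{-1..q}"]] by auto
    have VL: "(\<lambda>k. integral {-1..1} (\<lambda>x. V t x * T k x)) \<longlonglongrightarrow> K t q - K t p" if "t > 0" for t
    proof -
      have "(LINT x:{-1..1}|lebesgue. V t x * T k x) = integral {-1..1} (\<lambda>x. V t x * T k x)" for k
        by (rule set_lebesgue_integral_eq_integral(2)[OF absolutely_integrable_continuous_real])
           (auto simp: T_def intro!: continuous_on_mult sl that continuous_on_trapezoid)
      moreover have "(\<lambda>k. LINT x:{-1..1}|lebesgue. V t x * T k x) \<longlonglongrightarrow> integral {p..q} (V t)"
        unfolding T_def
        by (rule trapezoid_test_tendsto[OF locally_integrable_continuous[OF sl(1)[OF that]] _ _ _ N]) (use pq in auto)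
      ultimately show ?thesis using comb[OF sl(1)[OF that]] by (simp add: K_def)
    qed
    have AL: "(\<lambda>k. A k s) \<longlonglongrightarrow> L s q - L s p" if "s > 0" for s
      using trapezoid_flux(1)[OF sl(2)[OF that] sl(3)[OF that] pq N] comb[OF sl(3)[OF that]]
      unfolding A_def T_def L_def by (simp add: algebra_simps)
    have sub: "{t1..t2} \<times> {-1..1} \<subseteq> {0<..} \<times> {-1..1::real}" using t by auto
    obtain M where M: "\<And>s x. s \<in> {t1..t2} \<Longrightarrow> x \<in> {-1..1} \<Longrightarrow> \<bar>H s x\<bar> \<le> M \<and> \<bar>R s x\<bar> \<le> M"
    proof -
      obtain M1 M2 where "\<And>s x. s \<in> {t1..t2} \<Longrightarrow> x \<in> {-1..1} \<Longrightarrow> \<bar>H s x\<bar> \<le> M1"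
        "\<And>s x. s \<in> {t1..t2} \<Longrightarrow> x \<in> {-1..1} \<Longrightarrow> \<bar>R s x\<bar> \<le> M2"
        using bounded_on_slab[OF continuous_on_subset[OF H sub]] bounded_on_slab[OF continuous_on_subset[OF R sub]] by metis
      then show thesis by (intro that[of "max M1 M2"]) (meson max.coboundedI1 max.coboundedI2)
    qed
    have cA: "continuous_on {t1..t2} (A k)" for k
      unfolding A_def
    proof (rule continuous_on_param_integral)
      have cT: "continuous_on UNIV (T k)" "continuous_on UNIV (\<lambda>x. frechet_derivative (T k) (at x) 1)"
        by (rule test_function_real[OF test[of k]], assumption)+
      have 1: "continuous_on ({t1..t2} \<times> {-1..1}) (\<lambda>p. f (snd p))" if "continuous_on UNIV f" for f :: "real \<Rightarrow> real"
        by (rule continuous_on_compose2[OF that]) (auto intro: continuous_intros)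
      show "continuous_on ({t1..t2} \<times> {-1..1})
          (\<lambda>(s, x). - H s x * frechet_derivative (T k) (at x) 1 + R s x * T k x)"
        using continuous_on_add[OF continuous_on_mult[OF continuous_on_minus[OF continuous_on_subset[OF H sub]] 1[OF cT(2)]]
            continuous_on_mult[OF continuous_on_subset[OF R sub] 1[OF cT(1)]]]
        by (simp add: case_prod_unfold)
    qed
    have "(\<lambda>k. integral {t1..t2} (A k)) \<longlonglongrightarrow> integral {t1..t2} (\<lambda>s. L s q - L s p)"
    proof (rule dominated_convergence(2)[where h = "\<lambda>s. 4 * M"])
      show "A k integrable_on {t1..t2}" for k by (rule integrable_continuous_interval[OF cA])
      show "norm (A k s) \<le> 4 * M" if "s \<in> {t1..t2}" for k s
      proof -
        have "s > 0" using that t by auto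
        show ?thesis unfolding A_def T_def real_norm_def
          by (rule trapezoid_flux(2)[OF sl(2)[OF \<open>s > 0\<close>] sl(3)[OF \<open>s > 0\<close>] pq N]) (use M[OF that] in auto)
      qed
      show "(\<lambda>k. A k s) \<longlonglongrightarrow> L s q - L s p" if "s \<in> {t1..t2}" for s using that t by (intro AL) auto
    qed auto
    moreover have "integral {t1..t2} (A k) = integral {-1..1} (\<lambda>x. V t2 x * T k x) - integral {-1..1} (\<lambda>x. V t1 x * T k x)" for k
      using weak[OF test t] by (simp add: A_def[abs_def])
    ultimately have lim: "(\<lambda>k. integral {-1..1} (\<lambda>x. V t2 x * T k x) - integral {-1..1} (\<lambda>x. V t1 x * T k x))
        \<longlonglongrightarrow> integral {t1..t2} (\<lambda>s. L s q - L s p)" by (simp only:)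
    have "(\<lambda>k. integral {-1..1} (\<lambda>x. V t2 x * T k x) - integral {-1..1} (\<lambda>x. V t1 x * T k x))
        \<longlonglongrightarrow> (K t2 q - K t2 p) - (K t1 q - K t1 p)"
      using t by (intro tendsto_diff VL) auto
    from LIMSEQ_unique[OF this lim] show ?thesis .
  qed
  have full: "K t2 x - K t1 x = integral {t1..t2} (\<lambda>s. L s x)" if t: "0 < t1" "t1 < t2" for t1 t2
  proof -
    have Li: "(\<lambda>s. L s x) integrable_on {t1..t2}" if "x \<in> {-1..1}" for x
      by (intro integrable_continuous_interval continuous_on_subset[OF continuous_on_section[OF cL that]]) (use t in auto)
    \<comment> \<open>The defect of the integrated equation; it has equal values at interior points and vanishes at \<open>-1\<close>.\<close>
    define D where "D x = K t2 x - K t1 x - integral {t1..t2} (\<lambda>s. L s x)" for x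
    have Dc: "continuous_on {-1..1} D"
      unfolding D_def
    proof (intro continuous_on_diff continuous_on_time_slice[OF cK] continuous_on_param_integral)
      have "continuous_on ({-1..1} \<times> {t1..t2}) (\<lambda>p. (\<lambda>(t, x). L t x) (snd p, fst p))"
        by (rule continuous_on_compose2[OF cL]) (use t in \<open>auto intro!: continuous_intros\<close>)
      then show "continuous_on ({-1..1} \<times> {t1..t2}) (\<lambda>(x, s). L s x)" by (simp add: case_prod_unfold)
    qed (use t in auto)
    have Dd: "D x = D 0" if "x \<in> dom_I" for x
    proof -
      have *: "D q = D p" if "-1 < p" "p < q" "q < 1" for p q
      proof -
        have "integral {t1..t2} (\<lambda>s. L s q - L s p) = integral {t1..t2} (\<lambda>s. L s q) - integral {t1..t2} (\<lambda>s. L s p)"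
          using that by (intro Henstock_Kurzweil_Integration.integral_diff Li) auto
        with inc[OF that t] show ?thesis by (simp add: D_def)
      qed
      show ?thesis using *[of x 0] *[of 0 x] that by (cases "x = 0") (auto simp: neq_iff)
    qed
    have const: "D x = D 0" if "x \<in> {-1..1}" for x
    proof (rule continuous_constant_on_closure[of dom_I D "D 0" x, OF _ Dd])
      show "continuous_on (closure dom_I) D" "x \<in> closure dom_I" using Dc that by simp_all
    qed
    have "integral {t1..t2} (\<lambda>s. L s (-1)) = integral {t1..t2} (\<lambda>s. 0)"
      by (intro Henstock_Kurzweil_Integration.integral_cong) (use t H0 in \<open>auto simp: L_def\<close>)
    then have "D (-1) = 0" by (simp add: D_def K_def)
    with const[of "-1"] const[OF x] have "D x = 0" by simp
    then show ?thesis by (simp add: D_def)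
  qed
  have "((\<lambda>s. integral {t / 2..s} (\<lambda>s. L s x)) has_real_derivative L t x) (at t within {t / 2..t + 1})"
    by (rule integral_has_real_derivative[OF continuous_on_subset[OF continuous_on_section[OF cL x]]]) (use t in auto)
  then have "((\<lambda>s. integral {t / 2..s} (\<lambda>s. L s x)) has_real_derivative L t x) (at t)"
    using t by (simp add: at_within_Icc_at)
  then have "((\<lambda>s. K (t / 2) x + integral {t / 2..s} (\<lambda>s. L s x)) has_real_derivative 0 + L t x) (at t)"
    by (intro DERIV_add DERIV_const)
  then have "((\<lambda>s. K s x) has_real_derivative 0 + L t x) (at t)"
  proof (rule has_field_derivative_transform_within_open[of _ _ _ "{t / 2<..}"])
    fix s assume "s \<in> {t / 2<..}"
    then show "K (t / 2) x + integral {t / 2..s} (\<lambda>s. L s x) = K s x" using full[of "t / 2" s] t by simp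
  qed (use t in auto)
  then show ?thesis by (simp add: K_def L_def)
qed


text \<open>
  Here all assumptions on a strong solution are converted into statements on continuous
  functions. The Neumann condition holds for almost every time by assumption and for every time
  by continuity.
\<close>

lemma strong_solution_classical:
  assumes eps: "\<epsilon> > 0" and sol: "strong_solution \<delta> r \<epsilon> \<infinity> u0 v"
    and nonneg: "\<And>t. t \<ge> 0 \<Longrightarrow> AE x in lebesgue_on dom_I. v t x \<ge> 0"
  obtains V VX P W where
    "continuous_on ({0<..} \<times> {-1..1}) (\<lambda>(t, x). V t x)"
    "continuous_on ({0<..} \<times> {-1..1}) (\<lambda>(t, x). VX t x)"
    "continuous_on ({0<..} \<times> {-1..1}) (\<lambda>(t, x). P t x)"
    "\<And>t. t > 0 \<Longrightarrow> AE x in lebesgue_on dom_I. v t x = V t x"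
    "\<And>t x. t > 0 \<Longrightarrow> x \<in> {-1..1} \<Longrightarrow> (V t has_real_derivative VX t x) (at x within {-1..1})"
    "\<And>t x. t > 0 \<Longrightarrow> x \<in> {-1..1} \<Longrightarrow> (P t has_real_derivative (V t x - W t x) / \<epsilon>) (at x within {-1..1})"
    "\<And>t x. t > 0 \<Longrightarrow> x \<in> {-1..1} \<Longrightarrow> (W t has_real_derivative - P t x) (at x within {-1..1})"
    "\<And>t. t > 0 \<Longrightarrow> P t (-1) = 0" "\<And>t. t > 0 \<Longrightarrow> P t 1 = 0"
    "\<And>t. t > 0 \<Longrightarrow> VX t (-1) = 0" "\<And>t. t > 0 \<Longrightarrow> VX t 1 = 0"
    "\<And>t x. t > 0 \<Longrightarrow> x \<in> {-1..1} \<Longrightarrow> W t x \<ge> 0"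
    "\<And>t. t \<ge> 0 \<Longrightarrow> L2 (v t)"
    "AE x in lebesgue_on dom_I. v 0 x = u0 x"
    "((\<lambda>t. L2_norm (\<lambda>x. v t x - v 0 x)) \<longlongrightarrow> 0) (at_right 0)"
    "\<And>t x. t > 0 \<Longrightarrow> x \<in> {-1..1} \<Longrightarrow> ((\<lambda>t. integral {-1..x} (V t)) has_real_derivative
        (\<delta> * VX t x - V t x * P t x) + integral {-1..x} (\<lambda>y. r * V t y * (1 - V t y))) (at t)"
proof -
  have J: "{t. 0 \<le> t \<and> ereal t < \<infinity>} = {0..}" "{t. 0 < t \<and> ereal t < \<infinity>} = {0<..}" by auto
  from sol[unfolded strong_solution_def Let_def J] obtain ut ux uxx \<phi> Fx where
    c1: "continuous_sobolev 1 {0..} v" and c2: "continuous_sobolev 2 {0<..} v"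
    and ini: "AE x in lebesgue_on dom_I. v 0 x = u0 x"
    and wt: "has_weak_deriv ({0<..} \<times> dom_I) (1, 0) (\<lambda>(t, x). v t x) (\<lambda>(t, x). ut t x)"
    and derivs: "\<forall>t\<in>{0..}. has_weak_deriv dom_I 1 (v t) (ux t)"
      "\<forall>t\<in>{0..}. elliptic_solution \<epsilon> (\<lambda>x. - ux t x) (\<phi> t)"
      "\<forall>t\<in>{0<..}. has_weak_deriv dom_I 1 (ux t) (uxx t)"
      "\<forall>t\<in>{0<..}. has_weak_deriv dom_I 1 (\<lambda>x. v t x * \<phi> t x) (Fx t)"
    and bd: "AE t in lebesgue_on {0..}. has_boundary_value (ux t) (-1) 0 \<and> has_boundary_value (ux t) 1 0"
    and eq: "AE (t, x) in lebesgue_on ({0..} \<times> dom_I). ut t x = \<delta> * uxx t x - Fx t x + r * v t x * (1 - v t x)"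
    by (elim conjE exE) blast
  have w1: "\<And>t. t \<ge> 0 \<Longrightarrow> has_weak_deriv dom_I 1 (v t) (ux t)"
    and el: "\<And>t. t \<ge> 0 \<Longrightarrow> elliptic_solution \<epsilon> (\<lambda>x. - ux t x) (\<phi> t)"
    and w2: "\<And>t. t > 0 \<Longrightarrow> has_weak_deriv dom_I 1 (ux t) (uxx t)"
    and wF: "\<And>t. t > 0 \<Longrightarrow> has_weak_deriv dom_I 1 (\<lambda>x. v t x * \<phi> t x) (Fx t)"
    using derivs by auto
  have s2: "sobolev 2 (v t)" if "t > 0" for t using c2 that by (auto simp: continuous_sobolev_def)
  have "\<forall>t. \<exists>F FX P W. t > 0 \<longrightarrow> regular_slice \<epsilon> (v t) (ux t) (\<phi> t) F FX P W"
    using regular_slice_exists[OF eps s2 w1 w2 el] by (meson less_imp_le)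
  then obtain V VX P W where slice: "\<And>t. t > 0 \<Longrightarrow> regular_slice \<epsilon> (v t) (ux t) (\<phi> t) (V t) (VX t) (P t) (W t)"
    by metis
  note sl = slice[unfolded regular_slice_def]
  have ae: "AE x in lebesgue_on dom_I. v t x = V t x" if "t > 0" for t using sl[OF that] by auto
  have dV: "(V t has_real_derivative VX t x) (at x within {-1..1})"
    and dP: "(P t has_real_derivative (V t x - W t x) / \<epsilon>) (at x within {-1..1})"
    and dW: "(W t has_real_derivative - P t x) (at x within {-1..1})" if "t > 0" "x \<in> {-1..1}" for t x
    using sl[OF that(1)] that(2) by auto
  have Pb: "P t (-1) = 0" "P t 1 = 0" if "t > 0" for t using sl[OF that] by auto
  have cs: "continuous_on {-1..1} (V t)" "continuous_on {-1..1} (VX t)" "continuous_on {-1..1} (P t)" if "t > 0" for t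
  proof -
    show "continuous_on {-1..1} (V t)" "continuous_on {-1..1} (P t)"
      using dV[OF that] dP[OF that] by (meson DERIV_continuous continuous_on_eq_continuous_within)+
    show "continuous_on {-1..1} (VX t)" using sl[OF that] by auto
  qed
  \<comment> \<open>A modulus of continuity in time for \<open>V\<close>, \<open>VX\<close> and \<open>P\<close> simultaneously.\<close>
  define \<omega> where "\<omega> s t = 3 * sobolev_norm 2 (\<lambda>x. v t x - v s x)" for s t
  have om: "(\<omega> s \<longlongrightarrow> 0) (at s within {0<..})" if "s > 0" for s
    using c2 that tendsto_mult_right_zero[of "\<lambda>t. sobolev_norm 2 (\<lambda>x. v t x - v s x)" "at s within {0<..}" 3]
    by (simp add: continuous_sobolev_def \<omega>_def[abs_def])
  have diff: "\<bar>V t x - V s x\<bar> \<le> \<omega> s t" "\<bar>VX t x - VX s x\<bar> \<le> \<omega> s t" "\<bar>P t x - P s x\<bar> \<le> \<omega> s t"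
    if "s > 0" "t > 0" "x \<in> {-1..1}" for s t x
    unfolding \<omega>_def
    by (rule regular_slice_diff_bounds[OF eps s2 w1 w2 slice s2 w1 w2 slice]; use that in simp)+
  have cV: "continuous_on ({0<..} \<times> {-1..1}) (\<lambda>(t, x). V t x)"
    by (rule jointly_continuous[OF cs(1) om diff(1)])
  have cVX: "continuous_on ({0<..} \<times> {-1..1}) (\<lambda>(t, x). VX t x)"
    by (rule jointly_continuous[OF cs(2) om diff(2)])
  have cP: "continuous_on ({0<..} \<times> {-1..1}) (\<lambda>(t, x). P t x)"
    by (rule jointly_continuous[OF cs(3) om diff(3)])
  have VXb: "VX t a = 0" if t: "t > 0" and a: "a = -1 \<or> a = 1" for t a
  proof -
    \<comment> \<open>Restricting to \<open>s \<ge> t/2\<close> keeps the set closed, as \<open>VX\<close> is only continuous at positive times.\<close>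
    define C where "C = {s \<in> {t / 2..}. VX s a = 0}"
    have "continuous_on {t / 2..} (\<lambda>s. VX s a)"
      by (rule continuous_on_subset[OF continuous_on_section[OF cVX]]) (use t a in auto)
    then have "closed C" unfolding C_def by (intro continuous_closed_preimage_constant) auto
    have "AE s in lebesgue. s \<in> {0..} \<longrightarrow> has_boundary_value (ux s) (-1) 0 \<and> has_boundary_value (ux s) 1 0"
      using bd by (subst (asm) AE_restrict_space_iff) auto
    then have "AE s \<in> {t / 2<..} in lebesgue. s \<in> C"
    proof eventually_elim
      case (elim s)
      show ?case
      proof
        assume s: "s \<in> {t / 2<..}"
        then have s0: "s > 0" using t by auto
        have "has_boundary_value (ux s) a 0" using elim s0 a by auto
        moreover have "AE x in lebesgue_on dom_I. ux s x = VX s x" using sl[OF s0] by auto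
        ultimately have "VX s a = 0"
          by (rule boundary_value_unique[OF _ cs(2)[OF s0]]) (use a in auto)
        with s show "s \<in> C" by (auto simp: C_def)
      qed
    qed
    from mem_closed_if_AE_lebesgue_open[OF open_greaterThan \<open>closed C\<close> this, of t] t
    show ?thesis by (auto simp: C_def)
  qed
  have V0: "V t x \<ge> 0" if t: "t > 0" and x: "x \<in> {-1..1}" for t x
  proof -
    have "AE x in lebesgue_on dom_I. v t x \<ge> 0" by (rule nonneg) (use t in simp)
    then have "AE x in lebesgue_on dom_I. V t x = \<bar>V t x\<bar>"
      using ae[OF t] by eventually_elim simp
    from continuous_AE_eq[OF cs(1)[OF t] continuous_on_rabs[OF cs(1)[OF t]] this x] show ?thesis by simp
  qed
  have W0: "W t x \<ge> 0" if "t > 0" "x \<in> {-1..1}" for t x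
    by (rule neumann_resolvent_nonneg[OF eps dW[OF that(1)] dP[OF that(1)] Pb[OF that(1)] V0[OF that(1)] that(2)])
  have L2v: "L2 (v t)" if "t \<ge> 0" for t
    using c1 that by (auto simp: continuous_sobolev_def One_nat_def)
  have lim0: "((\<lambda>t. L2_norm (\<lambda>x. v t x - v 0 x)) \<longlongrightarrow> 0) (at_right 0)"
  proof (rule tendsto_sandwich[OF _ _ tendsto_const])
    have "((\<lambda>t. sobolev_norm 1 (\<lambda>x. v t x - v 0 x)) \<longlongrightarrow> 0) (at 0 within {0..})"
      using c1 by (auto simp: continuous_sobolev_def)
    then show "((\<lambda>t. sobolev_norm 1 (\<lambda>x. v t x - v 0 x)) \<longlongrightarrow> 0) (at_right 0)"
      by (rule tendsto_within_subset) auto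
    show "eventually (\<lambda>t. L2_norm (\<lambda>x. v t x - v 0 x) \<le> sobolev_norm 1 (\<lambda>x. v t x - v 0 x)) (at_right 0)"
      unfolding eventually_at_filter
    proof (intro always_eventually allI impI)
      fix t :: real assume "t \<noteq> 0" "t \<in> {0<..}"
      then have t: "t \<ge> 0" by simp
      have "sobolev 1 (v t)" "sobolev 1 (v 0)" using c1 t by (auto simp: continuous_sobolev_def)
      from sobolev_1_deriv(3)[OF sobolev_diff[OF this] has_weak_deriv_diff[OF w1[OF t] w1[OF order_refl]]]
      show "L2_norm (\<lambda>x. v t x - v 0 x) \<le> sobolev_norm 1 (\<lambda>x. v t x - v 0 x)" .
    qed
  qed simp
  let ?H = "\<lambda>t x. \<delta> * VX t x - V t x * P t x" and ?R = "\<lambda>t x. r * V t x * (1 - V t x)"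
  have cH: "continuous_on ({0<..} \<times> {-1..1}) (\<lambda>(t, x). ?H t x)"
    using cV cVX cP unfolding case_prod_unfold by (intro continuous_intros)
  have cR: "continuous_on ({0<..} \<times> {-1..1}) (\<lambda>(t, x). ?R t x)"
    using cV unfolding case_prod_unfold by (intro continuous_intros)
  have eq': "AE t in lebesgue. t > 0 \<longrightarrow>
      (AE x in lebesgue_on dom_I. ut t x = \<delta> * uxx t x - Fx t x + r * v t x * (1 - v t x))"
  proof -
    have "{0..} \<times> dom_I \<in> sets (borel :: (real \<times> real) measure)" by (intro borel_Times) auto
    then have m: "{0..} \<times> dom_I \<in> sets (lebesgue :: (real \<times> real) measure)" by simp
    have "AE p in lebesgue. p \<in> {0..} \<times> dom_I \<longrightarrow>
        (case p of (t, x) \<Rightarrow> ut t x = \<delta> * uxx t x - Fx t x + r * v t x * (1 - v t x))"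
      using eq m by (subst (asm) AE_restrict_space_iff) auto
    then have "AE p in lborel \<Otimes>\<^sub>M lborel. p \<in> {0..} \<times> dom_I \<longrightarrow>
        (case p of (t, x) \<Rightarrow> ut t x = \<delta> * uxx t x - Fx t x + r * v t x * (1 - v t x))"
      by (subst lborel_prod) (simp only: AE_completion_iff)
    from AE_completion[OF lborel_pair.AE_pair[OF this]] show ?thesis
    proof eventually_elim
      case (elim t)
      show ?case
      proof
        assume "t > 0"
        show "AE x in lebesgue_on dom_I. ut t x = \<delta> * uxx t x - Fx t x + r * v t x * (1 - v t x)"
          unfolding AE_lebesgue_on_dom_I_iff using AE_completion[OF elim] \<open>t > 0\<close> by (auto elim: eventually_mono)
      qed
    qed
  qed
  have weak: "integral {-1..1} (\<lambda>x. V t2 x * b x) - integral {-1..1} (\<lambda>x. V t1 x * b x) =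
      integral {t1..t2} (\<lambda>s. integral {-1..1} (\<lambda>x. - ?H s x * frechet_derivative b (at x) 1 + ?R s x * b x))"
    if b: "test_function dom_I b" and t: "0 < t1" "t1 < t2" for b t1 t2
  proof -
    define g where "g t = integral {-1..1} (\<lambda>x. V t x * b x)" for t
    define A where "A t = integral {-1..1} (\<lambda>x. - ?H t x * frechet_derivative b (at x) 1 + ?R t x * b x)" for t
    have cb: "continuous_on UNIV b" "continuous_on UNIV (\<lambda>x. frechet_derivative b (at x) 1)"
      by (rule test_function_real[OF b], assumption)+
    have 1: "continuous_on ({0<..} \<times> {-1..1}) (\<lambda>p. f (snd p))" if "continuous_on UNIV f" for f :: "real \<Rightarrow> real"
      by (rule continuous_on_compose2[OF that]) (auto intro: continuous_intros)
    have cg: "continuous_on {0<..} g" unfolding g_def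
      by (rule continuous_on_param_integral)
         (use continuous_on_mult[OF cV 1[OF cb(1)]] in \<open>simp add: case_prod_unfold\<close>)
    have cA: "continuous_on {0<..} A" unfolding A_def
      by (rule continuous_on_param_integral)
         (use continuous_on_add[OF continuous_on_mult[OF continuous_on_minus[OF cH] 1[OF cb(2)]]
            continuous_on_mult[OF cR 1[OF cb(1)]]] in \<open>simp add: case_prod_unfold\<close>)
    have "g t2 - g t1 = integral {t1..t2} A"
    proof (rule weak_time_increment[OF cg cA _ t])
      fix a assume a: "test_function {0<..} (a :: real \<Rightarrow> real)"
      show "(LINT t:{0<..}|lebesgue. g t * frechet_derivative a (at t) 1) = - (LINT t:{0<..}|lebesgue. A t * a t)"
      proof (rule time_weak_identity[OF wt _ _ _ b a])
        show "(LINT x:dom_I|lebesgue. v t x * b x) = g t" if "t > 0" for t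
        proof -
          have "(LINT x:dom_I|lebesgue. v t x * b x) = (LINT x:dom_I|lebesgue. V t x * b x)"
            by (rule set_integral_cong_dom_I) (use ae[OF that] in \<open>eventually_elim, simp\<close>)
          also have "\<dots> = g t" unfolding g_def set_lebesgue_dom_I
            by (rule continuous_integral_dom_I(2))
               (intro continuous_on_mult cs(1)[OF that] continuous_on_subset[OF cb(1) subset_UNIV])
          finally show ?thesis .
        qed
        show "AE t in lebesgue. t > 0 \<longrightarrow> (LINT x:dom_I|lebesgue. ut t x * b x) = A t"
          using eq'
        proof eventually_elim
          case (elim t)
          then show ?case unfolding A_def using slice_weak_form[OF slice w2 wF _ b] by blast
        qed
        show "(\<lambda>t. indicator {0<..} t * A t) \<in> borel_measurable lebesgue"
          using borel_measurable_continuous_on_indicator[OF _ cA] by (intro borel_measurable_lebesgueI) simp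
      qed
    qed
    then show ?thesis unfolding g_def A_def[abs_def] .
  qed
  show thesis
  proof (rule that[OF cV cVX cP ae dV dP dW Pb VXb VXb W0 L2v ini lim0])
    show "((\<lambda>t. integral {-1..x} (V t)) has_real_derivative
        (\<delta> * VX t x - V t x * P t x) + integral {-1..x} (\<lambda>y. r * V t y * (1 - V t y))) (at t)"
      if "t > 0" "x \<in> {-1..1}" for t x
      by (rule integrated_equation[OF cV cH cR _ weak that]) (use Pb VXb in auto)
  qed auto
qed

section \<open>Dissipation of the dual distance\<close>

lemma FTC_reference_interval:
  fixes B b :: "real \<Rightarrow> real"
  assumes "\<And>x. x \<in> {-1..1} \<Longrightarrow> (B has_real_derivative b x) (at x within {-1..1})"
  shows "(b has_integral B 1 - B (-1)) {-1..1}"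
  by (rule fundamental_theorem_of_calculus)
     (use assms in \<open>auto simp: has_real_derivative_iff_has_vector_derivative\<close>)

lemma young_inequality: "\<eta> > 0 \<Longrightarrow> a * b \<le> \<eta> * a\<^sup>2 + b\<^sup>2 / (4 * \<eta>)" for a b \<eta> :: real
proof -
  assume "\<eta> > 0"
  have "0 \<le> (2 * \<eta> * a - b)\<^sup>2 / (4 * \<eta>)" using \<open>\<eta> > 0\<close> by simp
  also have "\<dots> = \<eta> * a\<^sup>2 + b\<^sup>2 / (4 * \<eta>) - a * b"
    using \<open>\<eta> > 0\<close> by (simp add: power2_eq_square field_simps)
  finally show ?thesis by simp
qed

text \<open>
  A fixed time, with \<open>V\<close> the solution of the \<open>\<epsilon>\<close>-problem,
  \<open>U\<close> the solution of the limit problem, \<open>P\<close> the potential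
  \<open>\<phi>\<close> and \<open>W\<close> the Neumann resolvent of \<open>V\<close>.
\<close>

locale energy_slice =
  fixes \<epsilon> M :: real and V VX U UX P W :: "real \<Rightarrow> real"
  assumes eps: "\<epsilon> > 0"
    and V: "\<And>x. x \<in> {-1..1} \<Longrightarrow> (V has_real_derivative VX x) (at x within {-1..1})"
    and U: "\<And>x. x \<in> {-1..1} \<Longrightarrow> (U has_real_derivative UX x) (at x within {-1..1})"
    and P: "\<And>x. x \<in> {-1..1} \<Longrightarrow> (P has_real_derivative (V x - W x) / \<epsilon>) (at x within {-1..1})"
    and W: "\<And>x. x \<in> {-1..1} \<Longrightarrow> (W has_real_derivative - P x) (at x within {-1..1})"
    and P_bd: "P (-1) = 0" "P 1 = 0"
    and VX: "continuous_on {-1..1} VX" and UX: "continuous_on {-1..1} UX"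
    and VX_bd: "VX 1 = 0" and UX_bd: "UX 1 = 0"
    and U_bd: "\<And>x. x \<in> {-1..1} \<Longrightarrow> 0 \<le> U x" "\<And>x. x \<in> {-1..1} \<Longrightarrow> U x \<le> M"
    and W_nonneg: "\<And>x. x \<in> {-1..1} \<Longrightarrow> 0 \<le> W x"
begin

definition "z x = V x - U x"
text \<open>
  The derivative of \<open>G\<close> is \<open>- V P - U U'\<close>, the difference of the two
  drift terms.
\<close>

definition "G x = ((W x)\<^sup>2 - \<epsilon> * (P x)\<^sup>2 - (U x)\<^sup>2) / 2"
abbreviation "I f \<equiv> integral {-1..1::real} f"

lemma cont: "continuous_on {-1..1} V" "continuous_on {-1..1} U" "continuous_on {-1..1} P" "continuous_on {-1..1} W"
  using V U P W by (meson DERIV_continuous continuous_on_eq_continuous_within)+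

lemma cont_z: "continuous_on {-1..1} z" and cont_G: "continuous_on {-1..1} G"
  unfolding z_def G_def by (intro continuous_intros cont; simp)+

lemmas int = integrable_continuous_interval

lemma M_nonneg: "M \<ge> 0" using U_bd[of 0] by simp

text \<open>
  Test \<open>- \<epsilon> W'' + W = V\<close> with \<open>W - U\<close>: the boundary terms
  vanish as \<open>W' = - P\<close> is zero at the end points.
\<close>

lemma resolvent_estimate:
  "I (\<lambda>x. (W x - U x)\<^sup>2) + \<epsilon> * I (\<lambda>x. (P x)\<^sup>2) \<le> I (\<lambda>x. (z x)\<^sup>2) + \<epsilon> * I (\<lambda>x. (UX x)\<^sup>2)"
proof -
  have "((\<lambda>x. P x * (W x - U x)) has_real_derivative
      ((V x - W x) / \<epsilon> * (W x - U x) + (- P x - UX x) * P x)) (at x within {-1..1})" if "x \<in> {-1..1}" for x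
    by (intro DERIV_mult DERIV_diff P W U that)
  from FTC_reference_interval[OF this] P_bd
  have "((\<lambda>x. (V x - W x) / \<epsilon> * (W x - U x) + (- P x - UX x) * P x) has_integral 0) {-1..1}" by simp
  from has_integral_mult_right[OF this, of "2 * \<epsilon>"]
  have 1: "((\<lambda>x. 2 * \<epsilon> * ((V x - W x) / \<epsilon> * (W x - U x) + (- P x - UX x) * P x)) has_integral 0) {-1..1}" by simp
  have 2: "((\<lambda>x. (z x)\<^sup>2 + \<epsilon> * (UX x)\<^sup>2 - ((W x - U x)\<^sup>2 + \<epsilon> * (P x)\<^sup>2)) has_integral
      (I (\<lambda>x. (z x)\<^sup>2) + \<epsilon> * I (\<lambda>x. (UX x)\<^sup>2) - (I (\<lambda>x. (W x - U x)\<^sup>2) + \<epsilon> * I (\<lambda>x. (P x)\<^sup>2)))) {-1..1}"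
    by (intro has_integral_diff has_integral_add has_integral_mult_right integrable_integral int
        continuous_intros cont cont_z UX)
  have "0 \<le> I (\<lambda>x. (z x)\<^sup>2) + \<epsilon> * I (\<lambda>x. (UX x)\<^sup>2) - (I (\<lambda>x. (W x - U x)\<^sup>2) + \<epsilon> * I (\<lambda>x. (P x)\<^sup>2))"
  proof (rule has_integral_le[OF 1 2])
    fix x
    have "2 * \<epsilon> * ((V x - W x) / \<epsilon> * (W x - U x) + (- P x - UX x) * P x)
        = 2 * (z x * (W x - U x)) - 2 * (W x - U x)\<^sup>2 - 2 * \<epsilon> * (P x)\<^sup>2 - \<epsilon> * (2 * (UX x * P x))"
      using eps by (simp add: z_def power2_eq_square field_simps)
    moreover have "2 * (z x * (W x - U x)) \<le> (z x)\<^sup>2 + (W x - U x)\<^sup>2"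
      using zero_le_power2[of "z x - (W x - U x)"] by (simp add: power2_diff)
    moreover have "- (2 * (UX x * P x)) \<le> (UX x)\<^sup>2 + (P x)\<^sup>2"
      using zero_le_power2[of "UX x + P x"] by (simp add: power2_sum)
    then have "\<epsilon> * - (2 * (UX x * P x)) \<le> \<epsilon> * ((UX x)\<^sup>2 + (P x)\<^sup>2)"
      using eps by (intro mult_left_mono) auto
    ultimately show "2 * \<epsilon> * ((V x - W x) / \<epsilon> * (W x - U x) + (- P x - UX x) * P x)
        \<le> (z x)\<^sup>2 + \<epsilon> * (UX x)\<^sup>2 - ((W x - U x)\<^sup>2 + \<epsilon> * (P x)\<^sup>2)"
      by (simp add: algebra_simps)
  qed
  then show ?thesis by simp
qed

text \<open>
  The key estimate. Expand \<open>- 2 G z\<close> with \<open>z = (W - U) + \<epsilon>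
  P'\<close>. The product \<open>(W\<^sup>2 - U\<^sup>2) (W - U)\<close> is nonnegative because
  \<open>W\<close> and \<open>U\<close> are; \<open>\<epsilon>\<^sup>2 P\<^sup>2 P'\<close> is
  an exact derivative; and \<open>- \<epsilon> (W\<^sup>2 - U\<^sup>2) P'\<close>, integrated by
  parts, yields \<open>- 2 \<epsilon> W P\<^sup>2 - 2 \<epsilon> U U' P\<close>. Added to the
  remaining term \<open>\<epsilon> P\<^sup>2 (W - U)\<close> this gives \<open>- \<epsilon> W
  P\<^sup>2 - \<epsilon> U P\<^sup>2 - 2 \<epsilon> U U' P\<close>, and the last two terms
  complete to a square up to \<open>\<epsilon> U U'\<^sup>2\<close>.
\<close>

lemma flux_dissipation:
  "- I (\<lambda>x. G x * z x) \<le> \<epsilon> * M / 2 * I (\<lambda>x. (UX x)\<^sup>2)"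
proof -
  \<comment> \<open>The exact derivative that collects all boundary terms; it vanishes at both ends with \<open>P\<close>.\<close>
  let ?B = "\<lambda>x. \<epsilon>\<^sup>2 / 3 * (P x) ^ 3 - \<epsilon> * (((W x)\<^sup>2 - (U x)\<^sup>2) * P x)"
  let ?b = "\<lambda>x. \<epsilon>\<^sup>2 * (P x)\<^sup>2 * ((V x - W x) / \<epsilon>)
      - \<epsilon> * ((2 * W x * - P x - 2 * U x * UX x) * P x + ((W x)\<^sup>2 - (U x)\<^sup>2) * ((V x - W x) / \<epsilon>))"
  have "(?B has_real_derivative ?b x) (at x within {-1..1})" if "x \<in> {-1..1}" for x
    by (rule derivative_eq_intros P W U that refl)+ (simp add: power2_eq_square algebra_simps)
  from FTC_reference_interval[OF this] P_bd have 1: "(?b has_integral 0) {-1..1}" by simp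
  have 2: "((\<lambda>x. - 2 * (G x * z x)) has_integral - 2 * I (\<lambda>x. G x * z x)) {-1..1}"
    by (intro has_integral_mult_right integrable_integral int continuous_intros cont_z cont_G)
  have 3: "((\<lambda>x. \<epsilon> * M * (UX x)\<^sup>2 + ?b x) has_integral \<epsilon> * M * I (\<lambda>x. (UX x)\<^sup>2) + 0) {-1..1}"
    by (intro has_integral_add 1 has_integral_mult_right integrable_integral int continuous_intros UX)
  have "- 2 * I (\<lambda>x. G x * z x) \<le> \<epsilon> * M * I (\<lambda>x. (UX x)\<^sup>2) + 0"
  proof (rule has_integral_le[OF 2 3])
    fix x :: real assume x: "x \<in> {-1..1}"
    \<comment> \<open>The derivative of \<open>P\<close>; the pointwise inequality is polynomial in \<open>p\<close>.\<close>
    define p where "p = (V x - W x) / \<epsilon>"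
    have zx: "z x = W x - U x + \<epsilon> * p" using eps by (simp add: p_def z_def)
    have "- 2 * (G x * z x) - ?b x = - ((W x + U x) * (W x - U x)\<^sup>2) - \<epsilon> * (W x * (P x)\<^sup>2)
       + \<epsilon> * (U x * (- (P x)\<^sup>2 - 2 * UX x * P x))"
    proof -
      have "- 2 * (G x * z x) = - ((W x)\<^sup>2 - \<epsilon> * (P x)\<^sup>2 - (U x)\<^sup>2) * z x"
        unfolding G_def by (simp only: times_divide_eq_left nonzero_mult_div_cancel_left mult_minus_left minus_divide_left)
      then show ?thesis unfolding p_def[symmetric] zx by (simp add: power2_eq_square algebra_simps)
    qed
    also have "\<dots> \<le> \<epsilon> * (M * (UX x)\<^sup>2)"
    proof -
      have a: "0 \<le> (W x + U x) * (W x - U x)\<^sup>2" using W_nonneg[OF x] U_bd(1)[OF x] by simp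
      have b: "0 \<le> \<epsilon> * (W x * (P x)\<^sup>2)" using W_nonneg[OF x] eps by simp
      have "- (P x)\<^sup>2 - 2 * UX x * P x \<le> (UX x)\<^sup>2"
        using zero_le_power2[of "UX x + P x"] by (simp add: power2_sum)
      then have "U x * (- (P x)\<^sup>2 - 2 * UX x * P x) \<le> U x * (UX x)\<^sup>2"
        using U_bd(1)[OF x] by (intro mult_left_mono)
      also have "\<dots> \<le> M * (UX x)\<^sup>2" using U_bd(2)[OF x] by (intro mult_right_mono) auto
      finally have "\<epsilon> * (U x * (- (P x)\<^sup>2 - 2 * UX x * P x)) \<le> \<epsilon> * (M * (UX x)\<^sup>2)"
        using eps by (intro mult_left_mono) auto
      with a b show ?thesis by linarith
    qed
    finally show "- 2 * (G x * z x) \<le> \<epsilon> * M * (UX x)\<^sup>2 + ?b x" by (simp add: mult.assoc)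
  qed
  then show ?thesis by simp
qed

definition "m = I z"
text \<open>
  The primitive of \<open>z\<close>, with the linear function subtracted that makes it vanish at
  both end points.
\<close>

definition "Zt x = integral {-1..x} z - (x + 1) / 2 * m"
text \<open>
  Equivalent to the square of the norm of \<open>z\<close> in the dual of
  \<open>W\<^sup>1\<^sup>,\<^sup>2(-1,1)\<close>.
\<close>

definition "y = I (\<lambda>x. (Zt x)\<^sup>2) + m\<^sup>2"

lemma Zt_deriv: "x \<in> {-1..1} \<Longrightarrow> (Zt has_real_derivative (z x - m / 2)) (at x within {-1..1})"
proof -
  assume x: "x \<in> {-1..1}"
  have "((\<lambda>x. (x + 1) / 2 * c) has_real_derivative c / 2) (at x within {-1..1})" for c
    by (auto intro!: derivative_eq_intros)
  then show ?thesis unfolding Zt_def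
    by (intro DERIV_diff integral_has_real_derivative cont_z x)
qed

lemma cont_Zt: "continuous_on {-1..1} Zt"
  using Zt_deriv by (meson DERIV_continuous continuous_on_eq_continuous_within)

lemma Zt_bd: "Zt (-1) = 0" "Zt 1 = 0" by (auto simp: Zt_def m_def)

lemma y_nonneg: "y \<ge> 0" unfolding y_def
  by (intro add_nonneg_nonneg integral_nonneg int continuous_intros cont_Zt) auto

lemma m_le: "\<bar>m\<bar> \<le> sqrt y" "m\<^sup>2 \<le> y"
proof -
  have "0 \<le> I (\<lambda>x. (Zt x)\<^sup>2)"
    by (intro integral_nonneg int continuous_intros cont_Zt) auto
  then show "m\<^sup>2 \<le> y" by (simp add: y_def)
  then show "\<bar>m\<bar> \<le> sqrt y" by (metis real_sqrt_abs real_sqrt_le_iff)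
qed

text \<open>
  By Young the \<open>L\<^sup>1\<close> norm of \<open>Zt\<close> is at most \<open>y / (2 s) +
  s\<close> for every \<open>s > 0\<close>; take \<open>s = \<surd>y\<close>.
\<close>

lemma Zt_L1: "I (\<lambda>x. \<bar>Zt x\<bar>) \<le> 3/2 * sqrt y"
proof -
  define s where "s = sqrt y"
  have s: "s \<ge> 0" "s\<^sup>2 = y" using y_nonneg by (auto simp: s_def)
  show ?thesis
  proof (cases "s = 0")
    case True
    have "0 \<le> I (\<lambda>x. (Zt x)\<^sup>2)"
      by (intro integral_nonneg int continuous_intros cont_Zt) auto
    moreover have "I (\<lambda>x. (Zt x)\<^sup>2) + m\<^sup>2 = 0" using True s(2) by (simp add: y_def)
    ultimately have "I (\<lambda>x. (Zt x)\<^sup>2) = 0" using zero_le_power2[of m] by linarith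
    moreover have "continuous_on {-1..1} (\<lambda>x. (Zt x)\<^sup>2)" by (intro continuous_intros cont_Zt)
    ultimately have "\<forall>x\<in>{-1..1}. (Zt x)\<^sup>2 = 0"
      using integral_eq_0_iff[of "-1" 1 "\<lambda>x. (Zt x)\<^sup>2"] by simp
    then have "I (\<lambda>x. \<bar>Zt x\<bar>) = I (\<lambda>x. 0)"
      by (intro Henstock_Kurzweil_Integration.integral_cong) auto
    then show ?thesis using y_nonneg by simp
  next
    case False
    with s(1) have "s > 0" by simp
    have "I (\<lambda>x. \<bar>Zt x\<bar>) \<le> I (\<lambda>x. (1 / (2 * s)) * (Zt x)\<^sup>2 + s / 2)"
    proof (intro Henstock_Kurzweil_Integration.integral_le int continuous_intros cont_Zt)
      fix x
      show "\<bar>Zt x\<bar> \<le> 1 / (2 * s) * (Zt x)\<^sup>2 + s / 2"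
        using young_inequality[of "1 / (2 * s)" "\<bar>Zt x\<bar>" 1] \<open>s > 0\<close> by simp
    qed
    also have "\<dots> = (1 / (2 * s)) * I (\<lambda>x. (Zt x)\<^sup>2) + s"
    proof -
      have "((\<lambda>x. (1 / (2 * s)) * (Zt x)\<^sup>2 + s / 2) has_integral
         (1 / (2 * s)) * I (\<lambda>x. (Zt x)\<^sup>2) + (1 - (-1)) * (s / 2)) {-1..1}"
        by (intro has_integral_add has_integral_mult_right integrable_integral int continuous_intros cont_Zt)
           (use has_integral_const_real[of "s/2" "-1" 1] in auto)
      from integral_unique[OF this] show ?thesis by simp
    qed
    also have "\<dots> \<le> (1 / (2 * s)) * s\<^sup>2 + s"
      using \<open>s > 0\<close> s(2) zero_le_power2[of m] by (intro add_right_mono mult_left_mono) (auto simp: y_def)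
    also have "\<dots> = 3/2 * s" using \<open>s > 0\<close> by (simp add: power2_eq_square)
    finally show ?thesis by (simp add: s_def)
  qed
qed


lemma G_bound: "x \<in> {-1..1} \<Longrightarrow> \<bar>G x\<bar> \<le> ((W x - U x)\<^sup>2 + \<epsilon> * (P x)\<^sup>2) / 2 + M * \<bar>W x - U x\<bar>"
proof -
  assume x: "x \<in> {-1..1}"
  define w where "w = W x - U x"
  have "\<bar>U x * w\<bar> \<le> M * \<bar>w\<bar>" unfolding abs_mult using U_bd[OF x] by (intro mult_right_mono) auto
  moreover have "G x = (w\<^sup>2 - \<epsilon> * (P x)\<^sup>2) / 2 + U x * w"
    by (simp add: G_def w_def power2_eq_square field_simps)
  moreover have "0 \<le> w\<^sup>2" "0 \<le> \<epsilon> * (P x)\<^sup>2" using eps by auto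
  moreover have "\<bar>g\<bar> \<le> (a + b) / 2 + e" if "\<bar>c\<bar> \<le> e" "g = (a - b) / 2 + c" "0 \<le> a" "0 \<le> b" for a b c e g :: real
    using that by (simp add: abs_le_iff field_simps) linarith
  ultimately show ?thesis unfolding w_def[symmetric] by blast
qed

text \<open>
  The mean of \<open>G\<close> is quadratic in the unknowns, but it is multiplied by
  \<open>m\<close>, which is at most \<open>\<surd>y\<close>.
\<close>

lemma mean_flux_bound:
  assumes "\<eta> > 0"
  shows "m / 2 * I G \<le> (\<bar>m\<bar> / 4 + \<eta>) * (I (\<lambda>x. (z x)\<^sup>2) + \<epsilon> * I (\<lambda>x. (UX x)\<^sup>2)) + M\<^sup>2 * m\<^sup>2 / (8 * \<eta>)"
proof -
  let ?Q = "I (\<lambda>x. (W x - U x)\<^sup>2) + \<epsilon> * I (\<lambda>x. (P x)\<^sup>2)"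
  let ?r = "\<lambda>x. (\<bar>m\<bar> / 4 + \<eta>) * ((W x - U x)\<^sup>2 + \<epsilon> * (P x)\<^sup>2) + M\<^sup>2 * m\<^sup>2 / (16 * \<eta>)"
  have 1: "((\<lambda>x. m / 2 * G x) has_integral m / 2 * I G) {-1..1}"
    by (intro has_integral_mult_right integrable_integral int cont_G)
  have c: "((\<lambda>x. M\<^sup>2 * m\<^sup>2 / (16 * \<eta>)) has_integral M\<^sup>2 * m\<^sup>2 / (8 * \<eta>)) {-1..1::real}"
    using has_integral_const_real[of "M\<^sup>2 * m\<^sup>2 / (16 * \<eta>)" "-1" 1] by simp
  have 2: "(?r has_integral (\<bar>m\<bar> / 4 + \<eta>) * ?Q + M\<^sup>2 * m\<^sup>2 / (8 * \<eta>)) {-1..1}"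
    by (intro has_integral_add[OF _ c] has_integral_mult_right has_integral_add integrable_integral int
        continuous_intros cont)
  have "m / 2 * I G \<le> (\<bar>m\<bar> / 4 + \<eta>) * ?Q + M\<^sup>2 * m\<^sup>2 / (8 * \<eta>)"
  proof (rule has_integral_le[OF 1 2])
    fix x :: real assume x: "x \<in> {-1..1}"
    define w where "w = W x - U x"
    have "m / 2 * G x \<le> \<bar>m / 2\<bar> * \<bar>G x\<bar>" by (metis abs_ge_self abs_mult)
    also have "\<dots> \<le> \<bar>m / 2\<bar> * ((w\<^sup>2 + \<epsilon> * (P x)\<^sup>2) / 2 + M * \<bar>w\<bar>)"
      using G_bound[OF x] unfolding w_def by (intro mult_left_mono) auto
    also have "\<dots> = \<bar>m\<bar> / 4 * (w\<^sup>2 + \<epsilon> * (P x)\<^sup>2) + \<bar>w\<bar> * (M * \<bar>m\<bar> / 2)"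
      by (simp add: algebra_simps)
    also have "\<bar>w\<bar> * (M * \<bar>m\<bar> / 2) \<le> \<eta> * \<bar>w\<bar>\<^sup>2 + (M * \<bar>m\<bar> / 2)\<^sup>2 / (4 * \<eta>)" by (rule young_inequality[OF assms])
    also have "\<dots> = \<eta> * w\<^sup>2 + M\<^sup>2 * m\<^sup>2 / (16 * \<eta>)" by (simp add: power_mult_distrib power_divide)
    also have "\<eta> * w\<^sup>2 \<le> \<eta> * (w\<^sup>2 + \<epsilon> * (P x)\<^sup>2)" using assms eps by (intro mult_left_mono) auto
    finally show "m / 2 * G x \<le> ?r x" unfolding w_def by (simp add: algebra_simps)
  qed
  also have "(\<bar>m\<bar> / 4 + \<eta>) * ?Q \<le> (\<bar>m\<bar> / 4 + \<eta>) * (I (\<lambda>x. (z x)\<^sup>2) + \<epsilon> * I (\<lambda>x. (UX x)\<^sup>2))"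
    using assms by (intro mult_left_mono resolvent_estimate) auto
  finally show ?thesis by simp
qed

definition "reac r x = integral {-1..x} (\<lambda>x. r * z x * (1 - V x - U x))"

text \<open>
  The time derivative of \<open>\<integral>\<^bsub>-1\<^esub>\<^bsup>x\<^esup> z\<close>
  prescribed by the two evolution equations.
\<close>

definition "flux \<delta> r x = \<delta> * (VX x - UX x) - V x * P x - U x * UX x + reac r x"

lemma cont_reac: "continuous_on {-1..1} (reac r)"
  unfolding reac_def
  by (intro indefinite_integral_continuous_1 int continuous_intros cont cont_z)

lemma reac_bound:
  assumes "r \<ge> 0" "x \<in> {-1..1}"
  shows "\<bar>reac r x\<bar> \<le> r * I (\<lambda>x. (z x)\<^sup>2) + r * (1 + 2 * M) * I (\<lambda>x. \<bar>z x\<bar>)"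
proof -
  let ?f = "\<lambda>x. r * z x * (1 - V x - U x)"
  let ?h = "\<lambda>x. r * (z x)\<^sup>2 + r * (1 + 2 * M) * \<bar>z x\<bar>"
  have h: "(?h has_integral r * I (\<lambda>x. (z x)\<^sup>2) + r * (1 + 2 * M) * I (\<lambda>x. \<bar>z x\<bar>)) {-1..1}"
    by (intro has_integral_add has_integral_mult_right integrable_integral int continuous_intros cont_z)
  have hc: "continuous_on {-1..1} ?h" "continuous_on {-1..1} ?f" by (intro continuous_intros cont cont_z)+
  have sub: "{-1..x} \<subseteq> {-1..1}" using assms(2) by auto
  have h0: "0 \<le> ?h x" for x using assms(1) M_nonneg by simp
  have "norm (reac r x) \<le> integral {-1..x} ?h"
    unfolding reac_def
  proof (rule integral_norm_bound_integral)
    show "?f integrable_on {-1..x}" "?h integrable_on {-1..x}"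
      using hc sub by (auto intro!: int intro: continuous_on_subset)
    fix t assume "t \<in> {-1..x}"
    then have t: "t \<in> {-1..1}" using sub by blast
    have "\<bar>1 - V t - U t\<bar> \<le> \<bar>z t\<bar> + (1 + 2 * M)" using U_bd[OF t] by (auto simp: z_def)
    then have "\<bar>z t\<bar> * \<bar>1 - V t - U t\<bar> \<le> \<bar>z t\<bar> * (\<bar>z t\<bar> + (1 + 2 * M))" by (intro mult_left_mono) auto
    from mult_left_mono[OF this assms(1)]
    have "r * (\<bar>z t\<bar> * \<bar>1 - V t - U t\<bar>) \<le> r * (\<bar>z t\<bar> * (\<bar>z t\<bar> + (1 + 2 * M)))" .
    also have "\<dots> = ?h t" by (simp add: power2_eq_square algebra_simps)
    finally show "norm (?f t) \<le> ?h t" using assms(1) by (simp add: abs_mult mult.assoc)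
  qed
  also have "\<dots> \<le> integral {-1..1} ?h"
    using hc sub h0 by (intro integral_subset_le int) (auto intro: continuous_on_subset)
  also have "\<dots> = r * I (\<lambda>x. (z x)\<^sup>2) + r * (1 + 2 * M) * I (\<lambda>x. \<bar>z x\<bar>)" by (rule integral_unique[OF h])
  finally show ?thesis by simp
qed

text \<open>
  Integration by parts: \<open>\<delta> (V' - U') - V P - U U'\<close> is the derivative of
  \<open>\<delta> z + G\<close>, while \<open>Zt\<close> vanishes at the end points and has
  derivative \<open>z - m/2\<close>.
\<close>

lemma diffusion_identity:
  "I (\<lambda>x. Zt x * (\<delta> * (VX x - UX x) - V x * P x - U x * UX x))
    = - \<delta> * I (\<lambda>x. (z x)\<^sup>2) - I (\<lambda>x. G x * z x) + m / 2 * (\<delta> * m + I G)"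
proof -
  let ?sx = "\<lambda>x. \<delta> * (VX x - UX x) - V x * P x - U x * UX x"
  have S: "((\<lambda>x. \<delta> * z x + G x) has_real_derivative ?sx x) (at x within {-1..1})" if "x \<in> {-1..1}" for x
  proof -
    have "((\<lambda>x. \<delta> * (V x - U x) + ((W x)\<^sup>2 - \<epsilon> * (P x)\<^sup>2 - (U x)\<^sup>2) / 2) has_real_derivative
        \<delta> * (VX x - UX x) + (2 * (- P x * W x) - \<epsilon> * (2 * ((V x - W x) / \<epsilon> * P x)) - 2 * (UX x * U x)) / 2)
        (at x within {-1..1})"
      unfolding power2_eq_square
      using DERIV_mult[OF W[OF that] W[OF that]] DERIV_mult[OF P[OF that] P[OF that]] DERIV_mult[OF U[OF that] U[OF that]]
      by (intro DERIV_add DERIV_cmult DERIV_diff DERIV_cdivide V U that) (simp_all only: mult_2)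
    moreover have "\<delta> * (VX x - UX x) + (2 * (- P x * W x) - \<epsilon> * (2 * ((V x - W x) / \<epsilon> * P x)) - 2 * (UX x * U x)) / 2
        = ?sx x" using eps by (simp add: field_simps)
    ultimately show ?thesis unfolding z_def G_def by (simp only:)
  qed
  have "((\<lambda>x. Zt x * (\<delta> * z x + G x)) has_real_derivative
      ((z x - m / 2) * (\<delta> * z x + G x) + ?sx x * Zt x)) (at x within {-1..1})" if "x \<in> {-1..1}" for x
    by (intro DERIV_mult Zt_deriv S that)
  from FTC_reference_interval[OF this] have 1: "((\<lambda>x. (z x - m / 2) * (\<delta> * z x + G x) + ?sx x * Zt x) has_integral 0) {-1..1}"
    by (simp add: Zt_bd)
  have 2: "((\<lambda>x. \<delta> * (z x)\<^sup>2 + G x * z x - m / 2 * (\<delta> * z x + G x)) has_integral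
      \<delta> * I (\<lambda>x. (z x)\<^sup>2) + I (\<lambda>x. G x * z x) - m / 2 * (\<delta> * I z + I G)) {-1..1}"
    by (intro has_integral_diff has_integral_add has_integral_mult_right integrable_integral int
          continuous_intros cont_z cont_G)
  have eq: "(\<lambda>x. (z x - m / 2) * (\<delta> * z x + G x) + ?sx x * Zt x
       - (\<delta> * (z x)\<^sup>2 + G x * z x - m / 2 * (\<delta> * z x + G x))) = (\<lambda>x. Zt x * ?sx x)"
    by (intro ext) (simp add: power2_eq_square algebra_simps)
  have "((\<lambda>x. Zt x * ?sx x) has_integral
      0 - (\<delta> * I (\<lambda>x. (z x)\<^sup>2) + I (\<lambda>x. G x * z x) - m / 2 * (\<delta> * I z + I G))) {-1..1}"
    using has_integral_diff[OF 1 2] unfolding eq .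
  from integral_unique[OF this] show ?thesis by (simp add: m_def)
qed

lemma flux_1: "flux \<delta> r 1 = reac r 1"
  using P_bd VX_bd UX_bd by (simp add: flux_def)

text \<open>
  The reaction is quadratic in \<open>z\<close>, hence not controlled by \<open>y\<close>; the
  factor \<open>\<surd>y\<close> makes it absorbable once \<open>y\<close> is small.
\<close>

lemma reaction_bound:
  assumes "r \<ge> 0"
  shows "I (\<lambda>x. Zt x * (reac r x - (x + 1) / 2 * reac r 1)) + m * reac r 1
    \<le> 4 * sqrt y * (r * I (\<lambda>x. (z x)\<^sup>2) + r * (1 + 2 * M) * I (\<lambda>x. \<bar>z x\<bar>))"
proof -
  define B where "B = r * I (\<lambda>x. (z x)\<^sup>2) + r * (1 + 2 * M) * I (\<lambda>x. \<bar>z x\<bar>)"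
  have b: "\<bar>reac r x\<bar> \<le> B" if "x \<in> {-1..1}" for x using reac_bound[OF assms that] by (simp add: B_def)
  have B0: "B \<ge> 0" using b[of 0] by simp
  have "I (\<lambda>x. Zt x * (reac r x - (x + 1) / 2 * reac r 1)) \<le> I (\<lambda>x. 2 * B * \<bar>Zt x\<bar>)"
  proof (intro Henstock_Kurzweil_Integration.integral_le int continuous_intros cont_Zt cont_reac)
    fix x :: real assume x: "x \<in> {-1..1}"
    have "\<bar>(x + 1) / 2 * reac r 1\<bar> \<le> 1 * B"
      unfolding abs_mult using b[of 1] x by (intro mult_mono) auto
    then have "\<bar>reac r x - (x + 1) / 2 * reac r 1\<bar> \<le> 2 * B" using b[OF x] by linarith
    then have "\<bar>Zt x\<bar> * \<bar>reac r x - (x + 1) / 2 * reac r 1\<bar> \<le> \<bar>Zt x\<bar> * (2 * B)" by (intro mult_left_mono) auto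
    then show "Zt x * (reac r x - (x + 1) / 2 * reac r 1) \<le> 2 * B * \<bar>Zt x\<bar>"
      by (metis abs_le_D1 abs_mult mult.commute)
  qed auto
  also have "\<dots> = 2 * B * I (\<lambda>x. \<bar>Zt x\<bar>)" by simp
  also have "\<dots> \<le> 2 * B * (3/2 * sqrt y)" using B0 by (intro mult_left_mono Zt_L1) auto
  finally have 1: "I (\<lambda>x. Zt x * (reac r x - (x + 1) / 2 * reac r 1)) \<le> 3 * sqrt y * B" by (simp add: mult_ac)
  have "m * reac r 1 \<le> \<bar>m\<bar> * \<bar>reac r 1\<bar>" by (metis abs_ge_self abs_mult)
  also have "\<dots> \<le> sqrt y * B" using b[of 1] m_le(1) y_nonneg by (intro mult_mono) auto
  finally show ?thesis using 1 unfolding B_def by (simp add: algebra_simps)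
qed

lemma L1_absorb:
  assumes "\<eta> > 0" "s \<ge> 0"
  shows "s * I (\<lambda>x. \<bar>z x\<bar>) \<le> \<eta> * I (\<lambda>x. (z x)\<^sup>2) + s\<^sup>2 / (2 * \<eta>)"
proof -
  have c: "((\<lambda>x. s\<^sup>2 / (4 * \<eta>)) has_integral s\<^sup>2 / (2 * \<eta>)) {-1..1::real}"
    using has_integral_const_real[of "s\<^sup>2 / (4 * \<eta>)" "-1" 1] by simp
  have 1: "((\<lambda>x. s * \<bar>z x\<bar>) has_integral s * I (\<lambda>x. \<bar>z x\<bar>)) {-1..1}"
    by (intro has_integral_mult_right integrable_integral int continuous_intros cont_z)
  have 2: "((\<lambda>x. \<eta> * (z x)\<^sup>2 + s\<^sup>2 / (4 * \<eta>)) has_integral \<eta> * I (\<lambda>x. (z x)\<^sup>2) + s\<^sup>2 / (2 * \<eta>)) {-1..1}"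
    by (intro has_integral_add[OF _ c] has_integral_mult_right integrable_integral int continuous_intros cont_z)
  show ?thesis
    by (rule has_integral_le[OF 1 2]) (use young_inequality[OF assms(1), of "\<bar>z _\<bar>" s] in \<open>simp add: mult.commute\<close>)
qed

lemma y_le: "y \<le> 9 * (I (\<lambda>x. \<bar>z x\<bar>))\<^sup>2"
proof -
  define A where "A = I (\<lambda>x. \<bar>z x\<bar>)"
  have ca: "continuous_on {-1..1} (\<lambda>x. \<bar>z x\<bar>)" by (intro continuous_intros cont_z)
  have K: "\<bar>integral {-1..x} z\<bar> \<le> A" if x: "x \<in> {-1..1}" for x
  proof -
    have sub: "{-1..x} \<subseteq> {-1..1}" using x by auto
    have "norm (integral {-1..x} z) \<le> integral {-1..x} (\<lambda>x. \<bar>z x\<bar>)"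
      by (rule integral_norm_bound_integral) (auto intro!: int continuous_on_subset[OF cont_z sub] continuous_on_subset[OF ca sub])
    also have "\<dots> \<le> A" unfolding A_def
      by (intro integral_subset_le int continuous_on_subset[OF ca sub] ca sub) auto
    finally show ?thesis by simp
  qed
  have A0: "A \<ge> 0" using K[of "-1"] by simp
  have m: "\<bar>m\<bar> \<le> A" using K[of 1] by (simp add: m_def)
  have "(Zt x)\<^sup>2 \<le> 4 * A\<^sup>2" if x: "x \<in> {-1..1}" for x
  proof -
    have "\<bar>(x + 1) / 2 * m\<bar> \<le> 1 * A" unfolding abs_mult using m x by (intro mult_mono) auto
    then have "\<bar>Zt x\<bar> \<le> 2 * A" using K[OF x] unfolding Zt_def by linarith
    then have "\<bar>Zt x\<bar>\<^sup>2 \<le> (2 * A)\<^sup>2" by (intro power_mono) auto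
    then show ?thesis by (simp add: power_mult_distrib)
  qed
  then have "I (\<lambda>x. (Zt x)\<^sup>2) \<le> I (\<lambda>x. 4 * A\<^sup>2)"
    by (intro Henstock_Kurzweil_Integration.integral_le int continuous_intros cont_Zt)
  moreover have "m\<^sup>2 \<le> A\<^sup>2" using m A0 by (simp add: abs_le_square_iff[symmetric])
  ultimately show ?thesis by (simp add: y_def A_def)
qed

text \<open>
  Used only to see that \<open>y\<close> tends to \<open>0\<close> at the initial time.
\<close>

lemma y_le_L2: "y \<le> 18 * I (\<lambda>x. (z x)\<^sup>2)"
proof -
  define A where "A = I (\<lambda>x. \<bar>z x\<bar>)"
  have "A \<ge> 0" unfolding A_def by (intro integral_nonneg int continuous_intros cont_z) auto
  from L1_absorb[OF zero_less_one this] have "A * A \<le> I (\<lambda>x. (z x)\<^sup>2) + A\<^sup>2 / 2"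
    by (simp add: A_def)
  then show ?thesis using y_le by (simp add: A_def power2_eq_square)
qed

text \<open>
  All error terms are collected, with Young constants \<open>\<delta>/8\<close> chosen such that
  half of the dissipation \<open>\<delta> \<integral> z\<^sup>2\<close> survives. The left-hand
  side is the time derivative of \<open>y\<close>, since \<open>flux\<close> is that of
  \<open>\<integral>\<^bsub>-1\<^esub>\<^bsup>x\<^esup> z\<close>.
\<close>

lemma dissipation:
  assumes \<delta>: "\<delta> > 0" and r: "r \<ge> 0" and \<kappa>: "sqrt y \<le> \<kappa>" "\<kappa> \<le> 1" "\<kappa> * (1 / 4 + 4 * r) \<le> \<delta> / 4"
  shows "2 * (I (\<lambda>x. Zt x * (flux \<delta> r x - (x + 1) / 2 * flux \<delta> r 1)) + m * flux \<delta> r 1)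
    \<le> - \<delta> * I (\<lambda>x. (z x)\<^sup>2) + (M + 1 / 2 + \<delta> / 4) * \<epsilon> * I (\<lambda>x. (UX x)\<^sup>2)
      + (\<delta> + 2 * M\<^sup>2 / \<delta> + 128 * (r * (1 + 2 * M))\<^sup>2 / \<delta>) * y"
proof -
  define s Z h where "s = sqrt y" and "Z = I (\<lambda>x. (z x)\<^sup>2)" and "h = \<epsilon> * I (\<lambda>x. (UX x)\<^sup>2)"
  define c where "c = r * (1 + 2 * M)"
  have s: "s \<ge> 0" "s\<^sup>2 = y" "s \<le> \<kappa>" using y_nonneg \<kappa> by (auto simp: s_def)
  have Z0: "Z \<ge> 0" unfolding Z_def by (intro integral_nonneg int continuous_intros cont_z) auto
  have h0: "h \<ge> 0" unfolding h_def using eps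
    by (intro mult_nonneg_nonneg integral_nonneg int continuous_intros UX) auto
  have c0: "c \<ge> 0" using r M_nonneg by (simp add: c_def)
  let ?sx = "\<lambda>x. \<delta> * (VX x - UX x) - V x * P x - U x * UX x"
  let ?\<rho> = "\<lambda>x. reac r x - (x + 1) / 2 * reac r 1"
  have "I (\<lambda>x. Zt x * (flux \<delta> r x - (x + 1) / 2 * flux \<delta> r 1)) = I (\<lambda>x. Zt x * ?sx x + Zt x * ?\<rho> x)"
    unfolding flux_1 by (simp add: flux_def algebra_simps)
  also have "\<dots> = I (\<lambda>x. Zt x * ?sx x) + I (\<lambda>x. Zt x * ?\<rho> x)"
    by (intro Henstock_Kurzweil_Integration.integral_add int continuous_intros cont cont_Zt cont_reac VX UX) auto
  finally have E: "I (\<lambda>x. Zt x * (flux \<delta> r x - (x + 1) / 2 * flux \<delta> r 1)) + m * flux \<delta> r 1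
      = I (\<lambda>x. Zt x * ?sx x) + (I (\<lambda>x. Zt x * ?\<rho> x) + m * reac r 1)"
    by (simp add: flux_1)
  have e1: "I (\<lambda>x. Zt x * ?sx x) = - \<delta> * Z - I (\<lambda>x. G x * z x) + \<delta> / 2 * m\<^sup>2 + m / 2 * I G"
    unfolding diffusion_identity Z_def by (simp add: power2_eq_square algebra_simps)
  have e2: "- I (\<lambda>x. G x * z x) \<le> M / 2 * h" using flux_dissipation by (simp add: h_def mult_ac)
  have e3: "m / 2 * I G \<le> (s / 4 + \<delta> / 8) * (Z + h) + M\<^sup>2 * y / \<delta>"
  proof -
    have "m / 2 * I G \<le> (\<bar>m\<bar> / 4 + \<delta> / 8) * (Z + h) + M\<^sup>2 * m\<^sup>2 / (8 * (\<delta> / 8))"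
      unfolding Z_def h_def by (rule mean_flux_bound) (use \<delta> in simp)
    also have "\<dots> \<le> (s / 4 + \<delta> / 8) * (Z + h) + M\<^sup>2 * y / \<delta>"
      using m_le Z0 h0 \<delta> unfolding s_def
      by (intro add_mono mult_right_mono) (auto intro!: divide_right_mono mult_left_mono)
    finally show ?thesis .
  qed
  have e4: "I (\<lambda>x. Zt x * ?\<rho> x) + m * reac r 1 \<le> 4 * s * r * Z + (\<delta> / 8 * Z + 64 * c\<^sup>2 * y / \<delta>)"
  proof -
    have "4 * s * c * I (\<lambda>x. \<bar>z x\<bar>) \<le> \<delta> / 8 * Z + (4 * s * c)\<^sup>2 / (2 * (\<delta> / 8))"
      unfolding Z_def by (rule L1_absorb) (use \<delta> s c0 in auto)
    also have "(4 * s * c)\<^sup>2 / (2 * (\<delta> / 8)) = 64 * c\<^sup>2 * y / \<delta>"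
      unfolding s(2)[symmetric] by (simp add: power_mult_distrib)
    finally show ?thesis using reaction_bound[OF r] unfolding s_def Z_def c_def by (simp add: algebra_simps)
  qed
  have e5: "s / 4 * Z + 4 * s * r * Z \<le> \<delta> / 4 * Z"
  proof -
    have "s * (1 / 4 + 4 * r) \<le> \<kappa> * (1 / 4 + 4 * r)" using s(3) r by (intro mult_right_mono) auto
    with \<kappa>(3) have "s * (1 / 4 + 4 * r) \<le> \<delta> / 4" by linarith
    from mult_right_mono[OF this Z0] show ?thesis by (simp add: algebra_simps)
  qed
  have e6: "s / 4 * h \<le> h / 4" using s(3) \<kappa>(2) h0 mult_right_mono[of s 1 h] by simp
  have e7: "\<delta> / 2 * m\<^sup>2 \<le> \<delta> / 2 * y" using m_le(2) \<delta> by (intro mult_left_mono) auto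
  define E1 E2 where "E1 = I (\<lambda>x. Zt x * ?sx x)" and "E2 = I (\<lambda>x. Zt x * ?\<rho> x) + m * reac r 1"
  define J1 J2 where "J1 = I (\<lambda>x. G x * z x)" and "J2 = m / 2 * I G"
  define t1 t2 where "t1 = M\<^sup>2 * y / \<delta>" and "t2 = c\<^sup>2 * y / \<delta>"
  have a1: "E1 = - (\<delta> * Z) - J1 + \<delta> * m\<^sup>2 / 2 + J2" using e1 by (simp add: E1_def J1_def J2_def)
  have a2: "- J1 \<le> M * h / 2" using e2 by (simp add: J1_def)
  have a3: "J2 \<le> s * Z / 4 + s * h / 4 + \<delta> * Z / 8 + \<delta> * h / 8 + t1"
    using e3 unfolding J2_def[symmetric] t1_def[symmetric] by (simp add: algebra_simps add_divide_distrib)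
  have a4: "E2 \<le> 4 * (s * r * Z) + \<delta> * Z / 8 + 64 * t2"
    using e4 unfolding E2_def[symmetric] by (simp add: t2_def mult_ac)
  have a5: "s * Z / 4 + 4 * (s * r * Z) \<le> \<delta> * Z / 4" using e5 by (simp add: mult_ac)
  have a6: "s * h / 4 \<le> h / 4" using e6 by simp
  have a7: "\<delta> * m\<^sup>2 / 2 \<le> \<delta> * y / 2" using e7 by simp
  have "2 * (E1 + E2) \<le> - (\<delta> * Z) + (M * h + h / 2 + \<delta> * h / 4) + (\<delta> * y + 2 * t1 + 128 * t2)"
    using a1 a2 a3 a4 a5 a6 a7 by argo
  also have "\<dots> = - \<delta> * Z + (M + 1 / 2 + \<delta> / 4) * h + (\<delta> + 2 * M\<^sup>2 / \<delta> + 128 * c\<^sup>2 / \<delta>) * y"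
    by (simp add: t1_def t2_def algebra_simps)
  finally show ?thesis
    unfolding E Z_def[symmetric] c_def[symmetric] E1_def[symmetric] E2_def[symmetric]
    by (simp add: h_def mult.assoc)
qed

end

section \<open>Continuation in time\<close>

text \<open>
  The function \<open>e\<^bsup>- C t\<^esup> y(t)\<close>, corrected by the integrals of the
  dissipation and of the forcing, is nonincreasing. The dissipation carries the constant weight
  \<open>e\<^bsup>- C T\<^esup>\<close>, a lower bound of all weights on \<open>[s,t]\<close>.
\<close>

lemma gronwall_step:
  fixes y y' Z h :: "real \<Rightarrow> real"
  assumes st: "0 < s" "s < t" "t \<le> T" and "C \<ge> 0" "\<delta> \<ge> 0" "\<alpha> \<ge> 0"
    and y: "\<And>\<tau>. \<tau> \<in> {s..t} \<Longrightarrow> (y has_real_derivative y' \<tau>) (at \<tau>)"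
    and Z: "continuous_on {s..t} Z" "\<And>\<tau>. \<tau> \<in> {s..t} \<Longrightarrow> Z \<tau> \<ge> 0"
    and h: "continuous_on {s..t} h" "\<And>\<tau>. \<tau> \<in> {s..t} \<Longrightarrow> h \<tau> \<ge> 0"
    and ineq: "\<And>\<tau>. s < \<tau> \<Longrightarrow> \<tau> < t \<Longrightarrow> y' \<tau> \<le> - \<delta> * Z \<tau> + \<alpha> * h \<tau> + C * y \<tau>"
  shows "exp (- C * t) * y t + \<delta> * exp (- C * T) * integral {s..t} Z
    \<le> exp (- C * s) * y s + \<alpha> * integral {s..t} h"
proof -
  define E where "E \<tau> = exp (- C * \<tau>) * y \<tau> + \<delta> * exp (- C * T) * integral {s..\<tau>} Z - \<alpha> * integral {s..\<tau>} h" for \<tau>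
  have "E t \<le> E s"
  proof (rule DERIV_nonpos_imp_decreasing_open[OF less_imp_le[OF st(2)]])
    fix \<tau> assume \<tau>: "s < \<tau>" "\<tau> < t"
    have iZ: "((\<lambda>\<tau>. integral {s..\<tau>} Z) has_real_derivative Z \<tau>) (at \<tau>)"
      using integral_has_real_derivative[OF Z(1), of \<tau>] \<tau> by (simp add: at_within_Icc_at)
    have ih: "((\<lambda>\<tau>. integral {s..\<tau>} h) has_real_derivative h \<tau>) (at \<tau>)"
      using integral_has_real_derivative[OF h(1), of \<tau>] \<tau> by (simp add: at_within_Icc_at)
    have ex: "((\<lambda>\<tau>. exp (- C * \<tau>)) has_real_derivative exp (- C * \<tau>) * (- C)) (at \<tau>)"
      by (auto intro!: derivative_eq_intros)
    let ?D = "exp (- C * \<tau>) * (- C) * y \<tau> + y' \<tau> * exp (- C * \<tau>) + \<delta> * exp (- C * T) * Z \<tau> - \<alpha> * h \<tau>"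
    have D: "(E has_real_derivative ?D) (at \<tau>)"
      unfolding E_def by (intro DERIV_diff DERIV_add DERIV_mult DERIV_cmult iZ ih ex y) (use \<tau> in auto)
    have Z0: "Z \<tau> \<ge> 0" "h \<tau> \<ge> 0" using Z(2) h(2) \<tau> by auto
    define e where "e = exp (- C * \<tau>)"
    have e: "0 < e" "e \<le> 1" "exp (- C * T) \<le> e"
      using \<open>C \<ge> 0\<close> \<tau> st by (auto simp: e_def mult_left_mono)
    have "e * y' \<tau> \<le> e * (- \<delta> * Z \<tau> + \<alpha> * h \<tau> + C * y \<tau>)" using ineq[OF \<tau>] e by (intro mult_left_mono) auto
    moreover have "e * (\<alpha> * h \<tau>) \<le> 1 * (\<alpha> * h \<tau>)" using e Z0 assms(6) by (intro mult_right_mono) auto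
    moreover have "exp (- C * T) * (\<delta> * Z \<tau>) \<le> e * (\<delta> * Z \<tau>)" using e Z0 assms(5) by (intro mult_right_mono) auto
    ultimately have "?D \<le> 0" unfolding e_def[symmetric] by (simp add: algebra_simps)
    with D show "\<exists>d. (E has_real_derivative d) (at \<tau>) \<and> d \<le> 0" by blast
  next
    have "continuous_on {s..t} y"
      using y by (meson DERIV_isCont continuous_at_imp_continuous_on)
    then show "continuous_on {s..t} E" unfolding E_def
      by (intro continuous_intros indefinite_integral_continuous_1 integrable_continuous_interval Z h)
  qed
  then show ?thesis by (simp add: E_def)
qed

text \<open>
  The differential inequality is available only while \<open>y \<le> k\<close>. At the first
  time with \<open>y = k\<close> it would hold on the whole past, and the resulting bound
  \<open>y \<le> exp (C T) \<alpha> H < k\<close> is a contradiction; so it holds up to time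
  \<open>T\<close>.
\<close>

lemma gronwall_bootstrap:
  fixes y y' Z h :: "real \<Rightarrow> real"
  assumes T: "T > 0" and C: "C \<ge> 0" and \<delta>: "\<delta> \<ge> 0" and \<alpha>: "\<alpha> \<ge> 0"
    and y: "\<And>\<tau>. \<tau> > 0 \<Longrightarrow> (y has_real_derivative y' \<tau>) (at \<tau>)"
    and y0: "(y \<longlongrightarrow> 0) (at_right 0)" "\<And>\<tau>. \<tau> > 0 \<Longrightarrow> y \<tau> \<ge> 0"
    and Z: "continuous_on {0<..} Z" "\<And>\<tau>. \<tau> > 0 \<Longrightarrow> Z \<tau> \<ge> 0"
    and h: "continuous_on {0<..} h" "\<And>\<tau>. \<tau> > 0 \<Longrightarrow> h \<tau> \<ge> 0"
    and ineq: "\<And>\<tau>. 0 < \<tau> \<Longrightarrow> \<tau> \<le> T \<Longrightarrow> y \<tau> \<le> k \<Longrightarrow> y' \<tau> \<le> - \<delta> * Z \<tau> + \<alpha> * h \<tau> + C * y \<tau>"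
    and H: "\<And>s t. 0 < s \<Longrightarrow> s \<le> t \<Longrightarrow> t \<le> T \<Longrightarrow> integral {s..t} h \<le> H"
    and small: "exp (C * T) * (\<alpha> * H) < k"
    and s: "0 < s" "s \<le> T"
  shows "\<delta> * integral {s..T} Z \<le> exp (C * T) * (\<alpha> * H)"
proof -
  have H0: "H \<ge> 0" using H[of T T] T by simp
  have k0: "k > 0"
  proof -
    have "0 \<le> exp (C * T) * (\<alpha> * H)" using \<alpha> H0 by simp
    with small show ?thesis by linarith
  qed
  have Zi: "0 \<le> integral {s..t} Z" if "0 < s" for s t
    using that Z by (intro integral_nonneg integrable_continuous_interval continuous_on_subset[OF Z(1)]) auto
  have step: "exp (- C * t) * y t + \<delta> * exp (- C * T) * integral {s..t} Z \<le> y s + \<alpha> * H"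
    if st: "0 < s" "s < t" "t \<le> T" and le: "\<And>\<tau>. s < \<tau> \<Longrightarrow> \<tau> < t \<Longrightarrow> y \<tau> \<le> k" for s t
  proof -
    have "exp (- C * t) * y t + \<delta> * exp (- C * T) * integral {s..t} Z
      \<le> exp (- C * s) * y s + \<alpha> * integral {s..t} h"
      by (rule gronwall_step[OF st C \<delta> \<alpha> y])
         (use st le ineq Z h in \<open>auto intro: continuous_on_subset\<close>)
    also have "exp (- C * s) * y s \<le> 1 * y s" using y0(2)[of s] st C by (intro mult_right_mono) auto
    also have "\<alpha> * integral {s..t} h \<le> \<alpha> * H" using H[of s t] st \<alpha> by (intro mult_left_mono) auto
    finally show ?thesis by simp
  qed
  have lim: "L \<le> \<alpha> * H" if "\<And>s. 0 < s \<Longrightarrow> s < s0 \<Longrightarrow> L \<le> y s + \<alpha> * H" "s0 > 0" for L s0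
  proof -
    have "((\<lambda>s. y s + \<alpha> * H) \<longlongrightarrow> 0 + \<alpha> * H) (at_right 0)" by (intro tendsto_intros y0)
    moreover have "eventually (\<lambda>s. L \<le> y s + \<alpha> * H) (at_right 0)"
      unfolding eventually_at_right_field using that by blast
    ultimately have "L \<le> 0 + \<alpha> * H" by (rule tendsto_lowerbound) simp
    then show ?thesis by simp
  qed
  have lt: "y t1 < k" if t1: "0 < t1" "t1 \<le> T" for t1
  proof (rule ccontr)
    assume ge: "\<not> y t1 < k"
    obtain s0 where s0: "s0 > 0" "\<And>s. 0 < s \<Longrightarrow> s < s0 \<Longrightarrow> y s < k"
      using order_tendstoD(2)[OF y0(1) k0] unfolding eventually_at_right_field by blast
    have "\<not> t1 < s0" using s0(2)[of t1] t1 ge by auto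
    \<comment> \<open>The infimum of this compact set is the first time at which \<open>y\<close> reaches \<open>k\<close>.\<close>
    define S where "S = {t \<in> {s0 / 2..t1}. k \<le> y t}"
    have cy: "continuous_on {s0 / 2..t1} y"
      by (intro continuous_at_imp_continuous_on ballI DERIV_isCont[OF y]) (use s0 in auto)
    have "closed S" unfolding S_def
      by (rule continuous_on_closed_Collect_le[OF continuous_on_const cy closed_atLeastAtMost])
    moreover have "S \<noteq> {}" using ge s0 \<open>\<not> t1 < s0\<close> by (auto simp: S_def)
    moreover have "bdd_below S" by (rule bdd_belowI[of _ "s0 / 2"]) (auto simp: S_def)
    ultimately have tS: "Inf S \<in> S" by (rule closed_contains_Inf[rotated 2])
    define t where "t = Inf S"
    have t: "t \<in> {s0 / 2..t1}" "k \<le> y t" using tS by (auto simp: S_def t_def)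
    have below: "y \<tau> < k" if "0 < \<tau>" "\<tau> < t" for \<tau>
    proof (rule ccontr)
      assume "\<not> y \<tau> < k"
      then have "\<tau> \<ge> s0" using s0(2)[of \<tau>] that by force
      then have "\<tau> \<in> S" using \<open>\<not> y \<tau> < k\<close> that t(1) s0(1) by (auto simp: S_def)
      then have "t \<le> \<tau>" unfolding t_def using \<open>bdd_below S\<close> by (rule cInf_lower)
      with that show False by simp
    qed
    have t0: "t > 0" "t \<le> T" using t(1) s0(1) t1 by auto
    have "exp (- C * t) * y t \<le> \<alpha> * H"
    proof (rule lim[of t])
      fix s assume s: "0 < s" "s < t"
      have "exp (- C * t) * y t + \<delta> * exp (- C * T) * integral {s..t} Z \<le> y s + \<alpha> * H"
        by (rule step[OF s t0(2)]) (use below s in \<open>auto intro!: less_imp_le\<close>)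
      moreover have "0 \<le> \<delta> * exp (- C * T) * integral {s..t} Z" using Zi[OF s(1)] \<delta> by simp
      ultimately show "exp (- C * t) * y t \<le> y s + \<alpha> * H" by linarith
    qed (use t0 in auto)
    then have "exp (C * t) * (exp (- C * t) * y t) \<le> exp (C * t) * (\<alpha> * H)" by (intro mult_left_mono) auto
    then have "y t \<le> exp (C * t) * (\<alpha> * H)" by (simp add: mult.assoc[symmetric] exp_add[symmetric])
    also have "\<dots> \<le> exp (C * T) * (\<alpha> * H)"
      using t0 C \<alpha> H0 by (intro mult_right_mono) (auto intro: mult_left_mono)
    finally show False using t(2) small by linarith
  qed
  have "\<delta> * exp (- C * T) * integral {s..T} Z \<le> \<alpha> * H"
  proof (rule lim[of s])
    fix s' assume s': "0 < s'" "s' < s"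
    have "exp (- C * T) * y T + \<delta> * exp (- C * T) * integral {s'..T} Z \<le> y s' + \<alpha> * H"
      by (rule step) (use lt s s' in \<open>auto intro!: less_imp_le\<close>)
    moreover have "0 \<le> exp (- C * T) * y T" using y0(2)[OF T] by simp
    moreover have "integral {s..T} Z \<le> integral {s'..T} Z"
      using s s' Z by (intro integral_subset_le integrable_continuous_interval continuous_on_subset[OF Z(1)]) auto
    then have "\<delta> * exp (- C * T) * integral {s..T} Z \<le> \<delta> * exp (- C * T) * integral {s'..T} Z"
      using \<delta> by (intro mult_left_mono) auto
    ultimately show "\<delta> * exp (- C * T) * integral {s..T} Z \<le> y s' + \<alpha> * H" by linarith
  qed (use s in auto)
  then have "exp (C * T) * (\<delta> * exp (- C * T) * integral {s..T} Z) \<le> exp (C * T) * (\<alpha> * H)"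
    by (intro mult_left_mono) auto
  moreover have "exp (C * T) * (\<delta> * exp (- C * T) * integral {s..T} Z)
     = (exp (C * T) * exp (- C * T)) * (\<delta> * integral {s..T} Z)" by (simp add: mult_ac)
  moreover have "exp (C * T) * exp (- C * T) = 1" by (simp add: exp_add[symmetric])
  ultimately show ?thesis by (simp only: mult_1_left)
qed

section \<open>The limit problem\<close>

lemma parametric_integral_derivative:
  fixes f ft :: "real \<Rightarrow> real \<Rightarrow> real"
  assumes d: "\<And>t x. t > 0 \<Longrightarrow> x \<in> {a..b} \<Longrightarrow> ((\<lambda>t. f t x) has_real_derivative ft t x) (at t)"
    and c: "\<And>t. t > 0 \<Longrightarrow> continuous_on {a..b} (f t)"
    and ct: "continuous_on ({0<..} \<times> {a..b}) (\<lambda>(t, x). ft t x)" and t: "t > 0"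
  shows "((\<lambda>t. integral {a..b} (f t)) has_real_derivative integral {a..b} (ft t)) (at t)"
proof -
  have "((\<lambda>t. integral (cbox a b) (f t)) has_real_derivative integral (cbox a b) (ft t)) (at t within {0<..})"
  proof (rule leibniz_rule_field_derivative)
    show "((\<lambda>t. f t x) has_real_derivative ft s x) (at s within {0<..})" if "s \<in> {0<..}" "x \<in> cbox a b" for s x
      using d[of s x] that by (auto intro: DERIV_subset)
    show "f s integrable_on cbox a b" if "s \<in> {0<..}" for s
      using integrable_continuous_interval[OF c[of s]] that by simp
  qed (use ct t in auto)
  then show ?thesis using t by (simp add: at_within_open[of t "{0<..}"])
qed

text \<open>
  The equation is given in the open interval only, so the spatial integrals of
  \<open>u\<^sub>t\<close> and of \<open>u u\<^sub>t\<close> are computed by the fundamental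
  theorem of calculus for functions that are merely continuous up to the boundary. The last
  identity is the energy identity, from testing with \<open>u\<close>.
\<close>

lemma limit_solution_classical:
  assumes sol: "limit_solution \<delta> r u0 u"
  obtains ux where
    "continuous_on ({0..} \<times> {-1..1}) (\<lambda>(t, x). u t x)"
    "AE x in lebesgue_on dom_I. u 0 x = u0 x"
    "continuous_on ({0<..} \<times> {-1..1}) (\<lambda>(t, x). ux t x)"
    "\<And>t x. t > 0 \<Longrightarrow> x \<in> {-1..1} \<Longrightarrow> (u t has_real_derivative ux t x) (at x within {-1..1})"
    "\<And>t. t > 0 \<Longrightarrow> ux t (-1) = 0" "\<And>t. t > 0 \<Longrightarrow> ux t 1 = 0"
    "\<And>t x. t > 0 \<Longrightarrow> x \<in> {-1..1} \<Longrightarrow> ((\<lambda>t. integral {-1..x} (u t)) has_real_derivative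
        (\<delta> * ux t x + u t x * ux t x) + integral {-1..x} (\<lambda>y. r * u t y * (1 - u t y))) (at t)"
    "\<And>t. t > 0 \<Longrightarrow> ((\<lambda>t. integral {-1..1} (\<lambda>x. (u t x)\<^sup>2)) has_real_derivative
        2 * (integral {-1..1} (\<lambda>x. r * (u t x)\<^sup>2 * (1 - u t x)) - integral {-1..1} (\<lambda>x. (\<delta> + u t x) * (ux t x)\<^sup>2))) (at t)"
proof -
  from sol[unfolded limit_solution_def] obtain ut ux uxx where
    cu: "continuous_on ({0..} \<times> {-1..1}) (\<lambda>(t, x). u t x)"
    and ini: "AE x in lebesgue_on dom_I. u 0 x = u0 x"
    and cut: "continuous_on ({0<..} \<times> {-1..1}) (\<lambda>(t, x). ut t x)"
    and cux: "continuous_on ({0<..} \<times> {-1..1}) (\<lambda>(t, x). ux t x)"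
    and ders: "\<forall>t>0. \<forall>x\<in>{-1..1}. ((\<lambda>s. u s x) has_real_derivative ut t x) (at t) \<and>
           ((\<lambda>y. u t y) has_real_derivative ux t x) (at x within {-1..1}) \<and>
           ((\<lambda>y. ux t y) has_real_derivative uxx t x) (at x within {-1..1})"
    and eq: "\<forall>t>0. \<forall>x\<in>dom_I. ut t x = deriv (deriv (\<lambda>y. \<delta> * u t y + (u t y)\<^sup>2 / 2)) x + r * u t x * (1 - u t x)"
    and bds: "\<forall>t>0. ux t (-1) = 0 \<and> ux t 1 = 0"
    by (elim conjE exE) blast
  have dt: "((\<lambda>s. u s x) has_real_derivative ut t x) (at t)"
    and dx: "(u t has_real_derivative ux t x) (at x within {-1..1})"
    and dxx: "(ux t has_real_derivative uxx t x) (at x within {-1..1})" if "t > 0" "x \<in> {-1..1}" for t x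
    using ders that by auto
  have bd: "ux t (-1) = 0" "ux t 1 = 0" if "t > 0" for t using bds that by auto
  have cu': "continuous_on ({0<..} \<times> {-1..1}) (\<lambda>(t, x). u t x)"
    by (rule continuous_on_subset[OF cu]) auto
  have cs: "continuous_on {-1..1} (u t)" "continuous_on {-1..1} (ux t)" "continuous_on {-1..1} (ut t)" if "t > 0" for t
    using continuous_on_time_slice[OF cu'] continuous_on_time_slice[OF cux] continuous_on_time_slice[OF cut] that by auto
  define B where "B t x = \<delta> * ux t x + u t x * ux t x" for t x
  have cB: "continuous_on {-1..1} (B t)" if "t > 0" for t
    unfolding B_def by (intro continuous_intros cs that)
  have dB: "(B t has_real_derivative ut t x - r * u t x * (1 - u t x)) (at x)" if t: "t > 0" and x: "x \<in> dom_I" for t x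
  proof -
    have int: "(u t has_real_derivative ux t y) (at y)" "(ux t has_real_derivative uxx t y) (at y)" if "y \<in> dom_I" for y
      using dx[OF t, of y] dxx[OF t, of y] that by (auto simp: at_within_Icc_at)
    have "((\<lambda>y. \<delta> * u t y + (u t y)\<^sup>2 / 2) has_real_derivative B t y) (at y)" if "y \<in> dom_I" for y
      unfolding B_def power2_eq_square using int(1)[OF that]
      by (auto intro!: derivative_eq_intros simp: field_simps)
    then have e: "deriv (\<lambda>y. \<delta> * u t y + (u t y)\<^sup>2 / 2) y = B t y" if "y \<in> dom_I" for y
      using that by (intro DERIV_imp_deriv)
    have D: "(B t has_real_derivative \<delta> * uxx t x + (ux t x * ux t x + uxx t x * u t x)) (at x)"
      unfolding B_def by (intro DERIV_add DERIV_cmult DERIV_mult int x)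
    have "(deriv (\<lambda>y. \<delta> * u t y + (u t y)\<^sup>2 / 2) has_real_derivative \<delta> * uxx t x + (ux t x * ux t x + uxx t x * u t x)) (at x)"
      by (rule has_field_derivative_transform_within_open[OF D open_greaterThanLessThan x]) (simp add: e)
    then have "deriv (deriv (\<lambda>y. \<delta> * u t y + (u t y)\<^sup>2 / 2)) x = \<delta> * uxx t x + (ux t x * ux t x + uxx t x * u t x)"
      by (rule DERIV_imp_deriv)
    with eq t x D show ?thesis by simp
  qed
  have I1: "integral {-1..x} (ut t) = B t x + integral {-1..x} (\<lambda>y. r * u t y * (1 - u t y))"
    if t: "t > 0" and x: "x \<in> {-1..1}" for t x
  proof -
    have sub: "{-1..x} \<subseteq> {-1..1}" using x by auto
    have "((\<lambda>y. ut t y - r * u t y * (1 - u t y)) has_integral B t x - B t (-1)) {-1..x}"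
    proof (rule fundamental_theorem_of_calculus_interior)
      show "continuous_on {-1..x} (B t)" by (rule continuous_on_subset[OF cB[OF t] sub])
      show "(B t has_vector_derivative ut t y - r * u t y * (1 - u t y)) (at y)" if "y \<in> {-1<..<x}" for y
        using dB[OF t, of y] that x by (simp add: has_real_derivative_iff_has_vector_derivative)
    qed (use x in auto)
    moreover have "((\<lambda>y. r * u t y * (1 - u t y)) has_integral integral {-1..x} (\<lambda>y. r * u t y * (1 - u t y))) {-1..x}"
      by (intro integrable_integral integrable_continuous_interval continuous_intros continuous_on_subset[OF cs(1)[OF t] sub])
    ultimately have "((\<lambda>y. ut t y - r * u t y * (1 - u t y) + r * u t y * (1 - u t y)) has_integral
        B t x - B t (-1) + integral {-1..x} (\<lambda>y. r * u t y * (1 - u t y))) {-1..x}"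
      by (rule has_integral_add)
    then show ?thesis using bd[OF t] by (simp add: integral_unique B_def)
  qed
  have I2: "integral {-1..1} (\<lambda>x. 2 * (u t x * ut t x)) =
      2 * (integral {-1..1} (\<lambda>x. r * (u t x)\<^sup>2 * (1 - u t x)) - integral {-1..1} (\<lambda>x. (\<delta> + u t x) * (ux t x)\<^sup>2))"
    if t: "t > 0" for t
  proof -
    have 1: "((\<lambda>x. ux t x * B t x + (ut t x - r * u t x * (1 - u t x)) * u t x) has_integral
        u t 1 * B t 1 - u t (-1) * B t (-1)) {-1..1}"
    proof (rule fundamental_theorem_of_calculus_interior)
      show "continuous_on {-1..1} (\<lambda>x. u t x * B t x)" by (intro continuous_intros cs cB t)
      show "((\<lambda>x. u t x * B t x) has_vector_derivative
          ux t x * B t x + (ut t x - r * u t x * (1 - u t x)) * u t x) (at x)" if "x \<in> {-1<..<1}" for x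
      proof -
        have "(u t has_real_derivative ux t x) (at x)" using dx[OF t, of x] that by (auto simp: at_within_Icc_at)
        from DERIV_mult[OF this dB[OF t that]] show ?thesis
          by (simp add: has_real_derivative_iff_has_vector_derivative)
      qed
    qed auto
    have 2: "((\<lambda>x. r * (u t x)\<^sup>2 * (1 - u t x) - (\<delta> + u t x) * (ux t x)\<^sup>2) has_integral
        integral {-1..1} (\<lambda>x. r * (u t x)\<^sup>2 * (1 - u t x)) - integral {-1..1} (\<lambda>x. (\<delta> + u t x) * (ux t x)\<^sup>2)) {-1..1}"
      by (intro has_integral_diff integrable_integral integrable_continuous_interval continuous_intros cs t)
    have "(\<lambda>x. 2 * ((ux t x * B t x + (ut t x - r * u t x * (1 - u t x)) * u t x)
        + (r * (u t x)\<^sup>2 * (1 - u t x) - (\<delta> + u t x) * (ux t x)\<^sup>2))) = (\<lambda>x. 2 * (u t x * ut t x))"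
      by (intro ext) (simp add: B_def power2_eq_square algebra_simps)
    with integral_unique[OF has_integral_mult_right[OF has_integral_add[OF 1 2], of 2]] bd[OF t] show ?thesis
      by (simp add: B_def)
  qed
  show thesis
  proof (rule that[OF cu ini cux dx bd])
    fix t x :: real assume t: "t > 0" and x: "x \<in> {-1..1}"
    have "((\<lambda>t. integral {-1..x} (u t)) has_real_derivative integral {-1..x} (ut t)) (at t)"
    proof (rule parametric_integral_derivative[OF dt _ _ t])
      show "continuous_on {-1..x} (u s)" if "s > 0" for s
        by (rule continuous_on_subset[OF cs(1)[OF that]]) (use x in auto)
      show "continuous_on ({0<..} \<times> {-1..x}) (\<lambda>(t, x). ut t x)"
        by (rule continuous_on_subset[OF cut]) (use x in auto)
    qed (use x in auto)
    then show "((\<lambda>t. integral {-1..x} (u t)) has_real_derivative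
        (\<delta> * ux t x + u t x * ux t x) + integral {-1..x} (\<lambda>y. r * u t y * (1 - u t y))) (at t)"
      using I1[OF t x] by (simp add: B_def)
  next
    fix t :: real assume t: "t > 0"
    have "((\<lambda>t. integral {-1..1} (\<lambda>x. (u t x)\<^sup>2)) has_real_derivative integral {-1..1} (\<lambda>x. 2 * (u t x * ut t x))) (at t)"
    proof (rule parametric_integral_derivative[OF _ _ _ t])
      show "((\<lambda>t. (u t x)\<^sup>2) has_real_derivative 2 * (u s x * ut s x)) (at s)" if "s > 0" "x \<in> {-1..1}" for s x
        unfolding power2_eq_square using DERIV_mult[OF dt[OF that] dt[OF that]] by (simp add: mult.commute)
      show "continuous_on {-1..1} (\<lambda>x. (u s x)\<^sup>2)" if "s > 0" for s by (intro continuous_intros cs that)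
      show "continuous_on ({0<..} \<times> {-1..1}) (\<lambda>(s, x). 2 * (u s x * ut s x))"
        using cu' cut unfolding case_prod_unfold by (intro continuous_intros)
    qed
    then show "((\<lambda>t. integral {-1..1} (\<lambda>x. (u t x)\<^sup>2)) has_real_derivative
        2 * (integral {-1..1} (\<lambda>x. r * (u t x)\<^sup>2 * (1 - u t x)) - integral {-1..1} (\<lambda>x. (\<delta> + u t x) * (ux t x)\<^sup>2))) (at t)"
      by (simp only: I2[OF t])
  qed auto
qed

text \<open>
  The bound is uniform as \<open>s \<rightarrow> 0\<close>, although \<open>u\<^sub>x\<close>
  may be unbounded there: the energy at time \<open>s\<close> is controlled by the supremum of
  \<open>u\<close>.
\<close>

lemma limit_solution_gradient_bound:
  fixes u ux :: "real \<Rightarrow> real \<Rightarrow> real"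
  assumes \<delta>: "\<delta> > 0" and r: "r \<ge> 0"
    and cu: "continuous_on ({0<..} \<times> {-1..1}) (\<lambda>(t, x). u t x)"
    and cux: "continuous_on ({0<..} \<times> {-1..1}) (\<lambda>(t, x). ux t x)"
    and energy: "\<And>t. t > 0 \<Longrightarrow> ((\<lambda>t. integral {-1..1} (\<lambda>x. (u t x)\<^sup>2)) has_real_derivative
        2 * (integral {-1..1} (\<lambda>x. r * (u t x)\<^sup>2 * (1 - u t x)) - integral {-1..1} (\<lambda>x. (\<delta> + u t x) * (ux t x)\<^sup>2))) (at t)"
    and M: "\<And>t x. 0 < t \<Longrightarrow> t \<le> T \<Longrightarrow> x \<in> {-1..1} \<Longrightarrow> 0 \<le> u t x \<and> u t x \<le> M"
    and st: "0 < s" "s \<le> t" "t \<le> T"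
  shows "integral {s..t} (\<lambda>t. integral {-1..1} (\<lambda>x. (ux t x)\<^sup>2)) \<le> (M\<^sup>2 + 2 * r * M\<^sup>2 * T) / \<delta>"
proof -
  define h where "h t = integral {-1..1} (\<lambda>x. (ux t x)\<^sup>2)" for t
  define e where "e t = integral {-1..1} (\<lambda>x. (u t x)\<^sup>2)" for t
  have cs: "continuous_on {-1..1} (u t)" "continuous_on {-1..1} (ux t)" if "t > 0" for t
    using continuous_on_time_slice[OF cu] continuous_on_time_slice[OF cux] that by auto
  have "continuous_on {0<..} h" unfolding h_def
    by (rule continuous_on_param_integral) (use cux in \<open>auto simp: case_prod_unfold intro!: continuous_intros\<close>)
  then have ch: "continuous_on {s..t} h" by (rule continuous_on_subset) (use st in auto)
  have e0: "0 \<le> e t" "e t \<le> 2 * M\<^sup>2" if "0 < t" "t \<le> T" for t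
  proof -
    show "0 \<le> e t" unfolding e_def
      by (intro integral_nonneg integrable_continuous_interval continuous_intros cs that) auto
    have "e t \<le> integral {-1..1::real} (\<lambda>x. M\<^sup>2)" unfolding e_def
      by (intro Henstock_Kurzweil_Integration.integral_le integrable_continuous_interval continuous_intros cs that)
         (use M[OF that] in \<open>auto intro: power_mono\<close>)
    then show "e t \<le> 2 * M\<^sup>2" by simp
  qed
  define E where "E \<tau> = e \<tau> + 2 * \<delta> * integral {s..\<tau>} h - 4 * r * M\<^sup>2 * (\<tau> - s)" for \<tau>
  have de: "(e has_real_derivative 2 * (integral {-1..1} (\<lambda>x. r * (u t x)\<^sup>2 * (1 - u t x))
      - integral {-1..1} (\<lambda>x. (\<delta> + u t x) * (ux t x)\<^sup>2))) (at t)" if "t > 0" for t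
    using energy[OF that] by (simp add: e_def[abs_def])
  have "E t \<le> E s"
  proof (rule DERIV_nonpos_imp_decreasing_open[OF st(2)])
    fix \<tau> assume \<tau>: "s < \<tau>" "\<tau> < t"
    have \<tau>0: "0 < \<tau>" "\<tau> \<le> T" using \<tau> st by auto
    let ?d = "2 * (integral {-1..1} (\<lambda>x. r * (u \<tau> x)\<^sup>2 * (1 - u \<tau> x)) - integral {-1..1} (\<lambda>x. (\<delta> + u \<tau> x) * (ux \<tau> x)\<^sup>2))
      + 2 * \<delta> * h \<tau> - 4 * r * M\<^sup>2 * (1 - 0)"
    have "((\<lambda>\<tau>. integral {s..\<tau>} h) has_real_derivative h \<tau>) (at \<tau>)"
      using integral_has_real_derivative[OF ch, of \<tau>] \<tau> by (simp add: at_within_Icc_at)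
    then have D: "(E has_real_derivative ?d) (at \<tau>)" unfolding E_def
      by (intro DERIV_diff DERIV_add DERIV_cmult de \<tau>0 DERIV_ident DERIV_const)
    have "integral {-1..1} (\<lambda>x. r * (u \<tau> x)\<^sup>2 * (1 - u \<tau> x)) \<le> integral {-1..1::real} (\<lambda>x. r * M\<^sup>2)"
    proof (intro Henstock_Kurzweil_Integration.integral_le integrable_continuous_interval continuous_intros cs \<tau>0)
      fix x :: real assume x: "x \<in> {-1..1}"
      have "(u \<tau> x)\<^sup>2 * (1 - u \<tau> x) \<le> (u \<tau> x)\<^sup>2 * 1"
        using M[OF \<tau>0 x] by (intro mult_left_mono) auto
      also have "\<dots> \<le> M\<^sup>2 * 1" using M[OF \<tau>0 x] by (intro mult_right_mono power_mono) auto
      finally have "(u \<tau> x)\<^sup>2 * (1 - u \<tau> x) \<le> M\<^sup>2 * 1" .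
      then have "r * ((u \<tau> x)\<^sup>2 * (1 - u \<tau> x)) \<le> r * (M\<^sup>2 * 1)" using r by (rule mult_left_mono)
      then show "r * (u \<tau> x)\<^sup>2 * (1 - u \<tau> x) \<le> r * M\<^sup>2" by (simp add: mult.assoc)
    qed
    moreover have "\<delta> * h \<tau> \<le> integral {-1..1} (\<lambda>x. (\<delta> + u \<tau> x) * (ux \<tau> x)\<^sup>2)"
    proof -
      have "\<delta> * h \<tau> = integral {-1..1} (\<lambda>x. \<delta> * (ux \<tau> x)\<^sup>2)" by (simp add: h_def)
      also have "\<dots> \<le> integral {-1..1} (\<lambda>x. (\<delta> + u \<tau> x) * (ux \<tau> x)\<^sup>2)"
        by (intro Henstock_Kurzweil_Integration.integral_le integrable_continuous_interval continuous_intros cs \<tau>0)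
           (use M[OF \<tau>0] in \<open>auto intro!: mult_right_mono\<close>)
      finally show ?thesis .
    qed
    ultimately have "?d \<le> 0" by simp
    with D show "\<exists>d. (E has_real_derivative d) (at \<tau>) \<and> d \<le> 0" by blast
  next
    have "continuous_on {s..t} e"
      by (intro continuous_at_imp_continuous_on ballI DERIV_isCont[OF de]) (use st in auto)
    then show "continuous_on {s..t} E" unfolding E_def
      by (intro continuous_intros indefinite_integral_continuous_1 integrable_continuous_interval ch)
  qed
  then have "2 * \<delta> * integral {s..t} h \<le> e s - e t + 4 * r * M\<^sup>2 * (t - s)" by (simp add: E_def)
  also have "\<dots> \<le> 2 * M\<^sup>2 + 4 * r * M\<^sup>2 * T"
    using e0[of s] e0[of t] st r by (intro add_mono mult_left_mono) auto
  finally have "\<delta> * integral {s..t} h \<le> M\<^sup>2 + 2 * r * M\<^sup>2 * T" by simp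
  then show ?thesis using \<delta> unfolding h_def by (simp add: field_simps)
qed

section \<open>Convergence\<close>

lemma L2_norm_diff_sq:
  assumes "L2 f" "L2 g"
  shows "(L2_norm (\<lambda>x. f x - g x))\<^sup>2 \<le> 2 * (L2_norm f)\<^sup>2 + 2 * (L2_norm g)\<^sup>2"
proof -
  have s: "(L2_norm h)\<^sup>2 = (LINT x|lebesgue_on dom_I. (h x)\<^sup>2)" for h
    by (simp add: L2_norm_def Bochner_Integration.integral_nonneg)
  have i: "integrable (lebesgue_on dom_I) (\<lambda>x. (f x)\<^sup>2)" "integrable (lebesgue_on dom_I) (\<lambda>x. (g x)\<^sup>2)"
    "integrable (lebesgue_on dom_I) (\<lambda>x. (f x - g x)\<^sup>2)"
    using assms L2_diff[OF assms] by (auto simp: L2_def)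
  have "(LINT x|lebesgue_on dom_I. (f x - g x)\<^sup>2) \<le> (LINT x|lebesgue_on dom_I. 2 * (f x)\<^sup>2 + 2 * (g x)\<^sup>2)"
  proof (rule integral_mono)
    fix x show "(f x - g x)\<^sup>2 \<le> 2 * (f x)\<^sup>2 + 2 * (g x)\<^sup>2"
      using zero_le_power2[of "f x + g x"] by (simp add: power2_eq_square algebra_simps)
  qed (use i in auto)
  also have "\<dots> = 2 * (LINT x|lebesgue_on dom_I. (f x)\<^sup>2) + 2 * (LINT x|lebesgue_on dom_I. (g x)\<^sup>2)"
    using i by simp
  finally show ?thesis by (simp add: s)
qed

text \<open>
  The threshold \<open>\<epsilon>0\<close> makes the bound produced by the continuation argument
  smaller than \<open>\<kappa>\<^sup>2\<close>, the size of \<open>y\<close> up to which the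
  dissipation inequality holds. All constants come from \<open>u\<close>, so they are chosen
  before \<open>\<epsilon>\<close>.
\<close>

lemma convergence_rate:
  assumes \<delta>: "\<delta> > 0" and r: "r \<ge> 0" and T: "T > 0"
    and lim: "limit_solution \<delta> r u0 u" and u0: "\<And>t x. t \<ge> 0 \<Longrightarrow> x \<in> {-1..1} \<Longrightarrow> u t x \<ge> 0"
  shows "\<exists>C \<epsilon>0. \<epsilon>0 > 0 \<and> (\<forall>\<epsilon> v. 0 < \<epsilon> \<longrightarrow> \<epsilon> < \<epsilon>0 \<longrightarrow> strong_solution \<delta> r \<epsilon> \<infinity> u0 v \<longrightarrow>
     (\<forall>t\<ge>0. AE x in lebesgue_on dom_I. v t x \<ge> 0) \<longrightarrow>
     (LINT t:{0..T}|lebesgue. (L2_norm (\<lambda>x. v t x - u t x))\<^sup>2) \<le> C * \<epsilon>)"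
proof -
  obtain ux where
    cu: "continuous_on ({0..} \<times> {-1..1}) (\<lambda>(t, x). u t x)"
    and ini: "AE x in lebesgue_on dom_I. u 0 x = u0 x"
    and cux: "continuous_on ({0<..} \<times> {-1..1}) (\<lambda>(t, x). ux t x)"
    and dux: "\<And>t x. t > 0 \<Longrightarrow> x \<in> {-1..1} \<Longrightarrow> (u t has_real_derivative ux t x) (at x within {-1..1})"
    and uxb: "\<And>t. t > 0 \<Longrightarrow> ux t (-1) = 0" "\<And>t. t > 0 \<Longrightarrow> ux t 1 = 0"
    and du: "\<And>t x. t > 0 \<Longrightarrow> x \<in> {-1..1} \<Longrightarrow> ((\<lambda>t. integral {-1..x} (u t)) has_real_derivative
        (\<delta> * ux t x + u t x * ux t x) + integral {-1..x} (\<lambda>y. r * u t y * (1 - u t y))) (at t)"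
    and energy: "\<And>t. t > 0 \<Longrightarrow> ((\<lambda>t. integral {-1..1} (\<lambda>x. (u t x)\<^sup>2)) has_real_derivative
        2 * (integral {-1..1} (\<lambda>x. r * (u t x)\<^sup>2 * (1 - u t x)) - integral {-1..1} (\<lambda>x. (\<delta> + u t x) * (ux t x)\<^sup>2))) (at t)"
    by (rule limit_solution_classical[OF lim]) blast
  have cu': "continuous_on ({0<..} \<times> {-1..1}) (\<lambda>(t, x). u t x)"
    by (rule continuous_on_subset[OF cu]) auto
  have csu: "continuous_on {-1..1} (u t)" if "t \<ge> 0" for t using continuous_on_time_slice[OF cu] that by auto
  have csux: "continuous_on {-1..1} (ux t)" if "t > 0" for t using continuous_on_time_slice[OF cux] that by auto
  have "continuous_on ({0..T} \<times> {-1..1}) (\<lambda>(t, x). u t x)" by (rule continuous_on_subset[OF cu]) auto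
  from bounded_on_slab[OF this] obtain M where M': "\<forall>t\<in>{0..T}. \<forall>x\<in>{-1..1}. \<bar>u t x\<bar> \<le> M" ..
  have M: "\<bar>u t x\<bar> \<le> M" if "0 \<le> t" "t \<le> T" "x \<in> {-1..1}" for t x
    using M' that by simp
  have M0: "M \<ge> 0" using M[of 0 0] T by simp
  define h where "h t = integral {-1..1} (\<lambda>x. (ux t x)\<^sup>2)" for t
  define H where "H = (M\<^sup>2 + 2 * r * M\<^sup>2 * T) / \<delta>"
  have hH: "integral {s..t} h \<le> H" if "0 < s" "s \<le> t" "t \<le> T" for s t
    unfolding h_def H_def
  proof (rule limit_solution_gradient_bound[OF \<delta> r cu' cux energy _ that])
    show "0 \<le> u t x \<and> u t x \<le> M" if "0 < t" "t \<le> T" "x \<in> {-1..1}" for t x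
      using u0[of t x] M[of t x] that by auto
  qed
  have ch: "continuous_on {0<..} h" unfolding h_def
    by (rule continuous_on_param_integral) (use cux in \<open>auto simp: case_prod_unfold intro!: continuous_intros\<close>)
  have h0: "h t \<ge> 0" if "t > 0" for t unfolding h_def
    by (intro integral_nonneg integrable_continuous_interval continuous_intros csux that) auto
  \<comment> \<open>Smallness of \<open>\<surd>y\<close> that makes a quarter of the dissipation dominate the terms cubic in \<open>z\<close>.\<close>
  define \<kappa> where "\<kappa> = min 1 (\<delta> / (1 + 16 * r))"
  have \<kappa>: "\<kappa> > 0" "\<kappa> \<le> 1" "\<kappa> * (1 / 4 + 4 * r) \<le> \<delta> / 4"
  proof -
    show "\<kappa> > 0" "\<kappa> \<le> 1" using \<delta> r by (auto simp: \<kappa>_def)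
    have "\<kappa> * (1 + 16 * r) \<le> (\<delta> / (1 + 16 * r)) * (1 + 16 * r)"
      using r by (intro mult_right_mono) (auto simp: \<kappa>_def)
    also have "\<dots> = \<delta>" using r by simp
    finally show "\<kappa> * (1 / 4 + 4 * r) \<le> \<delta> / 4" by (simp add: algebra_simps)
  qed
  define a C where "a = M + 1 / 2 + \<delta> / 4" and "C = \<delta> + 2 * M\<^sup>2 / \<delta> + 128 * (r * (1 + 2 * M))\<^sup>2 / \<delta>"
  have aC: "a \<ge> 0" "C \<ge> 0" using M0 \<delta> by (auto simp: a_def C_def)
  have H0: "H \<ge> 0" using r T \<delta> by (simp add: H_def)
  define B where "B = exp (C * T) * (a * H)"
  have B0: "B \<ge> 0" using aC H0 by (simp add: B_def)
  have main: "(LINT t:{0..T}|lebesgue. (L2_norm (\<lambda>x. v t x - u t x))\<^sup>2) \<le> B / \<delta> * \<epsilon>"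
    if eps: "\<epsilon> > 0" "\<epsilon> < \<kappa>\<^sup>2 / (B + 1)" and sol: "strong_solution \<delta> r \<epsilon> \<infinity> u0 v"
      and nonneg: "\<And>t. t \<ge> 0 \<Longrightarrow> AE x in lebesgue_on dom_I. v t x \<ge> 0" for \<epsilon> v
  proof -
    obtain V VX P W where
      cV: "continuous_on ({0<..} \<times> {-1..1}) (\<lambda>(t, x). V t x)"
      and cVX: "continuous_on ({0<..} \<times> {-1..1}) (\<lambda>(t, x). VX t x)"
      and cP: "continuous_on ({0<..} \<times> {-1..1}) (\<lambda>(t, x). P t x)"
      and vV: "\<And>t. t > 0 \<Longrightarrow> AE x in lebesgue_on dom_I. v t x = V t x"
      and dV: "\<And>t x. t > 0 \<Longrightarrow> x \<in> {-1..1} \<Longrightarrow> (V t has_real_derivative VX t x) (at x within {-1..1})"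
      and dP: "\<And>t x. t > 0 \<Longrightarrow> x \<in> {-1..1} \<Longrightarrow> (P t has_real_derivative (V t x - W t x) / \<epsilon>) (at x within {-1..1})"
      and dW: "\<And>t x. t > 0 \<Longrightarrow> x \<in> {-1..1} \<Longrightarrow> (W t has_real_derivative - P t x) (at x within {-1..1})"
      and Pb: "\<And>t. t > 0 \<Longrightarrow> P t (-1) = 0" "\<And>t. t > 0 \<Longrightarrow> P t 1 = 0"
      and VXb: "\<And>t. t > 0 \<Longrightarrow> VX t (-1) = 0" "\<And>t. t > 0 \<Longrightarrow> VX t 1 = 0"
      and W0: "\<And>t x. t > 0 \<Longrightarrow> x \<in> {-1..1} \<Longrightarrow> W t x \<ge> 0"
      and L2v: "\<And>t. t \<ge> 0 \<Longrightarrow> L2 (v t)"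
      and iniv: "AE x in lebesgue_on dom_I. v 0 x = u0 x"
      and lim0: "((\<lambda>t. L2_norm (\<lambda>x. v t x - v 0 x)) \<longlongrightarrow> 0) (at_right 0)"
      and dKV: "\<And>t x. t > 0 \<Longrightarrow> x \<in> {-1..1} \<Longrightarrow> ((\<lambda>t. integral {-1..x} (V t)) has_real_derivative
        (\<delta> * VX t x - V t x * P t x) + integral {-1..x} (\<lambda>y. r * V t y * (1 - V t y))) (at t)"
      by (rule strong_solution_classical[OF eps(1) sol nonneg]) blast+
    have csV: "continuous_on {-1..1} (V t)" "continuous_on {-1..1} (VX t)" if "t > 0" for t
      using continuous_on_time_slice[OF cV] continuous_on_time_slice[OF cVX] that by auto
    \<comment> \<open>The quantities attached to a fixed time, as functions of time; \<open>F\<close> is the time derivative of \<open>K\<close>.\<close>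
    define z where "z t x = V t x - u t x" for t x
    define K where "K t x = integral {-1..x} (z t)" for t x
    define R where "R t x = r * z t x * (1 - V t x - u t x)" for t x
    define F where "F t x = \<delta> * (VX t x - ux t x) - V t x * P t x - u t x * ux t x + integral {-1..x} (R t)" for t x
    define Zt where "Zt t x = K t x - (x + 1) / 2 * K t 1" for t x
    define y where "y t = integral {-1..1} (\<lambda>x. (Zt t x)\<^sup>2) + (K t 1)\<^sup>2" for t
    define y' where "y' t = 2 * (integral {-1..1} (\<lambda>x. Zt t x * (F t x - (x + 1) / 2 * F t 1)) + K t 1 * F t 1)" for t
    define Z where "Z t = integral {-1..1} (\<lambda>x. (z t x)\<^sup>2)" for t
    have cz: "continuous_on ({0<..} \<times> {-1..1}) (\<lambda>(t, x). z t x)"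
      using cV cu' unfolding z_def case_prod_unfold by (intro continuous_intros)
    have csz: "continuous_on {-1..1} (z t)" if "t > 0" for t using continuous_on_time_slice[OF cz] that by auto
    have cK: "continuous_on ({0<..} \<times> {-1..1}) (\<lambda>(t, x). K t x)"
      unfolding K_def by (rule continuous_on_primitive[OF cz])
    have cR: "continuous_on ({0<..} \<times> {-1..1}) (\<lambda>(t, x). R t x)"
      using cV cu' cz unfolding R_def case_prod_unfold by (intro continuous_intros)
    have cF: "continuous_on ({0<..} \<times> {-1..1}) (\<lambda>(t, x). F t x)"
      using cV cu' cVX cux cP continuous_on_primitive[OF cR] unfolding F_def case_prod_unfold by (intro continuous_intros)
    have dK: "((\<lambda>t. K t x) has_real_derivative F t x) (at t)" if t: "t > 0" and x: "x \<in> {-1..1}" for t x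
    proof -
      have sub: "{-1..x} \<subseteq> {-1..1}" using x by auto
      have i: "f integrable_on {-1..x}" if "continuous_on {-1..1} f" for f :: "real \<Rightarrow> real"
        by (rule integrable_continuous_interval[OF continuous_on_subset[OF that sub]])
      have "integral {-1..x} (R t) = integral {-1..x} (\<lambda>y. r * V t y * (1 - V t y) - r * u t y * (1 - u t y))"
        by (rule arg_cong[where f = "integral _"]) (auto simp: R_def z_def algebra_simps)
      also have "\<dots> = integral {-1..x} (\<lambda>y. r * V t y * (1 - V t y)) - integral {-1..x} (\<lambda>y. r * u t y * (1 - u t y))"
        by (intro Henstock_Kurzweil_Integration.integral_diff i continuous_intros csV csu) (use t in auto)
      finally have "F t x = ((\<delta> * VX t x - V t x * P t x) + integral {-1..x} (\<lambda>y. r * V t y * (1 - V t y)))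
          - ((\<delta> * ux t x + u t x * ux t x) + integral {-1..x} (\<lambda>y. r * u t y * (1 - u t y)))"
        unfolding F_def by (simp add: algebra_simps)
      with DERIV_diff[OF dKV[OF t x] du[OF t x]]
      have D: "((\<lambda>t. integral {-1..x} (V t) - integral {-1..x} (u t)) has_real_derivative F t x) (at t)"
        by (simp only:)
      show ?thesis
      proof (rule has_field_derivative_transform_within_open[OF D, of "{0<..}"])
        fix s :: real assume "s \<in> {0<..}"
        then have s: "s > 0" by simp
        show "integral {-1..x} (V s) - integral {-1..x} (u s) = K s x"
          unfolding K_def z_def
          by (intro Henstock_Kurzweil_Integration.integral_diff[symmetric] i csV csu) (use s in auto)
      qed (use t in auto)
    qed
    have cK1: "continuous_on ({0<..} \<times> {-1..1::real}) (\<lambda>p. K (fst p) 1)"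
      by (rule continuous_on_compose2[OF continuous_on_section[OF cK]]) (auto intro!: continuous_intros)
    have cF1: "continuous_on ({0<..} \<times> {-1..1::real}) (\<lambda>p. F (fst p) 1)"
      by (rule continuous_on_compose2[OF continuous_on_section[OF cF]]) (auto intro!: continuous_intros)
    have cZt: "continuous_on ({0<..} \<times> {-1..1}) (\<lambda>(t, x). Zt t x)"
      using cK cK1 unfolding Zt_def case_prod_unfold by (intro continuous_intros) auto
    have csZt: "continuous_on {-1..1} (Zt t)" if "t > 0" for t using continuous_on_time_slice[OF cZt] that by auto
    have dy: "(y has_real_derivative y' t) (at t)" if t: "t > 0" for t
    proof -
      have dZt: "((\<lambda>t. Zt t x) has_real_derivative F s x - (x + 1) / 2 * F s 1) (at s)" if "s > 0" "x \<in> {-1..1}" for s x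
        unfolding Zt_def by (intro DERIV_diff DERIV_cmult dK that) auto
      have "((\<lambda>t. integral {-1..1} (\<lambda>x. (Zt t x)\<^sup>2)) has_real_derivative
          integral {-1..1} (\<lambda>x. 2 * (Zt t x * (F t x - (x + 1) / 2 * F t 1)))) (at t)"
      proof (rule parametric_integral_derivative[OF _ _ _ t])
        show "((\<lambda>t. (Zt t x)\<^sup>2) has_real_derivative 2 * (Zt s x * (F s x - (x + 1) / 2 * F s 1))) (at s)"
          if "s > 0" "x \<in> {-1..1}" for s x
          unfolding power2_eq_square using DERIV_mult[OF dZt[OF that] dZt[OF that]] by (simp add: mult.commute)
        show "continuous_on {-1..1} (\<lambda>x. (Zt s x)\<^sup>2)" if "s > 0" for s by (intro continuous_intros csZt that)
        show "continuous_on ({0<..} \<times> {-1..1}) (\<lambda>(s, x). 2 * (Zt s x * (F s x - (x + 1) / 2 * F s 1)))"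
          using cZt cF cF1 unfolding case_prod_unfold by (intro continuous_intros) auto
      qed
      moreover have "((\<lambda>t. (K t 1)\<^sup>2) has_real_derivative 2 * (K t 1 * F t 1)) (at t)"
        unfolding power2_eq_square using DERIV_mult[OF dK[OF t, of 1] dK[OF t, of 1]] by (simp add: mult.commute)
      ultimately have "((\<lambda>t. integral {-1..1} (\<lambda>x. (Zt t x)\<^sup>2) + (K t 1)\<^sup>2) has_real_derivative
          integral {-1..1} (\<lambda>x. 2 * (Zt t x * (F t x - (x + 1) / 2 * F t 1))) + 2 * (K t 1 * F t 1)) (at t)"
        by (rule DERIV_add)
      then show ?thesis by (simp add: y_def[abs_def] y'_def)
    qed
    have slice: "energy_slice \<epsilon> M (V t) (VX t) (u t) (ux t) (P t) (W t)" if "0 < t" "t \<le> T" for t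
    proof
      show "0 \<le> u t x" "u t x \<le> M" if "x \<in> {-1..1}" for x
        using u0[of t x] M[of t x] that \<open>0 < t\<close> \<open>t \<le> T\<close> by auto
    qed (use that eps dV dux dP dW Pb VXb uxb csV csux W0 in auto)
    have S: "energy_slice.z (V t) (u t) = z t" "energy_slice.m (V t) (u t) = K t 1"
      "energy_slice.Zt (V t) (u t) = Zt t" "energy_slice.y (V t) (u t) = y t"
      "energy_slice.flux (V t) (VX t) (u t) (ux t) (P t) \<delta> r = F t" if "0 < t" "t \<le> T" for t
    proof -
      note sl = slice[OF that]
      show 1: "energy_slice.z (V t) (u t) = z t"
        by (simp add: fun_eq_iff z_def energy_slice.z_def[OF sl])
      show 2: "energy_slice.m (V t) (u t) = K t 1"
        by (simp add: energy_slice.m_def[OF sl] 1 K_def)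
      show 3: "energy_slice.Zt (V t) (u t) = Zt t"
        by (simp add: fun_eq_iff Zt_def energy_slice.Zt_def[OF sl] 1 2 K_def)
      show "energy_slice.y (V t) (u t) = y t"
        by (simp add: y_def energy_slice.y_def[OF sl] 2 3)
      show "energy_slice.flux (V t) (VX t) (u t) (ux t) (P t) \<delta> r = F t"
        by (simp add: fun_eq_iff energy_slice.flux_def[OF sl] energy_slice.reac_def[OF sl] F_def 1 R_def[abs_def])
    qed
    \<comment> \<open>The dissipation inequality, available below the threshold \<open>\<kappa>\<^sup>2\<close> only.\<close>
    have ineq: "y' t \<le> - \<delta> * Z t + (a * \<epsilon>) * h t + C * y t" if t: "0 < t" "t \<le> T" and le: "y t \<le> \<kappa>\<^sup>2" for t
    proof -
      interpret E: energy_slice \<epsilon> M "V t" "VX t" "u t" "ux t" "P t" "W t" by (rule slice[OF t])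
      have "sqrt (y t) \<le> \<kappa>" using le \<kappa>(1) by (simp add: real_le_lsqrt E.y_nonneg[unfolded S[OF t]])
      from E.dissipation[OF \<delta> r, unfolded S[OF t], OF this \<kappa>(2,3)] show ?thesis
        by (simp add: y'_def Z_def h_def a_def C_def)
    qed
    have L2u: "L2 (u t)" if "t \<ge> 0" for t by (rule L2_continuous[OF csu[OF that]])
    define f where "f t = (L2_norm (\<lambda>x. v t x - u t x))\<^sup>2" for t
    \<comment> \<open>The integrand of the claim, which only at positive times is given by the regular representatives.\<close>
    have fZ: "f t = Z t" if t: "t > 0" for t
      unfolding f_def Z_def
    proof (rule L2_norm_continuous[OF csz[OF t]])
      show "AE x in lebesgue_on dom_I. v t x - u t x = z t x" using vV[OF t] by eventually_elim (simp add: z_def)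
      show "(\<lambda>x. v t x - u t x) \<in> borel_measurable (lebesgue_on dom_I)"
        using L2_diff[OF L2v L2u, of t t] t by (simp add: L2_def)
    qed
    have f0: "f 0 = 0"
    proof -
      have "AE x in lebesgue_on dom_I. (0::real) = v 0 x - u 0 x" using iniv ini by eventually_elim simp
      from L2_cong_AE(2)[OF _ this] show ?thesis
        using L2_continuous[of "\<lambda>x. 0"] by (simp add: f_def L2_norm_def)
    qed
    have f_lim: "(f \<longlongrightarrow> 0) (at_right 0)"
    proof -
      \<comment> \<open>Both solutions start at \<open>u0\<close>, so the distance is compared with their increments from time \<open>0\<close>.\<close>
      define d where "d t = integral {-1..1} (\<lambda>x. (u t x - u 0 x)\<^sup>2)" for t
      have "continuous_on {0..} d" unfolding d_def
      proof (rule continuous_on_param_integral)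
        have "continuous_on ({0..} \<times> {-1..1}) (\<lambda>p. u 0 (snd p))"
          by (rule continuous_on_compose2[OF csu[of 0]]) (auto intro!: continuous_intros)
        then show "continuous_on ({0..} \<times> {-1..1}) (\<lambda>(t, x). (u t x - u 0 x)\<^sup>2)"
          using cu unfolding case_prod_unfold by (intro continuous_intros)
      qed
      then have "(d \<longlongrightarrow> d 0) (at 0 within {0..})" by (simp add: continuous_on_def)
      then have d0: "(d \<longlongrightarrow> 0) (at_right 0)" by (rule tendsto_within_subset[THEN tendsto_eq_rhs]) (auto simp: d_def)
      show ?thesis
      proof (rule tendsto_sandwich[OF _ _ tendsto_const])
        show "eventually (\<lambda>t. f t \<le> 2 * (L2_norm (\<lambda>x. v t x - v 0 x))\<^sup>2 + 2 * d t) (at_right 0)"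
          unfolding eventually_at_filter
        proof (intro always_eventually allI impI)
          fix t :: real assume "t \<in> {0<..}"
          then have t: "t \<ge> 0" by simp
          have l: "L2 (\<lambda>x. v t x - v 0 x)" "L2 (\<lambda>x. u t x - u 0 x)"
            using L2_diff[OF L2v L2v] L2_diff[OF L2u L2u] t by auto
          have "AE x in lebesgue_on dom_I. (v t x - v 0 x) - (u t x - u 0 x) = v t x - u t x"
            using iniv ini by eventually_elim simp
          from L2_cong_AE(2)[OF L2_diff[OF l] this]
          have "f t = (L2_norm (\<lambda>x. (v t x - v 0 x) - (u t x - u 0 x)))\<^sup>2" by (simp add: f_def)
          also have "\<dots> \<le> 2 * (L2_norm (\<lambda>x. v t x - v 0 x))\<^sup>2 + 2 * (L2_norm (\<lambda>x. u t x - u 0 x))\<^sup>2"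
            by (rule L2_norm_diff_sq[OF l])
          also have "(L2_norm (\<lambda>x. u t x - u 0 x))\<^sup>2 = d t" unfolding d_def
            by (rule L2_norm_continuous) (use l csu t in \<open>auto simp: L2_def intro!: continuous_intros\<close>)
          finally show "f t \<le> 2 * (L2_norm (\<lambda>x. v t x - v 0 x))\<^sup>2 + 2 * d t" .
        qed
        have "((\<lambda>t. 2 * (L2_norm (\<lambda>x. v t x - v 0 x))\<^sup>2 + 2 * d t) \<longlongrightarrow> 2 * 0\<^sup>2 + 2 * 0) (at_right 0)"
          by (intro tendsto_intros lim0 d0)
        then show "((\<lambda>t. 2 * (L2_norm (\<lambda>x. v t x - v 0 x))\<^sup>2 + 2 * d t) \<longlongrightarrow> 0) (at_right 0)" by simp
      qed (simp add: f_def)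
    qed
    have y0: "y t \<ge> 0" if "t > 0" for t unfolding y_def
      by (intro add_nonneg_nonneg integral_nonneg integrable_continuous_interval continuous_intros csZt that) auto
    have y_lim: "(y \<longlongrightarrow> 0) (at_right 0)"
    proof (rule tendsto_sandwich[OF _ _ tendsto_const])
      show "eventually (\<lambda>t. y t \<le> 18 * f t) (at_right 0)"
        unfolding eventually_at_right_field
      proof (intro exI[of _ T] conjI allI impI T)
        fix t assume t: "0 < t" "t < T"
        then have "t \<le> T" by simp
        interpret E: energy_slice \<epsilon> M "V t" "VX t" "u t" "ux t" "P t" "W t" by (rule slice) (use t in auto)
        from E.y_le_L2[unfolded S[OF t(1) \<open>t \<le> T\<close>]] show "y t \<le> 18 * f t" by (simp add: fZ t Z_def)
      qed
      show "eventually (\<lambda>t. 0 \<le> y t) (at_right 0)"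
        unfolding eventually_at_filter using y0 by (auto intro: always_eventually)
      show "((\<lambda>t. 18 * f t) \<longlongrightarrow> 0) (at_right 0)" using tendsto_mult_right_zero[OF f_lim] by simp
    qed
    have cZ: "continuous_on {0<..} Z" unfolding Z_def
      by (rule continuous_on_param_integral) (use cz in \<open>auto simp: case_prod_unfold intro!: continuous_intros\<close>)
    have Z0: "Z t \<ge> 0" if "t > 0" for t unfolding Z_def
      by (intro integral_nonneg integrable_continuous_interval continuous_intros csz that) auto
    have small: "exp (C * T) * ((a * \<epsilon>) * H) < \<kappa>\<^sup>2"
    proof -
      have "exp (C * T) * ((a * \<epsilon>) * H) = B * \<epsilon>" by (simp add: B_def mult_ac)
      also have "\<dots> \<le> (B + 1) * \<epsilon>" using eps by (intro mult_right_mono) auto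
      also have "\<dots> < \<kappa>\<^sup>2" using eps(2) B0 by (simp add: field_simps)
      finally show ?thesis .
    qed
    have bound: "integral {s..T} f \<le> B / \<delta> * \<epsilon>" if s: "0 < s" "s \<le> T" for s
    proof -
      have "\<delta> * integral {s..T} Z \<le> exp (C * T) * ((a * \<epsilon>) * H)"
        by (rule gronwall_bootstrap[OF T aC(2) _ _ dy y_lim y0 cZ Z0 ch h0 ineq hH small s])
           (use \<delta> aC eps in auto)
      then have "integral {s..T} Z \<le> B / \<delta> * \<epsilon>" using \<delta> by (simp add: B_def field_simps)
      moreover have "integral {s..T} f = integral {s..T} Z"
        by (intro Henstock_Kurzweil_Integration.integral_cong fZ) (use s in auto)
      ultimately show ?thesis by simp
    qed
    have cf: "continuous_on {0..T} f"
      unfolding continuous_on_eq_continuous_within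
    proof
      fix t assume t: "t \<in> {0..T}"
      show "continuous (at t within {0..T}) f"
      proof (cases "t = 0")
        case True
        have "(f \<longlongrightarrow> 0) (at 0 within {0..T})"
        proof (rule filterlim_mono[OF f_lim order_refl])
          have "{0..T} - {0} \<subseteq> {0<..} - {0}" by auto
          then show "at 0 within {0..T} \<le> at_right 0"
            unfolding at_within_def by (intro inf_mono order_refl) simp
        qed
        with True f0 show ?thesis by (simp add: continuous_within)
      next
        case False
        with t have "t > 0" by simp
        have "isCont Z t" using cZ \<open>t > 0\<close> by (simp add: continuous_on_eq_continuous_at)
        moreover have "eventually (\<lambda>s. f s = Z s) (nhds t)"
          using eventually_nhds_in_open[of "{0<..}" t] \<open>t > 0\<close> by (auto elim!: eventually_mono simp: fZ)
        ultimately have "isCont f t" using isCont_cong[of f Z t] by simp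
        then show ?thesis by (rule continuous_at_imp_continuous_at_within)
      qed
    qed
    have "(LINT t:{0..T}|lebesgue. f t) = integral {0..T} f"
      by (rule set_lebesgue_integral_eq_integral(2)[OF absolutely_integrable_continuous_real[OF cf]])
    also have "integral {0..T} f \<le> B / \<delta> * \<epsilon>"
    proof (rule tendsto_upperbound)
      have "continuous_on {0..T} (\<lambda>s. integral {s..T} f)"
        by (rule indefinite_integral_continuous_1'[OF integrable_continuous_interval[OF cf]])
      then show "((\<lambda>s. integral {s..T} f) \<longlongrightarrow> integral {0..T} f) (at 0 within {0..T})"
        using T by (simp add: continuous_on_def)
      show "eventually (\<lambda>s. integral {s..T} f \<le> B / \<delta> * \<epsilon>) (at 0 within {0..T})"
        unfolding eventually_at_filter using bound by (auto intro!: always_eventually)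
      show "at 0 within {0..T} \<noteq> bot"
        using T by (simp add: trivial_limit_within islimpt_Icc)
    qed
    finally show ?thesis by (simp add: f_def)
  qed
  show ?thesis
    by (intro exI[of _ "B / \<delta>"] exI[of _ "\<kappa>\<^sup>2 / (B + 1)"] conjI allI impI main)
       (use \<kappa>(1) B0 in auto)
qed

theorem theorem2p6:
  fixes \<delta> r :: real
    and u0 :: "real \<Rightarrow> real"
    and u_eps :: "real \<Rightarrow> real \<Rightarrow> real \<Rightarrow> real"
    and u :: "real \<Rightarrow> real \<Rightarrow> real"
  assumes "\<delta> > 0" and "r \<ge> 0"
    and "sobolev 1 u0" and "AE x in lebesgue_on dom_I. u0 x \<ge> 0"
    and "\<And>\<epsilon>. \<epsilon> > 0 \<Longrightarrow> strong_solution \<delta> r \<epsilon> \<infinity> u0 (u_eps \<epsilon>)"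
    and "\<And>\<epsilon> t. \<epsilon> > 0 \<Longrightarrow> t \<ge> 0 \<Longrightarrow> AE x in lebesgue_on dom_I. u_eps \<epsilon> t x \<ge> 0"
    and "limit_solution \<delta> r u0 u"
    and "\<And>t x. t \<ge> 0 \<Longrightarrow> x \<in> {-1..1} \<Longrightarrow> u t x \<ge> 0"
  shows "\<forall>T>0. ((\<lambda>\<epsilon>. LINT t:{0..T}|lebesgue. (L2_norm (\<lambda>x. u_eps \<epsilon> t x - u t x))\<^sup>2)
                 \<longlongrightarrow> 0) (at_right 0)"
proof (intro allI impI)
  fix T :: real assume "T > 0"
  have "\<exists>C \<epsilon>0. \<epsilon>0 > 0 \<and> (\<forall>\<epsilon> v. 0 < \<epsilon> \<longrightarrow> \<epsilon> < \<epsilon>0 \<longrightarrow> strong_solution \<delta> r \<epsilon> \<infinity> u0 v \<longrightarrow>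
     (\<forall>t\<ge>0. AE x in lebesgue_on dom_I. v t x \<ge> 0) \<longrightarrow>
     (LINT t:{0..T}|lebesgue. (L2_norm (\<lambda>x. v t x - u t x))\<^sup>2) \<le> C * \<epsilon>)"
    by (rule convergence_rate[OF assms(1,2) \<open>T > 0\<close> assms(7)]) (rule assms(8))
  then obtain C \<epsilon>0 where \<epsilon>0: "\<epsilon>0 > 0"
    and rate: "\<forall>\<epsilon> v. 0 < \<epsilon> \<longrightarrow> \<epsilon> < \<epsilon>0 \<longrightarrow> strong_solution \<delta> r \<epsilon> \<infinity> u0 v \<longrightarrow>
     (\<forall>t\<ge>0. AE x in lebesgue_on dom_I. v t x \<ge> 0) \<longrightarrow>
     (LINT t:{0..T}|lebesgue. (L2_norm (\<lambda>x. v t x - u t x))\<^sup>2) \<le> C * \<epsilon>"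
    by blast
  have bound: "(LINT t:{0..T}|lebesgue. (L2_norm (\<lambda>x. u_eps \<epsilon> t x - u t x))\<^sup>2) \<le> C * \<epsilon>"
    if "0 < \<epsilon>" "\<epsilon> < \<epsilon>0" for \<epsilon>
    using rate[rule_format, OF that assms(5)[OF that(1)] assms(6)[OF that(1)]] .
  show "((\<lambda>\<epsilon>. LINT t:{0..T}|lebesgue. (L2_norm (\<lambda>x. u_eps \<epsilon> t x - u t x))\<^sup>2) \<longlongrightarrow> 0) (at_right 0)"
  proof (rule tendsto_sandwich[OF _ _ tendsto_const])
    show "eventually (\<lambda>\<epsilon>. 0 \<le> (LINT t:{0..T}|lebesgue. (L2_norm (\<lambda>x. u_eps \<epsilon> t x - u t x))\<^sup>2)) (at_right 0)"
      by (intro always_eventually allI) (simp add: set_lebesgue_integral_def Bochner_Integration.integral_nonneg)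
    show "eventually (\<lambda>\<epsilon>. (LINT t:{0..T}|lebesgue. (L2_norm (\<lambda>x. u_eps \<epsilon> t x - u t x))\<^sup>2) \<le> C * \<epsilon>) (at_right 0)"
      unfolding eventually_at_right_field using \<epsilon>0 bound by blast
    show "((\<lambda>\<epsilon>. C * \<epsilon>) \<longlongrightarrow> 0) (at_right 0)"
      by (rule tendsto_mult_right_zero[OF tendsto_ident_at])
  qed
qed

end
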